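(* Let $n\in\mathbb N$ and $-1<\ell\le 0$ be such that $(1+\ell)n>1$, let $\mu^2>\tfrac14$, and let $p_*=p_*(n,\ell)>1$ be the unique positive root of $$\gamma(n,\ell;p)=\bigl((1+\ell)n-1\bigr)p^2-\bigl((1+\ell)n+1-2\ell\bigr)p-2(1+\ell).$$ Suppose that $f\in H^1(\mathbb R^n)$, $g\in L^2(\mathbb R^n)$, $f,g\ge 0$ a.e., $(f,g)\ne(0,0)$, and that for some $0<R<(1+\ell)^{-1}$ one has $\operatorname{supp} f\cup\operatorname{supp} g\subset\overline{B_R}$. Then, for every $\varepsilon>0$, any weak solution with finite speed of propagation (with propagation radius $R$) of $$\begin{cases} u_{tt}-(1+t)^{2\ell}\Delta u+\dfrac{\mu^2}{(1+t)^2}u=|u|^{p_*},\\ u(0,x)=\varepsilon f(x),\quad u_t(0,x)=\varepsilon g(x),\end{cases}$$ blows up in finite time, that is, its maximal existence time $T_\varepsilon$ is finite. Moreover, there exist constants $\varepsilon_0>0$ and $C>0$, independent of $\varepsilon$, such that, for every $0<\varepsilon\le\varepsilon_0$, $$T_\varepsilon\le \exp\bigl(C\varepsilon^{-p_*(p_*-1)}\bigr).$$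
   Context: Notation: $B_r=\{x\in\mathbb R^n:|x|<r\}$, $a(t)=(1+t)^\ell$, $A(t)=\int_0^t a(s)\,ds=\frac{(1+t)^{1+\ell}-1}{1+\ell}$, $V(t)=\frac{\mu^2}{(1+t)^2}$. Weak solution with finite speed of propagation: let $T\in(0,\infty]$, $p>1$, $\varepsilon>0$. A function $u$ is a weak solution on $[0,T)$ with finite speed of propagation (with propagation radius $R$) of $u_{tt}-a(t)^2\Delta u+V(t)u=|u|^p$, $u(0,\cdot)=\varepsilon f$, $u_t(0,\cdot)=\varepsilon g$, if: (i) $u\in C^1([0,T);L^1_{\mathrm{loc}}(\mathbb R^n))$ and $|u|^p\in L^1_{\mathrm{loc}}([0,T)\times\mathbb R^n)$; (ii) $\operatorname{supp} f\cup\operatorname{supp} g\subset\overline{B_R}$ and $\operatorname{supp}u(t,\cdot)\subset\overline{B_{R+A(t)}}$ for all $t\in[0,T)$; (iii) for every $\psi\in C_c^\infty([0,T)\times\mathbb R^n)$, $$\int_0^T\!\!\int_{\mathbb R^n}u\,(\psi_{tt}-a(t)^2\Delta\psi+V(t)\psi)\,dx\,dt=\int_0^T\!\!\int_{\mathbb R^n}|u|^p\psi\,dx\,dt+\varepsilon\int_{\mathbb R^n}\bigl(g(x)\psi(0,x)-f(x)\psi_t(0,x)\bigr)dx.$$ The maximal existence time $T_\varepsilon\in(0,\infty]$ of such a solution is the supremum of all $T'>0$ such that it exists (i.e. extends) as a weak solution in this sense on $[0,T')$. The constants $\varepsilon_0,C$ may depend on $n,\ell,\mu,R,f,g$ but not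 on $\varepsilon$ or on the lifespan. *)

theory Defs
  imports "HOL-Analysis.Analysis"
begin

definition partial :: "'a::euclidean_space \<Rightarrow> ('a \<Rightarrow> real) \<Rightarrow> 'a \<Rightarrow> real" where
  "partial v f x = frechet_derivative f (at x) v"

primrec Ck :: "nat \<Rightarrow> ('a::euclidean_space \<Rightarrow> real) \<Rightarrow> bool" where
  "Ck 0 f \<longleftrightarrow> continuous_on UNIV f"
| "Ck (Suc k) f \<longleftrightarrow> (\<forall>x. f differentiable (at x)) \<and> (\<forall>v\<in>Basis. Ck k (partial v f))"

definition smooth :: "('a::euclidean_space \<Rightarrow> real) \<Rightarrow> bool" where
  "smooth f \<longleftrightarrow> (\<forall>k. Ck k f)"

definition test_function :: "'a::euclidean_space set \<Rightarrow> ('a \<Rightarrow> real) \<Rightarrow> bool" where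
  "test_function \<Omega> \<phi> \<longleftrightarrow>
     smooth \<phi> \<and> compact (closure {x. \<phi> x \<noteq> 0}) \<and> closure {x. \<phi> x \<noteq> 0} \<subseteq> \<Omega>"

text \<open>Elements of the spaces below are represented by functions; every notion is
  invariant under changing them on a Lebesgue null set.\<close>

definition L2 :: "('a::euclidean_space \<Rightarrow> real) \<Rightarrow> bool" where
  "L2 f \<longleftrightarrow> f \<in> borel_measurable lebesgue \<and> integrable lebesgue (\<lambda>x. (f x)\<^sup>2)"

definition weak_partial ::
    "'a::euclidean_space \<Rightarrow> ('a \<Rightarrow> real) \<Rightarrow> ('a \<Rightarrow> real) \<Rightarrow> bool" where
  "weak_partial v f h \<longleftrightarrow>
     (\<forall>\<phi>. test_function UNIV \<phi> \<longrightarrow>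
        (LINT x|lebesgue. f x * partial v \<phi> x) = - (LINT x|lebesgue. h x * \<phi> x))"

definition H1 :: "('a::euclidean_space \<Rightarrow> real) \<Rightarrow> bool" where
  "H1 f \<longleftrightarrow> L2 f \<and> (\<forall>v\<in>Basis. \<exists>h. L2 h \<and> weak_partial v f h)"

definition L1_loc :: "'a::euclidean_space set \<Rightarrow> ('a \<Rightarrow> real) \<Rightarrow> bool" where
  "L1_loc S f \<longleftrightarrow> (\<forall>K. compact K \<and> K \<subseteq> S \<longrightarrow> set_integrable lebesgue K f)"

definition ess_supp :: "('a::euclidean_space \<Rightarrow> real) \<Rightarrow> 'a set" where
  "ess_supp f = - \<Union>{U. open U \<and> (AE x in lebesgue. x \<in> U \<longrightarrow> f x = 0)}"

definition time_interval :: "ereal \<Rightarrow> real set" where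
  "time_interval T = {t. 0 \<le> t \<and> ereal t < T}"

text \<open>Continuous differentiability with values in the Frechet space of locally integrable
  functions, whose seminorms are the \<open>L\<^sup>1\<close>-norms over compact sets; the witness
  \<open>v\<close> is the time derivative (one-sided at time 0).\<close>

definition C1_L1_loc :: "ereal \<Rightarrow> (real \<Rightarrow> 'a::euclidean_space \<Rightarrow> real) \<Rightarrow> bool" where
  "C1_L1_loc T u \<longleftrightarrow>
     (\<forall>t\<in>time_interval T. L1_loc UNIV (u t)) \<and>
     (\<exists>v. (\<forall>t\<in>time_interval T. L1_loc UNIV (v t)) \<and>
        (\<forall>K. compact K \<longrightarrow> (\<forall>t\<in>time_interval T.
           ((\<lambda>s. LINT x:K|lebesgue. \<bar>(u s x - u t x) / (s - t) - v t x\<bar>) \<longlongrightarrow> 0)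
              (at t within time_interval T) \<and>
           ((\<lambda>s. LINT x:K|lebesgue. \<bar>v s x - v t x\<bar>) \<longlongrightarrow> 0)
              (at t within time_interval T))))"

definition speed :: "real \<Rightarrow> real \<Rightarrow> real" where
  "speed l t = (1 + t) powr l"

definition distance :: "real \<Rightarrow> real \<Rightarrow> real" where
  "distance l t = integral {0..t} (speed l)"

lemma distance_eq:
  assumes "-1 < l" "0 \<le> t"
  shows "distance l t = ((1 + t) powr (1 + l) - 1) / (1 + l)"
proof -
  have "(speed l has_integral
          (1 + t) powr (1 + l) / (1 + l) - (1 + 0) powr (1 + l) / (1 + l)) {0..t}"
    unfolding speed_def using assms
    by (intro fundamental_theorem_of_calculus)
       (auto intro!: derivative_eq_intros
          simp flip: has_real_derivative_iff_has_vector_derivative)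
  then show ?thesis
    by (simp add: distance_def integral_unique diff_divide_distrib)
qed

definition potential :: "real \<Rightarrow> real \<Rightarrow> real" where
  "potential \<mu> t = \<mu>\<^sup>2 / (1 + t)\<^sup>2"

definition time_deriv :: "(real \<times> (real^'n) \<Rightarrow> real) \<Rightarrow> real \<times> (real^'n) \<Rightarrow> real" where
  "time_deriv = partial (1, 0)"

definition laplacian :: "(real \<times> (real^'n) \<Rightarrow> real) \<Rightarrow> real \<times> (real^'n) \<Rightarrow> real" where
  "laplacian \<psi> z = (\<Sum>i\<in>UNIV. partial (0, axis i 1) (partial (0, axis i 1) \<psi>) z)"

definition wave_op ::
    "real \<Rightarrow> real \<Rightarrow> (real \<times> (real^'n) \<Rightarrow> real) \<Rightarrow> real \<Rightarrow> real^'n \<Rightarrow> real" where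
  "wave_op l \<mu> \<psi> t x =
     time_deriv (time_deriv \<psi>) (t, x) - (speed l t)\<^sup>2 * laplacian \<psi> (t, x)
       + potential \<mu> t * \<psi> (t, x)"

text \<open>Test functions with compact support in \<open>[0,T) \<times> \<real>\<^sup>n\<close> are the restrictions to
  nonnegative times of test functions on \<open>(-\<infinity>,T) \<times> \<real>\<^sup>n\<close>; they need not vanish at time 0.\<close>

definition weak_solution ::
    "real \<Rightarrow> real \<Rightarrow> real \<Rightarrow> real \<Rightarrow> real \<Rightarrow> (real^'n \<Rightarrow> real) \<Rightarrow> (real^'n \<Rightarrow> real)
      \<Rightarrow> ereal \<Rightarrow> (real \<Rightarrow> real^'n \<Rightarrow> real) \<Rightarrow> bool" where
  "weak_solution l \<mu> p R \<epsilon> f g T u \<longleftrightarrow>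
     0 < T \<and>
     C1_L1_loc T u \<and>
     L1_loc (time_interval T \<times> UNIV) (\<lambda>(t, x). \<bar>u t x\<bar> powr p) \<and>
     ess_supp f \<union> ess_supp g \<subseteq> cball 0 R \<and>
     (\<forall>t\<in>time_interval T. ess_supp (u t) \<subseteq> cball 0 (R + distance l t)) \<and>
     (\<forall>\<psi>. test_function {(t, x). ereal t < T} \<psi> \<longrightarrow>
        (LINT t:time_interval T|lebesgue. LINT x|lebesgue. u t x * wave_op l \<mu> \<psi> t x)
        = (LINT t:time_interval T|lebesgue. LINT x|lebesgue. \<bar>u t x\<bar> powr p * \<psi> (t, x))
          + \<epsilon> * (LINT x|lebesgue. g x * \<psi> (0, x) - f x * time_deriv \<psi> (0, x)))"

definition lifespan ::
    "real \<Rightarrow> real \<Rightarrow> real \<Rightarrow> real \<Rightarrow> real \<Rightarrow> (real^'n \<Rightarrow> real) \<Rightarrow> (real^'n \<Rightarrow> real)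
      \<Rightarrow> ereal \<Rightarrow> (real \<Rightarrow> real^'n \<Rightarrow> real) \<Rightarrow> ereal" where
  "lifespan l \<mu> p R \<epsilon> f g T u =
     Sup {T'. \<exists>w. weak_solution l \<mu> p R \<epsilon> f g T' w \<and>
        (\<forall>t\<in>time_interval (min T T'). AE x in lebesgue. w t x = u t x)}"

definition strauss_poly :: "nat \<Rightarrow> real \<Rightarrow> real \<Rightarrow> real" where
  "strauss_poly n l p =
     ((1 + l) * real n - 1) * p\<^sup>2 - ((1 + l) * real n + 1 - 2 * l) * p - 2 * (1 + l)"

definition p_star :: "nat \<Rightarrow> real \<Rightarrow> real" where
  "p_star n l = (THE p. 0 < p \<and> strauss_poly n l p = 0)"

lemma ex1_pos_root:
  assumes "-1 < l" "l \<le> 0" "(1 + l) * real n > 1"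
  shows "\<exists>!p. 0 < p \<and> strauss_poly n l p = 0"
proof -
  define A where "A = (1 + l) * real n - 1"
  define B where "B = (1 + l) * real n + 1 - 2 * l"
  define c where "c = 2 * (1 + l)"
  have A: "A > 0" and c: "c > 0" and B: "B > 0"
    using assms by (auto simp: A_def B_def c_def)
  have eq: "strauss_poly n l p = A * p\<^sup>2 - B * p - c" for p
    by (simp add: strauss_poly_def A_def B_def c_def)
  have uniq: "p = q" if "0 < p" "A * p\<^sup>2 - B * p - c = 0" "0 < q" "A * q\<^sup>2 - B * q - c = 0"
    for p q
  proof -
    have "(p - q) * (A * p * q + c) = p * (A * p * q) - q * (A * p * q) + (p - q) * c"
      by (simp add: algebra_simps)
    also have "\<dots> = q * (A * p\<^sup>2 - B * p - c) - p * (A * q\<^sup>2 - B * q - c)"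
      by (simp add: algebra_simps power2_eq_square)
    finally have "(p - q) * (A * p * q + c) = 0"
      using that by simp
    moreover have "A * p * q + c > 0"
      using A c that by (simp add: add_pos_pos)
    ultimately show ?thesis by simp
  qed
  have "\<exists>p\<ge>0. p \<le> (B + c + A) / A \<and> A * p\<^sup>2 - B * p - c = 0"
  proof (rule IVT')
    let ?m = "(B + c + A) / A"
    have m: "?m \<ge> 1" using A B c by simp
    have "A * ?m\<^sup>2 - B * ?m - c = (c + A) * ?m - c"
      using A by (simp add: power2_eq_square field_simps)
    also have "\<dots> \<ge> 0"
      using mult_left_mono[OF m, of "c + A"] A c by simp
    finally show "0 \<le> A * ?m\<^sup>2 - B * ?m - c" .
    show "A * 0\<^sup>2 - B * 0 - c \<le> 0" using c by simp
    show "0 \<le> ?m" using m by simp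
    show "continuous_on {0..?m} (\<lambda>p. A * p\<^sup>2 - B * p - c)"
      by (intro continuous_intros)
  qed
  then obtain p where "p \<ge> 0" "A * p\<^sup>2 - B * p - c = 0" by blast
  moreover from this c have "p \<noteq> 0" by auto
  ultimately show ?thesis
    unfolding eq using uniq by (metis less_eq_real_def)
qed

lemma p_star:
  assumes "-1 < l" "l \<le> 0" "(1 + l) * real n > 1"
  shows "1 < p_star n l" "strauss_poly n l (p_star n l) = 0"
proof -
  let ?p = "p_star n l"
  have *: "0 < ?p \<and> strauss_poly n l ?p = 0"
    unfolding p_star_def by (rule theI', rule ex1_pos_root[OF assms])
  then show "strauss_poly n l ?p = 0" by simp
  show "1 < ?p"
  proof (rule ccontr)
    assume "\<not> 1 < ?p"
    then have "?p\<^sup>2 \<le> ?p" using * by (simp add: power2_eq_square mult_left_le)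
    then have "((1 + l) * real n - 1) * ?p\<^sup>2 \<le> ((1 + l) * real n - 1) * ?p"
      using assms by (intro mult_left_mono) auto
    moreover have "(2 - 2 * l) * ?p \<ge> 0" using * assms by simp
    ultimately have "strauss_poly n l ?p < 0"
      using assms by (simp add: strauss_poly_def algebra_simps)
    with * show False by simp
  qed
qed

end

theory Submission
  imports Defs
begin

text \<open>
  With \<open>s = 1 + t\<close>, \<open>m = 1 + l\<close>, \<open>n\<close> the dimension and \<open>z = m\<^sup>2 |x|\<^sup>2 / s\<^bsup>2m\<^esup>\<close>, the linear equation has
  the self-similar solutions \<open>s\<^bsup>-\<beta>\<^esup> F(z)\<close> with \<open>F\<close> hypergeometric. For \<open>\<beta> > 0\<close> the coefficients
  of \<open>F\<close> are positive, and \<open>F\<close>, \<open>F'\<close> are at most of order \<open>(1 - z)\<^bsup>-\<kappa>\<^esup>\<close> when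
  \<open>\<beta> = m (\<kappa> - 1) + (m n - 1) / 2\<close>. As \<open>R < 1 / m\<close>, the solution lives where \<open>z\<close> stays
  below \<open>1\<close>, so a partial sum of \<open>F\<close> times a cutoff \<open>\<eta>\<close> in \<open>s / S\<close> is an admissible test function;
  the recursion of the coefficients telescopes and leaves a single error term, which vanishes in the
  limit. There remain only terms with derivatives of \<open>\<eta>\<close>, supported in the shell \<open>S/2 \<le> s \<le> S\<close>, and
  Hoelder's inequality bounds them by the mass of \<open>s\<^bsup>-\<beta>'\<^esup> |u|\<^sup>p\<close> in that shell, where \<open>\<beta>'\<close> belongs to
  \<open>\<kappa> = 1 - 1 / p\<close>. All powers of \<open>S\<close> cancel precisely because \<open>p\<close> is the critical exponent.

  For \<open>\<kappa> = 1\<close> this says that the mass \<open>D\<^sub>j\<close> of the shell \<open>S = 2\<^sup>j\<close> is at least of order \<open>\<epsilon>\<^sup>p\<close>. For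
  \<open>\<kappa> = 1 - 1 / p\<close>, where the cone integral is a harmonic sum and grows like \<open>log S\<close>, it says that
  \<open>D\<^sub>2 + \<dots> + D\<^sub>j\<^sub>-\<^sub>1\<close> is at most of order \<open>D\<^sub>j\<^bsup>1/p\<^esup> j\<^bsup>1-1/p\<^esup>\<close> and of order \<open>j\<close>. These inequalities
  can hold only for \<open>j\<close> up to order \<open>\<epsilon>\<^bsup>-p(p-1)\<^esup>\<close>, that is, for times up to \<open>exp (C \<epsilon>\<^bsup>-p(p-1)\<^esup>)\<close>.
\<close>

subsection \<open>Smooth functions and cutoffs\<close>

text \<open>The exponent \<kappa> belongs to F'. The hypergeometric parameters a, b satisfy a + b =
  (2 \<beta> + 1) / (2 m), and F' is of order n / 2 - a - b - 1 at z = 1; equating this with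
  -\<kappa> gives the formula for \<beta>. Hoelder's inequality raises the weight to the conjugate
  exponent p' = p / (p - 1), and the cone integral then behaves like the sum of k^(-\<kappa> p'),
  which is bounded for \<kappa> = 1 and harmonic for \<kappa> = 1 - 1 / p. The power of S does not
  depend on \<kappa>, since the term m \<kappa> in \<beta> compensates the stronger singularity; so
  one critical p serves both choices.

  F itself blows up on the cone and is no test function. Its partial sums are polynomials in |x|^2,
  and R < 1 / m keeps the support at distance \<delta> = 1 / m - R inside the cone. On a bounded
  time interval z is then at most some number below 1, and the error term decays geometrically in
  the number of summands. Layers of thickness \<delta> below the cone produce the sum over k.

  No joint Borel measurability of u is available, so |u|^p is replaced by a Borel version before
  Fubini's theorem is used.\<close>

lemma partial_eq:
  assumes "(f has_derivative f') (at x)"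
  shows "partial v f x = f' v"
  using frechet_derivative_at[OF assms] by (simp add: partial_def)

lemma partial_has_derivative:
  assumes "f differentiable (at x)"
  shows "(f has_derivative (\<lambda>v. partial v f x)) (at x)"
  using assms unfolding partial_def by (simp add: frechet_derivative_works)

lemma Ck_SucI:
  assumes "\<And>x. (f has_derivative f' x) (at x)" "\<And>v. v \<in> Basis \<Longrightarrow> Ck k (\<lambda>x. f' x v)"
  shows "Ck (Suc k) f"
proof -
  have "partial v f = (\<lambda>x. f' x v)" for v
    using partial_eq[OF assms(1)] by auto
  then show ?thesis using assms by (auto simp: differentiable_def)
qed

lemma Ck_Suc_has_derivative:
  "Ck (Suc k) f \<Longrightarrow> (f has_derivative (\<lambda>v. partial v f x)) (at x)"
  by (simp add: partial_has_derivative)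

lemma Ck_SucD: "Ck (Suc k) f \<Longrightarrow> Ck k f"
proof (induction k arbitrary: f)
  case 0
  then show ?case
    by (auto intro!: continuous_at_imp_continuous_on differentiable_imp_continuous_within)
next
  case (Suc k)
  then show ?case by simp
qed

lemma Ck_const: "Ck k (\<lambda>x. c)"
proof (induction k arbitrary: c)
  case (Suc k)
  show ?case by (rule Ck_SucI[where f' = "\<lambda>x v. 0"]) (auto simp: Suc)
qed simp

lemma Ck_add: "Ck k f \<Longrightarrow> Ck k g \<Longrightarrow> Ck k (\<lambda>x. f x + g x)"
proof (induction k arbitrary: f g)
  case 0
  then show ?case by (auto intro: continuous_intros)
next
  case (Suc k)
  show ?case
    by (rule Ck_SucI[OF has_derivative_add[OF Ck_Suc_has_derivative[OF Suc.prems(1)]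
          Ck_Suc_has_derivative[OF Suc.prems(2)]]])
       (use Suc in auto)
qed

lemma Ck_mult: "Ck k f \<Longrightarrow> Ck k g \<Longrightarrow> Ck k (\<lambda>x. f x * g x)"
proof (induction k arbitrary: f g)
  case 0
  then show ?case by (auto intro: continuous_intros)
next
  case (Suc k)
  show ?case
    by (rule Ck_SucI[OF has_derivative_mult[OF Ck_Suc_has_derivative[OF Suc.prems(1)]
          Ck_Suc_has_derivative[OF Suc.prems(2)]]])
       (use Suc Suc.prems[THEN Ck_SucD] in \<open>auto intro!: Ck_add\<close>)
qed

text \<open>The chain rule gives \<open>partial 1 h\<close> after \<open>q\<close>, times a
  derivative of \<open>q\<close>; hence the induction varies \<open>h\<close> and keeps
  \<open>q\<close> fixed.\<close>

lemma Ck_compose: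
  fixes h :: "real \<Rightarrow> real"
  shows "Ck k h \<Longrightarrow> Ck k q \<Longrightarrow> Ck k (\<lambda>x. h (q x))"
proof (induction k arbitrary: h)
  case 0
  then show ?case using continuous_on_compose2[of UNIV h UNIV q] by simp
next
  case (Suc k)
  have h: "(h has_derivative (\<lambda>v. v * partial 1 h y)) (at y)" for y
  proof -
    have d: "(h has_derivative (\<lambda>v. partial v h y)) (at y)"
      by (rule Ck_Suc_has_derivative[OF Suc.prems(1)])
    have "partial v h y = v * partial 1 h y" for v
      using linear_scale[OF has_derivative_linear[OF d], of v 1] by simp
    then show ?thesis by (intro has_derivative_eq_rhs[OF d] ext)
  qed
  have "Ck k (partial 1 h)" using Suc.prems(1) by simp
  from Suc.IH[OF this Ck_SucD[OF Suc.prems(2)]] Suc.prems(2) show ?case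
    by (intro Ck_SucI[OF has_derivative_compose[OF Ck_Suc_has_derivative[OF Suc.prems(2)] h]] Ck_mult)
       simp_all
qed

text \<open>Not an instance of \<open>Ck_compose\<close>, because a real power need not be smooth at
  0. The exponent drops by one with each derivative and is generalised in the induction.\<close>

lemma Ck_powr:
  assumes "\<And>x. 0 < q x"
  shows "Ck k q \<Longrightarrow> Ck k (\<lambda>x. q x powr r)"
proof (induction k arbitrary: r)
  case 0
  have "\<forall>x. q x \<noteq> 0" using assms by (metis less_irrefl)
  with 0 show ?case by (auto intro: continuous_intros)
next
  case (Suc k)
  have d: "((\<lambda>x. q x powr r) has_derivative (\<lambda>v. partial v q x * (r * q x powr (r - 1)))) (at x)" for x
  proof (rule has_derivative_compose[OF Ck_Suc_has_derivative[OF Suc.prems]])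
    show "((\<lambda>y. y powr r) has_derivative (\<lambda>v. v * (r * q x powr (r - 1)))) (at (q x))"
      using has_real_derivative_powr[OF assms[of x], of r]
      unfolding has_field_derivative_def
      by (rule has_derivative_eq_rhs) (simp add: fun_eq_iff)
  qed
  from Suc.IH[OF Ck_SucD[OF Suc.prems], of "r - 1"] Suc.prems show ?case
    by (intro Ck_SucI[OF d] Ck_mult Ck_const) simp_all
qed

lemma Ck_bounded_linear:
  assumes "bounded_linear f"
  shows "Ck k f"
proof (cases k)
  case 0
  then show ?thesis using assms by (simp add: linear_continuous_on)
next
  case (Suc j)
  show ?thesis unfolding Suc
    by (rule Ck_SucI[OF bounded_linear_imp_has_derivative[OF assms]]) (rule Ck_const)
qed

lemma smooth_const [intro]: "smooth (\<lambda>x. c)"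
  and smooth_add [intro]: "smooth f \<Longrightarrow> smooth g \<Longrightarrow> smooth (\<lambda>x. f x + g x)"
  and smooth_mult [intro]: "smooth f \<Longrightarrow> smooth g \<Longrightarrow> smooth (\<lambda>x. f x * g x)"
  and smooth_compose: "smooth h \<Longrightarrow> smooth f \<Longrightarrow> smooth (\<lambda>x. h (f x))"
  and smooth_powr: "(\<And>x. 0 < f x) \<Longrightarrow> smooth f \<Longrightarrow> smooth (\<lambda>x. f x powr r)"
  and smooth_bounded_linear: "bounded_linear f \<Longrightarrow> smooth f"
  for f g :: "'a::euclidean_space \<Rightarrow> real" and h :: "real \<Rightarrow> real"
  by (simp_all add: smooth_def Ck_const Ck_add Ck_mult Ck_compose Ck_powr Ck_bounded_linear)

lemma smooth_sum [intro]: "(\<And>i. i \<in> I \<Longrightarrow> smooth (f i)) \<Longrightarrow> smooth (\<lambda>x. \<Sum>i\<in>I. f i x)"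
  by (induction I rule: infinite_finite_induct) auto

lemma smooth_power [intro]: "smooth f \<Longrightarrow> smooth (\<lambda>x. f x ^ k)"
  by (induction k) auto

lemma smooth_inner_self: "smooth (\<lambda>x::'a::euclidean_space. x \<bullet> x)"
proof -
  have "smooth (\<lambda>x::'a. \<Sum>b\<in>Basis. (x \<bullet> b) * (x \<bullet> b))"
    by (intro smooth_sum smooth_mult smooth_bounded_linear bounded_linear_inner_left)
  then show ?thesis by (simp add: euclidean_inner[symmetric])
qed

lemma smooth_differentiable: "smooth f \<Longrightarrow> f differentiable (at x)"
  unfolding smooth_def by (metis Ck.simps(2))

lemma smooth_partial: "smooth f \<Longrightarrow> v \<in> Basis \<Longrightarrow> smooth (partial v f)"
  unfolding smooth_def by (metis Ck.simps(2))

lemma smooth_continuous: "smooth f \<Longrightarrow> continuous_on S f"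
  unfolding smooth_def by (metis Ck.simps(1) continuous_on_subset subset_UNIV)

lemma smooth_has_derivative: "smooth f \<Longrightarrow> (f has_derivative (\<lambda>v. partial v f x)) (at x)"
  by (simp add: partial_has_derivative smooth_differentiable)

lemma smooth_deriv: "smooth h \<Longrightarrow> smooth (partial 1 h)" for h :: "real \<Rightarrow> real"
  by (rule smooth_partial) auto

lemma smooth_has_real_derivative:
  fixes h :: "real \<Rightarrow> real"
  assumes "smooth h"
  shows "(h has_real_derivative partial 1 h x) (at x)"
proof -
  have d: "(h has_derivative (\<lambda>v. partial v h x)) (at x)"
    by (rule smooth_has_derivative[OF assms])
  have "partial v h x = v * partial 1 h x" for v
    using linear_scale[OF has_derivative_linear[OF d], of v 1] by simp
  then show ?thesis
    unfolding has_field_derivative_def by (intro has_derivative_eq_rhs[OF d] ext) (metis mult.commute)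
qed

lemma partial_real_eq: "(h has_real_derivative d) (at x) \<Longrightarrow> partial 1 h x = d"
  by (simp add: partial_eq[of _ "(*) d"] has_field_derivative_def)

section \<open>A smooth cutoff made from exp(-1/x)\<close>

definition exp_flat :: "nat \<Rightarrow> real \<Rightarrow> real" where
  "exp_flat k x = (if 0 < x then inverse x ^ k * exp (- inverse x) else 0)"

lemma exp_flat_quotient: "exp_flat k x / x = exp_flat (Suc k) x"
  by (simp add: exp_flat_def field_simps)

lemma tendsto_exp_flat: "(exp_flat k \<longlongrightarrow> 0) (at 0)"
proof -
  have "((\<lambda>x. inverse x ^ k * exp (- inverse x)) \<longlongrightarrow> 0) (at_right (0::real))"
    using filterlim_compose[OF tendsto_power_div_exp_0 filterlim_inverse_at_top_right, of k]
    by (simp add: exp_minus field_simps)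
  moreover have "eventually (\<lambda>x. inverse x ^ k * exp (- inverse x) = exp_flat k x) (at_right (0::real))"
    by (auto simp: eventually_at_right_field exp_flat_def intro!: exI[of _ 1])
  ultimately have r: "(exp_flat k \<longlongrightarrow> 0) (at_right 0)"
    by (rule Lim_transform_eventually)
  have "eventually (\<lambda>x. 0 = exp_flat k x) (at_left (0::real))"
    by (auto simp: eventually_at_left_field exp_flat_def intro!: exI[of _ "-1"])
  then have "(exp_flat k \<longlongrightarrow> 0) (at_left 0)"
    by (rule Lim_transform_eventually[OF tendsto_const])
  with r show ?thesis by (simp add: filterlim_split_at)
qed

text \<open>The reason for the parameter \<open>k\<close>: differentiation stays within the linear
  span of the family, so one induction gives smoothness of all members at once.\<close>

lemma exp_flat_has_derivative:
  "(exp_flat k has_real_derivative (exp_flat (k + 2) x - real k * exp_flat (k + 1) x)) (at x)"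
proof -
  consider "x > 0" | "x < 0" | "x = 0" by linarith
  then show ?thesis
  proof cases
    case 1
    have e: "real k * inverse x ^ (k - Suc 0) * inverse x * inverse x = real k * inverse x ^ (k + 1)"
      by (cases k) (auto simp: algebra_simps)
    have "((\<lambda>x. inverse x ^ k * exp (- inverse x)) has_real_derivative
        inverse x ^ (k + 2) * exp (- inverse x)
        - (real k * inverse x ^ (k - Suc 0) * inverse x * inverse x) * exp (- inverse x)) (at x)"
      by (rule derivative_eq_intros refl | use 1 in \<open>simp add: algebra_simps\<close>)+
    then have "((\<lambda>x. inverse x ^ k * exp (- inverse x)) has_real_derivative
        (exp_flat (k + 2) x - real k * exp_flat (k + 1) x)) (at x)"
      using 1 unfolding e by (simp add: exp_flat_def mult_ac)
    then show ?thesis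
      by (rule has_field_derivative_transform_within_open[where S = "{0<..}"])
         (use 1 in \<open>auto simp: exp_flat_def\<close>)
  next
    case 2
    have "((\<lambda>x. 0) has_real_derivative (exp_flat (k + 2) x - real k * exp_flat (k + 1) x)) (at x)"
      using 2 by (simp add: exp_flat_def)
    then show ?thesis
      by (rule has_field_derivative_transform_within_open[where S = "{..<0}"])
         (use 2 in \<open>auto simp: exp_flat_def\<close>)
  next
    \<comment> \<open>At 0 the difference quotient of a member is the next member of the family,
      which tends to 0.\<close>
    case 3
    have "((\<lambda>h. (exp_flat k (0 + h) - exp_flat k 0) / h) \<longlongrightarrow> 0) (at 0)"
      using tendsto_exp_flat[of "Suc k"] by (simp add: exp_flat_quotient exp_flat_def[of k 0])
    then show ?thesis using 3 by (simp add: DERIV_def exp_flat_def[of _ 0])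
  qed
qed

lemma smooth_exp_flat: "smooth (exp_flat k)"
proof -
  have "Ck j (exp_flat k)" for j
  proof (induction j arbitrary: k)
    case 0
    have "isCont (exp_flat k) x" for x by (rule DERIV_isCont[OF exp_flat_has_derivative])
    then show ?case by (simp add: continuous_at_imp_continuous_on)
  next
    case (Suc j)
    have "Ck j (\<lambda>x. exp_flat (k + 2) x + (- real k) * exp_flat (k + 1) x)"
      by (intro Ck_add Ck_mult Ck_const Suc)
    then show ?case
      by (intro Ck_SucI[OF exp_flat_has_derivative[unfolded has_field_derivative_def]]) simp
  qed
  then show ?thesis by (simp add: smooth_def)
qed

text \<open>Equal to 1 up to 1/2 and to 0 from 1 on. The two flat functions in the denominator never
  vanish together, and the power -1 in place of a division brings \<open>smooth_powr\<close> into
  play.\<close>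

definition smooth_step :: "real \<Rightarrow> real" where
  "smooth_step x = exp_flat 0 (1 - x) * (exp_flat 0 (1 - x) + exp_flat 0 (x - 1 / 2)) powr (-1)"

lemma exp_flat_nonneg: "0 \<le> exp_flat k x"
  by (simp add: exp_flat_def)

lemma smooth_step_denom_pos: "0 < exp_flat 0 (1 - x) + exp_flat 0 (x - 1 / 2)"
  by (cases "x < 1") (auto intro: add_pos_nonneg add_nonneg_pos exp_flat_nonneg simp: exp_flat_def)

lemma smooth_affine: "smooth (\<lambda>x::real. a + b * x)"
  by (intro smooth_add smooth_const smooth_bounded_linear bounded_linear_mult_right)

lemma smooth_smooth_step: "smooth smooth_step"
proof -
  have "smooth (\<lambda>x. exp_flat 0 (1 + (-1) * x))" "smooth (\<lambda>x. exp_flat 0 (- 1 / 2 + 1 * x))"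
    by (intro smooth_compose[OF smooth_exp_flat] smooth_affine)+
  then have s: "smooth (\<lambda>x. exp_flat 0 (1 - x))" "smooth (\<lambda>x. exp_flat 0 (x - 1 / 2))"
    by (simp_all add: algebra_simps)
  have "smooth (\<lambda>x. exp_flat 0 (1 - x) * (exp_flat 0 (1 - x) + exp_flat 0 (x - 1 / 2)) powr (-1))"
    using smooth_step_denom_pos by (intro smooth_mult smooth_powr smooth_add s) auto
  then show ?thesis by (simp add: smooth_step_def[abs_def])
qed

lemma smooth_step_eq_1: "x \<le> 1 / 2 \<Longrightarrow> smooth_step x = 1"
  by (simp add: smooth_step_def exp_flat_def powr_minus)

lemma smooth_step_eq_0: "1 \<le> x \<Longrightarrow> smooth_step x = 0"
  by (simp add: smooth_step_def exp_flat_def)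

lemma smooth_step_nonneg: "0 \<le> smooth_step x"
  by (simp add: smooth_step_def exp_flat_nonneg)

lemma smooth_step_le_1: "smooth_step x \<le> 1"
  using smooth_step_denom_pos[of x] exp_flat_nonneg[of 0 "x - 1/2"]
  by (simp add: smooth_step_def powr_minus field_simps)

subsection \<open>Coefficients of the self-similar solutions\<close>

text \<open>Writing (\<beta> + 2 m k) (\<beta> + 2 m k + 1) + \<mu>^2 = 4 m^2 (k + a) (k + b), these
  are the Taylor coefficients of the hypergeometric function with upper parameters a, b and lower
  parameter n / 2. For \<mu>^2 > 1/4 the numbers a and b are complex conjugates, so the real
  quadratic factor is kept unfactored.\<close>

primrec hyp_coeff :: "real \<Rightarrow> nat \<Rightarrow> real \<Rightarrow> real \<Rightarrow> nat \<Rightarrow> real" where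
  "hyp_coeff m n \<mu> \<beta> 0 = 1"
| "hyp_coeff m n \<mu> \<beta> (Suc k) = hyp_coeff m n \<mu> \<beta> k
     * ((\<beta> + 2 * m * real k) * (\<beta> + 2 * m * real k + 1) + \<mu>\<^sup>2)
     / (m\<^sup>2 * (2 * (real k + 1)) * (2 * real k + real n))"

lemma hyp_coeff_pos:
  assumes "0 < m" "0 < \<beta>" "0 < n"
  shows "0 < hyp_coeff m n \<mu> \<beta> k"
proof (induction k)
  case (Suc k)
  have "0 < (\<beta> + 2 * m * real k) * (\<beta> + 2 * m * real k + 1) + \<mu>\<^sup>2"
    using assms by (intro add_pos_nonneg mult_pos_pos) auto
  moreover have "0 < m\<^sup>2 * (2 * (real k + 1)) * (2 * real k + real n)"
    using assms by (intro mult_pos_pos) auto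
  ultimately show ?case using Suc by simp
qed simp

text \<open>The positive part of summand k comes from the time derivatives and the potential, the
  negative part from the Laplacian. By the recursion the Laplacian of summand k + 1 cancels the
  positive part of summand k, so only the last positive part survives. For k = 0 the truncated
  exponent is harmless, as its factor is 0.\<close>

lemma hyp_coeff_telescope:
  assumes "m \<noteq> 0" "0 < n"
  shows "(\<Sum>k\<le>N. hyp_coeff m n \<mu> \<beta> k
        * (((\<beta> + 2 * m * real k) * (\<beta> + 2 * m * real k + 1) + \<mu>\<^sup>2) * z ^ k
           - m\<^sup>2 * (2 * real k * (2 * real k + real n - 2)) * z ^ (k - 1)))
      = hyp_coeff m n \<mu> \<beta> N * ((\<beta> + 2 * m * real N) * (\<beta> + 2 * m * real N + 1) + \<mu>\<^sup>2) * z ^ N"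
proof (induction N)
  case (Suc N)
  have nz: "m\<^sup>2 * (2 * (real N + 1)) * (2 * real N + real n) \<noteq> 0"
    using assms by (auto simp: add_nonneg_eq_0_iff)
  have *: "hyp_coeff m n \<mu> \<beta> (Suc N) * (m\<^sup>2 * (2 * (real N + 1)) * (2 * real N + real n))
      = hyp_coeff m n \<mu> \<beta> N * ((\<beta> + 2 * m * real N) * (\<beta> + 2 * m * real N + 1) + \<mu>\<^sup>2)"
    using nz by simp
  have "hyp_coeff m n \<mu> \<beta> N * ((\<beta> + 2 * m * real N) * (\<beta> + 2 * m * real N + 1) + \<mu>\<^sup>2) * z ^ N
      = hyp_coeff m n \<mu> \<beta> (Suc N)
        * (m\<^sup>2 * (2 * real (Suc N) * (2 * real (Suc N) + real n - 2)) * z ^ (Suc N - 1))"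
    unfolding *[symmetric] by (simp add: algebra_simps del: hyp_coeff.simps)
  then show ?case
    unfolding sum.atMost_Suc Suc.IH by (simp add: right_diff_distrib mult.assoc del: hyp_coeff.simps)
qed simp

text \<open>Both sides satisfy first-order recursions whose ratios agree up to a factor 1 + O(1 /
  k^2), thanks to the choice of \<beta>; the product of such factors is bounded.\<close>

lemma hyp_coeff_le_pochhammer:
  assumes "0 < m" "0 < \<beta>" "0 < n" "0 < \<kappa>" "\<kappa> \<le> 1"
    and \<beta>: "\<beta> = m * (\<kappa> - 1) + (m * real n - 1) / 2"
  shows "\<exists>K>0. \<forall>k. (real k + 1) * hyp_coeff m n \<mu> \<beta> (Suc k) \<le> K * (pochhammer \<kappa> k / fact k)"
proof -
  define c where "c = hyp_coeff m n \<mu> \<beta>"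
  define A where "A = \<beta> * (\<beta> + 1) + \<mu>\<^sup>2 + 2 * m\<^sup>2 * real n * (1 - \<kappa>)"
  define C where "C = A / (2 * m\<^sup>2 * \<kappa>)"
  have A: "0 \<le> A" using assms by (auto simp: A_def)
  then have C: "0 \<le> C" using assms by (auto simp: C_def)
  have cpos: "0 < c k" for k
    unfolding c_def using assms by (intro hyp_coeff_pos)
  \<comment> \<open>The sum of 1 / (x (x + 1)) over x from 1 to k is 1 - 1 / (k + 1); the
    exponential collects the correction factors accumulated so far.\<close>
  have main: "(real k + 1) * c (Suc k) \<le> c 1 * (pochhammer \<kappa> k / fact k) * exp (C * (1 - 1 / (real k + 1)))" for k
  proof (induction k)
    case 0
    then show ?case by simp
  next
    case (Suc k)
    define x where "x = real k + 1"
    have x: "1 \<le> x" by (simp add: x_def)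
    define P where "P = (\<beta> + 2 * m * x) * (\<beta> + 2 * m * x + 1) + \<mu>\<^sup>2"
    have c2: "c (Suc (Suc k)) = c (Suc k) * P / (m\<^sup>2 * (2 * (x + 1)) * (2 * x + real n))"
      by (simp add: c_def P_def x_def add.commute del: of_nat_Suc) (simp add: add.commute)
    have Q: "0 < 2 * m\<^sup>2 * (2 * x + real n)" using assms x by (intro mult_pos_pos) auto
    \<comment> \<open>The formula for \<open>\<beta>\<close> is exactly what makes the terms linear
      in \<open>x\<close> agree; \<open>A\<close> is the remaining constant.\<close>
    have Pe: "P = 2 * m\<^sup>2 * (2 * x + real n) * (x + \<kappa> - 1) + A"
      unfolding P_def A_def by (simp add: \<beta> field_simps power2_eq_square)
    \<comment> \<open>Needed to turn the absolute error \<open>A\<close> into a relative error of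
      size C / (x (x + 1)); this is where \<open>C\<close> gets its factor 1 / \<kappa>.\<close>
    have lower: "\<kappa> * x \<le> x + \<kappa> - 1"
    proof -
      have "0 \<le> (1 - \<kappa>) * (x - 1)" using assms x by simp
      then show ?thesis by (simp add: algebra_simps)
    qed
    have "A / (2 * m\<^sup>2 * (2 * x + real n)) \<le> A / (2 * m\<^sup>2 * (x + 1))"
      using assms x A by (intro divide_left_mono mult_left_mono mult_pos_pos) auto
    also have "\<dots> = \<kappa> * x * (C / (x * (x + 1)))"
    proof -
      have "\<kappa> \<noteq> 0" "x \<noteq> 0" using assms x by auto
      then show ?thesis unfolding C_def by (simp add: divide_simps)
    qed
    also have "\<dots> \<le> (x + \<kappa> - 1) * (C / (x * (x + 1)))"
      using lower C x by (intro mult_right_mono) auto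
    finally have "P / (2 * m\<^sup>2 * (2 * x + real n)) \<le> (x + \<kappa> - 1) * (1 + C / (x * (x + 1)))"
      using Q by (simp add: Pe add_divide_distrib distrib_left)
    also have "\<dots> \<le> (x + \<kappa> - 1) * exp (C / (x * (x + 1)))"
      using assms x by (intro mult_left_mono exp_ge_add_one_self) auto
    finally have r: "P / (2 * m\<^sup>2 * (2 * x + real n)) \<le> (x + \<kappa> - 1) * exp (C / (x * (x + 1)))" .
    have P0: "0 \<le> P" using assms x unfolding P_def by (intro add_nonneg_nonneg mult_nonneg_nonneg) auto
    have "(real (Suc k) + 1) * c (Suc (Suc k)) = (x * c (Suc k)) * (P / (2 * m\<^sup>2 * (2 * x + real n)) / x)"
    proof -
      have "m\<^sup>2 * (2 * (x + 1)) * (2 * x + real n) = (x + 1) * (2 * m\<^sup>2 * (2 * x + real n))"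
        by (simp add: algebra_simps)
      moreover have "real (Suc k) + 1 = x + 1" by (simp add: x_def)
      moreover have "x + 1 \<noteq> 0" using x by simp
      ultimately show ?thesis
        using x unfolding c2 by (simp only: times_divide_eq_right mult_divide_mult_cancel_left) simp
    qed
    also have "\<dots> \<le> (c 1 * (pochhammer \<kappa> k / fact k) * exp (C * (1 - 1 / x)))
        * ((x + \<kappa> - 1) * exp (C / (x * (x + 1))) / x)"
    proof (rule mult_mono[OF _ divide_right_mono[OF r]])
      show le: "x * c (Suc k) \<le> c 1 * (pochhammer \<kappa> k / fact k) * exp (C * (1 - 1 / x))"
        using Suc by (simp add: x_def)
      show "0 \<le> c 1 * (pochhammer \<kappa> k / fact k) * exp (C * (1 - 1 / x))"
        using x cpos[of "Suc k"] by (intro order_trans[OF _ le]) auto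
      show "0 \<le> P / (2 * m\<^sup>2 * (2 * x + real n)) / x"
        using P0 x Q by (intro divide_nonneg_nonneg) auto
    qed (use x in simp)
    also have "\<dots> = c 1 * ((pochhammer \<kappa> k / fact k) * ((x + \<kappa> - 1) / x)) * (exp (C * (1 - 1 / x)) * exp (C / (x * (x + 1))))"
      by simp
    also have "exp (C * (1 - 1 / x)) * exp (C / (x * (x + 1))) = exp (C * (1 - 1 / (x + 1)))"
    proof -
      have "x \<noteq> 0" "x + 1 \<noteq> 0" using x by auto
      then have "C * (1 - 1 / x) + C / (x * (x + 1)) = C * (1 - 1 / (x + 1))"
        by (simp add: divide_simps) (simp add: algebra_simps)
      then show ?thesis by (simp only: exp_add[symmetric])
    qed
    also have "(pochhammer \<kappa> k / fact k) * ((x + \<kappa> - 1) / x) = pochhammer \<kappa> (Suc k) / fact (Suc k)"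
      by (simp add: pochhammer_Suc x_def add.commute)
    finally show ?case by (simp add: x_def add.commute)
  qed
  have "(real k + 1) * c (Suc k) \<le> c 1 * exp C * (pochhammer \<kappa> k / fact k)" for k
  proof -
    have "C * (1 - 1 / (real k + 1)) \<le> C * 1" using C by (intro mult_left_mono) auto
    then have "c 1 * (pochhammer \<kappa> k / fact k) * exp (C * (1 - 1 / (real k + 1)))
        \<le> c 1 * (pochhammer \<kappa> k / fact k) * exp C"
      using cpos[of 1] assms
      by (intro mult_left_mono) (auto intro!: mult_nonneg_nonneg divide_nonneg_nonneg pochhammer_nonneg)
    with main[of k] show ?thesis by (simp add: mult_ac)
  qed
  then show ?thesis
    using cpos[of 1] unfolding c_def[symmetric] by (intro exI[of _ "c 1 * exp C"]) auto
qed

text \<open>The left side is a partial sum, with nonnegative terms, of the binomial series of the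
  right side.\<close>

lemma sum_pochhammer_le:
  fixes \<kappa> z :: real
  assumes "0 < \<kappa>" "0 \<le> z" "z < 1"
  shows "(\<Sum>k<N. pochhammer \<kappa> k / fact k * z ^ k) \<le> (1 - z) powr (- \<kappa>)"
proof -
  have eq: "((- \<kappa>) gchoose k) * (- z) ^ k = pochhammer \<kappa> k / fact k * z ^ k" for k
  proof -
    have "((- \<kappa>) gchoose k) * (- z) ^ k = ((-1) ^ k * (-1) ^ k) * (pochhammer \<kappa> k / fact k * z ^ k)"
      unfolding power_minus[of z] by (simp add: gbinomial_pochhammer)
    then show ?thesis by (simp flip: power_add)
  qed
  have "(\<lambda>k. pochhammer \<kappa> k / fact k * z ^ k) sums (1 - z) powr (- \<kappa>)"
    using gen_binomial_real[of "- z" "- \<kappa>"] assms by (simp add: eq)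
  then show ?thesis
    using assms by (intro sum_le_suminf[THEN order_trans[OF _ eq_refl]])
      (auto simp: sums_iff intro!: mult_nonneg_nonneg divide_nonneg_nonneg pochhammer_nonneg)
qed

text \<open>The bounds on F and z F' control the terms with derivatives of the cutoff, the uniform
  bound on the coefficients the error term of the truncation. F is less singular than F', but the
  common exponent \<kappa> suffices: apart from the constant term, its coefficients are at most
  those of z F'.\<close>

lemma hyp_coeff_bounds:
  assumes "0 < m" "0 < \<beta>" "0 < n" "0 < \<kappa>" "\<kappa> \<le> 1"
    and \<beta>: "\<beta> = m * (\<kappa> - 1) + (m * real n - 1) / 2"
  obtains K where "0 < K" "\<And>k. hyp_coeff m n \<mu> \<beta> k \<le> K"
    "\<And>N z. 0 \<le> z \<Longrightarrow> z < 1 \<Longrightarrow>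
       (\<Sum>k\<le>N. hyp_coeff m n \<mu> \<beta> k * z ^ k) \<le> K * (1 - z) powr (- \<kappa>)"
    "\<And>N z. 0 \<le> z \<Longrightarrow> z < 1 \<Longrightarrow>
       (\<Sum>k\<le>N. real k * hyp_coeff m n \<mu> \<beta> k * z ^ k) \<le> K * (1 - z) powr (- \<kappa>)"
proof -
  define c where "c = hyp_coeff m n \<mu> \<beta>"
  obtain K where K: "0 < K" and le: "\<And>k. (real k + 1) * c (Suc k) \<le> K * (pochhammer \<kappa> k / fact k)"
    using hyp_coeff_le_pochhammer[OF assms, of \<mu>] by (auto simp: c_def)
  have cpos: "0 < c k" for k
    unfolding c_def using assms by (intro hyp_coeff_pos)
  have c0: "c 0 = 1" by (simp add: c_def)
  have cS: "c (Suc k) \<le> (real k + 1) * c (Suc k)" for k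
    using cpos[of "Suc k"] by simp
  have p1: "pochhammer \<kappa> k / fact k \<le> 1" for k
  proof -
    have "pochhammer \<kappa> k \<le> fact k"
    proof (induction k)
      case (Suc k)
      then have "pochhammer \<kappa> k * (\<kappa> + real k) \<le> fact k * (1 + real k)"
        using assms by (intro mult_mono) auto
      then show ?case by (simp add: pochhammer_Suc mult.commute)
    qed simp
    then show ?thesis by simp
  qed
  have ck: "c k \<le> 1 + K" for k
  proof (cases k)
    case (Suc j)
    have "c (Suc j) \<le> K * (pochhammer \<kappa> j / fact j)" using cS le by (rule order_trans)
    also have "\<dots> \<le> K * 1" using p1 K by (intro mult_left_mono) auto
    finally show ?thesis using Suc by simp
  qed (use K in \<open>simp add: c_def\<close>)
  have shift: "(\<Sum>k\<le>N. f k) = f 0 + (\<Sum>k<N. f (Suc k))" for f :: "nat \<Rightarrow> real" and N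
    unfolding lessThan_Suc_atMost[symmetric] by (rule sum.lessThan_Suc_shift)
  have b: "(\<Sum>k<N. (real k + 1) * c (Suc k) * z ^ Suc k) \<le> K * (1 - z) powr (- \<kappa>)"
    if "0 \<le> z" "z < 1" for N z
  proof -
    have "(\<Sum>k<N. (real k + 1) * c (Suc k) * z ^ Suc k) \<le> (\<Sum>k<N. K * (pochhammer \<kappa> k / fact k * z ^ k))"
    proof (intro sum_mono)
      fix k
      have "(real k + 1) * c (Suc k) * z ^ Suc k \<le> K * (pochhammer \<kappa> k / fact k) * z ^ k"
        using that power_decreasing[of k "Suc k" z] less_imp_le[OF cpos[of "Suc k"]]
        by (intro mult_mono[OF le[of k]] mult_nonneg_nonneg order_trans[OF _ le[of k]]) auto
      then show "(real k + 1) * c (Suc k) * z ^ Suc k \<le> K * (pochhammer \<kappa> k / fact k * z ^ k)"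
        by simp
    qed
    also have "\<dots> \<le> K * (1 - z) powr (- \<kappa>)"
      unfolding sum_distrib_left[symmetric]
      using K assms that by (intro mult_left_mono sum_pochhammer_le) auto
    finally show ?thesis .
  qed
  have one: "1 \<le> (1 - z) powr (- \<kappa>)" if "0 \<le> z" "z < 1" for z
    using sum_pochhammer_le[of \<kappa> z 1] that assms by simp
  show thesis
  proof (rule that[of "1 + K"])
    fix N and z :: real assume z: "0 \<le> z" "z < 1"
    have "(\<Sum>k\<le>N. c k * z ^ k) \<le> 1 + (\<Sum>k<N. (real k + 1) * c (Suc k) * z ^ Suc k)"
      unfolding shift using cS z by (auto intro!: sum_mono mult_right_mono simp: c0)
    also have "\<dots> \<le> (1 + K) * (1 - z) powr (- \<kappa>)"
      using b[OF z, of N] one[OF z] by (simp add: distrib_right)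
    finally show "(\<Sum>k\<le>N. hyp_coeff m n \<mu> \<beta> k * z ^ k) \<le> (1 + K) * (1 - z) powr (- \<kappa>)"
      by (simp add: c_def)
    have "(\<Sum>k\<le>N. real k * c k * z ^ k) \<le> K * (1 - z) powr (- \<kappa>)"
      unfolding shift using b[OF z, of N] by (simp add: add.commute)
    then show "(\<Sum>k\<le>N. real k * hyp_coeff m n \<mu> \<beta> k * z ^ k) \<le> (1 + K) * (1 - z) powr (- \<kappa>)"
      using one[OF z] by (simp add: c_def distrib_right)
  qed (use K ck in \<open>auto simp: c_def\<close>)
qed

subsection \<open>Self-similar test functions\<close>

lemma partial_zero: "smooth f \<Longrightarrow> partial 0 f x = 0"
  by (rule linear_0[OF has_derivative_linear[OF smooth_has_derivative]])

lemma separable_has_derivative: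
  fixes \<theta> :: "'i \<Rightarrow> real \<Rightarrow> real" and P :: "'i \<Rightarrow> 'a::euclidean_space \<Rightarrow> real"
  assumes "\<And>k. k \<in> I \<Longrightarrow> smooth (\<theta> k)" "\<And>k. k \<in> I \<Longrightarrow> smooth (P k)"
  shows "((\<lambda>z. \<Sum>k\<in>I. a k * (\<theta> k (fst z) * P k (snd z))) has_derivative
    (\<lambda>v. \<Sum>k\<in>I. a k * (\<theta> k (fst z) * partial (snd v) (P k) (snd z)
           + fst v * partial 1 (\<theta> k) (fst z) * P k (snd z)))) (at z)"
proof (intro has_derivative_sum has_derivative_mult_right has_derivative_mult)
  fix k assume k: "k \<in> I"
  have "(\<theta> k has_derivative (\<lambda>v. v * partial 1 (\<theta> k) (fst z))) (at (fst z))"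
    using smooth_has_real_derivative[OF assms(1)[OF k], of "fst z"]
    unfolding has_field_derivative_def
    by (rule has_derivative_eq_rhs) (simp add: fun_eq_iff)
  from has_derivative_compose[OF bounded_linear_imp_has_derivative[OF bounded_linear_fst] this]
  show "((\<lambda>z. \<theta> k (fst z)) has_derivative (\<lambda>v. fst v * partial 1 (\<theta> k) (fst z))) (at z)" .
  from has_derivative_compose[OF bounded_linear_imp_has_derivative[OF bounded_linear_snd]
      smooth_has_derivative[OF assms(2)[OF k]]]
  show "((\<lambda>z. P k (snd z)) has_derivative (\<lambda>v. partial (snd v) (P k) (snd z))) (at z)" .
qed

lemma partial_separable:
  fixes \<theta> :: "'i \<Rightarrow> real \<Rightarrow> real" and P :: "'i \<Rightarrow> 'a::euclidean_space \<Rightarrow> real"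
  assumes "\<And>k. k \<in> I \<Longrightarrow> smooth (\<theta> k)" "\<And>k. k \<in> I \<Longrightarrow> smooth (P k)"
  shows "partial (1, 0) (\<lambda>z. \<Sum>k\<in>I. a k * (\<theta> k (fst z) * P k (snd z)))
          = (\<lambda>z. \<Sum>k\<in>I. a k * (partial 1 (\<theta> k) (fst z) * P k (snd z)))"
    and "partial (0, v) (\<lambda>z. \<Sum>k\<in>I. a k * (\<theta> k (fst z) * P k (snd z)))
          = (\<lambda>z. \<Sum>k\<in>I. a k * (\<theta> k (fst z) * partial v (P k) (snd z)))"
  using partial_eq[OF separable_has_derivative[of I \<theta> P a, OF assms]]
  by (auto simp: partial_zero[OF assms(2)])

text \<open>For finite sums of products the operator reduces to second derivatives in one real
  variable and to Laplacians of functions of x alone.\<close>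

lemma wave_op_separable:
  fixes \<theta> :: "nat \<Rightarrow> real \<Rightarrow> real" and P :: "nat \<Rightarrow> real^'n \<Rightarrow> real"
  assumes \<theta>: "\<And>k. smooth (\<theta> k)" and P: "\<And>k. smooth (P k)"
  shows "wave_op l \<mu> (\<lambda>z. \<Sum>k\<in>I. a k * (\<theta> k (fst z) * P k (snd z))) t x
    = (\<Sum>k\<in>I. a k * (partial 1 (partial 1 (\<theta> k)) t * P k x
        - (speed l t)\<^sup>2 * (\<theta> k t * (\<Sum>i\<in>UNIV. partial (axis i 1) (partial (axis i 1) (P k)) x))
        + potential \<mu> t * (\<theta> k t * P k x)))"
proof -
  have ax: "axis i (1::real) \<in> (Basis :: (real^'n) set)" for i
    by (auto simp: Basis_vec_def)
  have "partial (1, 0) (partial (1, 0) (\<lambda>z. \<Sum>k\<in>I. a k * (\<theta> k (fst z) * P k (snd z)))) (t, x)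
      = (\<Sum>k\<in>I. a k * (partial 1 (partial 1 (\<theta> k)) t * P k x))"
    by (subst partial_separable(1), simp_all add: \<theta> P)
       (subst partial_separable(1), simp_all add: \<theta> P smooth_deriv)
  moreover have "partial (0, axis i 1) (partial (0, axis i 1)
        (\<lambda>z. \<Sum>k\<in>I. a k * (\<theta> k (fst z) * P k (snd z)))) (t, x)
      = (\<Sum>k\<in>I. a k * (\<theta> k t * partial (axis i 1) (partial (axis i 1) (P k)) x))" for i
    by (subst partial_separable(2), simp_all add: \<theta> P)
       (subst partial_separable(2), simp_all add: \<theta> P smooth_partial ax)
  moreover have "(\<Sum>i\<in>UNIV. \<Sum>k\<in>I. a k * (\<theta> k t * partial (axis i 1) (partial (axis i 1) (P k)) x))
      = (\<Sum>k\<in>I. a k * (\<theta> k t * (\<Sum>i\<in>UNIV. partial (axis i 1) (partial (axis i 1) (P k)) x)))"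
    by (subst sum.swap) (simp add: sum_distrib_left)
  ultimately show ?thesis
    unfolding wave_op_def time_deriv_def laplacian_def
    by (simp add: sum_distrib_left sum.distrib sum_subtractf algebra_simps)
qed

text \<open>Test functions are defined for all real times, so \<open>1 + t\<close>, which occurs with real exponents, is
  replaced by a positive smooth function that agrees with it for \<open>t \<ge> - 1 / 4\<close>.\<close>

definition past_cutoff :: "real \<Rightarrow> real" where
  "past_cutoff t = smooth_step (0 + (-2) * t)"

definition regular_time :: "real \<Rightarrow> real" where
  "regular_time t = 1 + t * past_cutoff t"

lemma smooth_past_cutoff: "smooth past_cutoff"
  unfolding past_cutoff_def[abs_def] by (intro smooth_compose[OF smooth_smooth_step] smooth_affine)

lemma past_cutoff_eq_1: "- 1 / 4 \<le> t \<Longrightarrow> past_cutoff t = 1"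
  unfolding past_cutoff_def by (intro smooth_step_eq_1) simp

lemma past_cutoff_eq_0: "t \<le> - 1 / 2 \<Longrightarrow> past_cutoff t = 0"
  unfolding past_cutoff_def by (intro smooth_step_eq_0) simp

lemma regular_time_eq: "- 1 / 4 \<le> t \<Longrightarrow> regular_time t = 1 + t"
  by (simp add: regular_time_def past_cutoff_eq_1)

lemma regular_time_pos: "0 < regular_time t"
proof (cases "t \<le> - 1 / 2")
  case False
  have "- 1 / 2 \<le> t * past_cutoff t"
  proof (cases "0 \<le> t")
    case True
    then show ?thesis
      using smooth_step_nonneg by (simp add: past_cutoff_def order_trans[of _ 0])
  next
    case neg: False
    have "(- t) * past_cutoff t \<le> (- t) * 1"
      using neg smooth_step_le_1 by (intro mult_left_mono) (auto simp: past_cutoff_def)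
    with False show ?thesis by simp
  qed
  then show ?thesis by (simp add: regular_time_def)
qed (simp add: regular_time_def past_cutoff_eq_0)

lemma smooth_regular_time: "smooth regular_time"
  unfolding regular_time_def[abs_def]
  by (intro smooth_add smooth_mult smooth_const smooth_past_cutoff smooth_bounded_linear bounded_linear_ident)

text \<open>The argument of the cutoff is (1 + t) / S in literally affine form, ready for
  \<open>smooth_affine\<close>. The factor \<open>past_cutoff\<close> makes the support bounded
  towards the past.\<close>

definition time_factor :: "nat \<Rightarrow> real \<Rightarrow> real \<Rightarrow> real \<Rightarrow> real" where
  "time_factor q S r t = smooth_step (1 / S + (1 / S) * t) ^ q * past_cutoff t * regular_time t powr (- r)"

text \<open>The argument |x|^2 / (2 \<rho>^2) avoids the norm, which is not smooth at 0. The cutoff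
  is 1 for |x| \<le> \<rho>, where the solution lives, and 0 for |x|^2 \<ge> 2 \<rho>^2.\<close>

definition space_factor :: "real \<Rightarrow> nat \<Rightarrow> 'a::euclidean_space \<Rightarrow> real" where
  "space_factor \<rho> k x = (x \<bullet> x) ^ k * smooth_step ((1 / (2 * \<rho>\<^sup>2)) * (x \<bullet> x))"

lemma smooth_time_factor: "smooth (time_factor q S r)"
  unfolding time_factor_def[abs_def]
  by (intro smooth_mult smooth_power smooth_compose[OF smooth_smooth_step] smooth_affine
      smooth_past_cutoff smooth_powr smooth_regular_time regular_time_pos)

lemma smooth_space_factor: "smooth (space_factor \<rho> k)"
  unfolding space_factor_def[abs_def]
  by (intro smooth_mult smooth_power smooth_compose[OF smooth_smooth_step] smooth_const smooth_inner_self)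

text \<open>\<open>smooth_compose\<close> admits only an outer function of one real variable, so
  composition with \<open>snd\<close> is rebuilt from the coordinates.\<close>

lemma smooth_space_factor_snd:
  "smooth (\<lambda>z :: real \<times> 'a::euclidean_space. space_factor \<rho> k (snd z))"
proof -
  have "smooth (\<lambda>z :: real \<times> 'a. \<Sum>b\<in>Basis. (snd z \<bullet> b) * (snd z \<bullet> b))"
    by (intro smooth_sum smooth_mult smooth_bounded_linear
        bounded_linear_compose[OF bounded_linear_inner_left bounded_linear_snd])
  then have "smooth (\<lambda>z :: real \<times> 'a. snd z \<bullet> snd z)"
    by (simp add: euclidean_inner[symmetric])
  then show ?thesis
    unfolding space_factor_def[abs_def]
    by (intro smooth_mult smooth_power smooth_compose[OF smooth_smooth_step] smooth_const)
qed

lemma smooth_time_factor_fst: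
  "smooth (\<lambda>z :: real \<times> 'a::euclidean_space. time_factor q S r (fst z))"
  by (intro smooth_compose[OF smooth_time_factor] smooth_bounded_linear bounded_linear_fst)

definition profile :: "nat \<Rightarrow> real \<Rightarrow> real" where
  "profile q y = smooth_step y ^ q"

lemma smooth_profile: "smooth (profile q)"
  unfolding profile_def[abs_def] by (intro smooth_power smooth_smooth_step)

lemma time_factor_eq:
  "- 1 / 4 \<le> t \<Longrightarrow> time_factor q S r t = profile q ((1 + t) / S) * (1 + t) powr (- r)"
  by (simp add: time_factor_def profile_def past_cutoff_eq_1 regular_time_eq add_divide_distrib)

lemma smooth_rescaled_has_real_derivative:
  assumes "smooth f"
  shows "((\<lambda>t. f ((1 + t) / S)) has_real_derivative partial 1 f ((1 + t) / S) / S) (at t)"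
proof -
  have "((\<lambda>t. (1 + t) / S) has_real_derivative (0 + 1) / S) (at t)"
    by (intro DERIV_cdivide DERIV_add DERIV_const DERIV_ident)
  from DERIV_chain2[OF smooth_has_real_derivative[OF assms] this] show ?thesis by simp
qed

lemma time_factor_deriv:
  assumes t: "- 1 / 4 < t"
  shows "partial 1 (time_factor q S r) t
    = partial 1 (profile q) ((1 + t) / S) / S * (1 + t) powr (- r)
      - r * (profile q ((1 + t) / S) * (1 + t) powr (- r - 1))"
proof -
  have "((\<lambda>t. profile q ((1 + t) / S) * (1 + t) powr (- r)) has_real_derivative
     (partial 1 (profile q) ((1 + t) / S) / S * (1 + t) powr (- r)
      - r * (profile q ((1 + t) / S) * (1 + t) powr (- r - 1)))) (at t)"
    using t by (auto intro!: derivative_eq_intros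
        smooth_rescaled_has_real_derivative[OF smooth_profile])
  then have "(time_factor q S r has_real_derivative
     (partial 1 (profile q) ((1 + t) / S) / S * (1 + t) powr (- r)
      - r * (profile q ((1 + t) / S) * (1 + t) powr (- r - 1)))) (at t)"
    by (rule has_field_derivative_transform_within_open[where S = "{- 1 / 4 <..}"])
       (use t in \<open>auto simp: time_factor_eq\<close>)
  then show ?thesis by (rule partial_real_eq)
qed

lemma time_factor_deriv2:
  assumes t: "- 1 / 4 < t"
  shows "partial 1 (partial 1 (time_factor q S r)) t
    = partial 1 (partial 1 (profile q)) ((1 + t) / S) / S\<^sup>2 * (1 + t) powr (- r)
      - 2 * r * (partial 1 (profile q) ((1 + t) / S) / S * (1 + t) powr (- r - 1))
      + r * (r + 1) * (profile q ((1 + t) / S) * (1 + t) powr (- r - 2))" (is "_ = ?D")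
proof -
  have "((\<lambda>t. partial 1 (profile q) ((1 + t) / S) / S * (1 + t) powr (- r)
      - r * (profile q ((1 + t) / S) * (1 + t) powr (- r - 1))) has_real_derivative ?D) (at t)"
  proof -
    have pw: "((\<lambda>t. (1 + t) powr a) has_real_derivative a * (1 + t) powr (a - 1)) (at t)" for a
      using t by (auto intro!: derivative_eq_intros)
    have e: "- r - 1 - 1 = - r - 2" by simp
    show ?thesis
      by (rule DERIV_cong[OF DERIV_diff[OF
              DERIV_mult[OF DERIV_cdivide[OF smooth_rescaled_has_real_derivative[OF smooth_deriv[OF smooth_profile]]] pw]
              DERIV_cmult[OF DERIV_mult[OF smooth_rescaled_has_real_derivative[OF smooth_profile] pw]]]])
         (simp add: e algebra_simps power2_eq_square add_divide_distrib)
  qed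
  then have "(partial 1 (time_factor q S r) has_real_derivative ?D) (at t)"
    by (rule has_field_derivative_transform_within_open[where S = "{- 1 / 4 <..}"])
       (use t in \<open>auto simp: time_factor_deriv\<close>)
  then show ?thesis by (rule partial_real_eq)
qed

lemma space_factor_eq:
  assumes "0 < \<rho>" "norm x \<le> \<rho>"
  shows "space_factor \<rho> k x = (x \<bullet> x) ^ k"
proof -
  have "x \<bullet> x \<le> \<rho>\<^sup>2"
    using assms by (simp add: power2_norm_eq_inner[symmetric] power_mono)
  then have "(1 / (2 * \<rho>\<^sup>2)) * (x \<bullet> x) \<le> 1 / 2" using assms by (simp add: field_simps)
  then show ?thesis by (simp only: space_factor_def smooth_step_eq_1 mult_1_right)
qed

lemma space_factor_laplacian:
  fixes x :: "real^'n"
  assumes \<rho>: "0 < \<rho>" and x: "norm x < \<rho>"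
  shows "(\<Sum>i\<in>UNIV. partial (axis i 1) (partial (axis i 1) (space_factor \<rho> k)) x)
    = 2 * real k * (2 * real k + real CARD('n) - 2) * (x \<bullet> x) ^ (k - 1)"
proof -
  have d1: "partial (axis i 1) (space_factor \<rho> k) y = 2 * real k * ((y \<bullet> y) ^ (k - 1) * (y $ i))"
    if "y \<in> ball 0 \<rho>" for i and y :: "real^'n"
  proof -
    have "((\<lambda>y::real^'n. (y \<bullet> y) ^ k) has_derivative
        (\<lambda>v. real k * (v \<bullet> y + y \<bullet> v) * (y \<bullet> y) ^ (k - 1))) (at y)"
      by (auto intro!: derivative_eq_intros simp: algebra_simps)
    then have "(space_factor \<rho> k has_derivative
        (\<lambda>v. real k * (v \<bullet> y + y \<bullet> v) * (y \<bullet> y) ^ (k - 1))) (at y)"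
      by (rule has_derivative_transform_within_open[where s = "ball 0 \<rho>"])
         (use that \<rho> in \<open>auto simp: space_factor_eq\<close>)
    from partial_eq[OF this, of "axis i 1"] show ?thesis
      by (simp add: inner_axis inner_axis')
  qed
  have d2: "partial (axis i 1) (partial (axis i 1) (space_factor \<rho> k)) x
      = 2 * real k * (real (k - 1) * (2 * x $ i) * (x \<bullet> x) ^ (k - 1 - 1) * (x $ i) + (x \<bullet> x) ^ (k - 1))" for i
  proof -
    have "((\<lambda>y::real^'n. 2 * real k * ((y \<bullet> y) ^ (k - 1) * (y $ i))) has_derivative
        (\<lambda>v. 2 * real k * ((x \<bullet> x) ^ (k - 1) * (v $ i)
           + real (k - 1) * (v \<bullet> x + x \<bullet> v) * (x \<bullet> x) ^ (k - 1 - 1) * (x $ i)))) (at x)"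
      by (auto intro!: derivative_eq_intros bounded_linear_imp_has_derivative bounded_linear_vec_nth
          simp: algebra_simps)
    then have "(partial (axis i 1) (space_factor \<rho> k) has_derivative
        (\<lambda>v. 2 * real k * ((x \<bullet> x) ^ (k - 1) * (v $ i)
           + real (k - 1) * (v \<bullet> x + x \<bullet> v) * (x \<bullet> x) ^ (k - 1 - 1) * (x $ i)))) (at x)"
      by (rule has_derivative_transform_within_open[where s = "ball 0 \<rho>"])
         (use x d1 in auto)
    from partial_eq[OF this, of "axis i 1"] show ?thesis
      by (simp add: inner_axis inner_axis' algebra_simps)
  qed
  have xx: "(\<Sum>i\<in>UNIV. x $ i * x $ i) = x \<bullet> x" by (simp add: inner_vec_def)
  have "(\<Sum>i\<in>UNIV. partial (axis i 1) (partial (axis i 1) (space_factor \<rho> k)) x)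
      = 2 * real k * (2 * real (k - 1) * (x \<bullet> x) ^ (k - 1 - 1) * (\<Sum>i\<in>UNIV. x $ i * x $ i)
          + real CARD('n) * (x \<bullet> x) ^ (k - 1))"
    unfolding d2 by (simp add: sum.distrib sum_distrib_left algebra_simps)
  also have "\<dots> = 2 * real k * (2 * real k + real CARD('n) - 2) * (x \<bullet> x) ^ (k - 1)"
  \<comment> \<open>Truncated exponents occur only for k \<le> 1, where the factor
    \<open>real k\<close> or \<open>real (k - 1)\<close> in front is 0.\<close>
  proof (cases k)
    case (Suc j)
    then show ?thesis unfolding xx by (cases j) (auto simp: algebra_simps)
  qed simp
  finally show ?thesis .
qed

text \<open>The self-similar solution truncated after N + 1 terms and cut off in time and space. The
  term s^(-\<beta>) z^k is expanded into a power of s times |x|^(2k), so that every summand is a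
  product of a function of t and a function of x and is regular across the cone.\<close>

definition cone_test ::
    "real \<Rightarrow> real \<Rightarrow> real \<Rightarrow> nat \<Rightarrow> real \<Rightarrow> real \<Rightarrow> nat \<Rightarrow> real \<times> (real^'n) \<Rightarrow> real" where
  "cone_test m \<mu> \<beta> q S \<rho> N = (\<lambda>z. \<Sum>k\<le>N. hyp_coeff m CARD('n) \<mu> \<beta> k * m ^ (2 * k)
     * (time_factor q S (\<beta> + 2 * m * real k) (fst z) * space_factor \<rho> k (snd z)))"

definition cone_var :: "real \<Rightarrow> real \<Rightarrow> real^'n \<Rightarrow> real" where
  "cone_var m s x = m\<^sup>2 * (x \<bullet> x) * s powr (- (2 * m))"

lemma cone_var_power:
  assumes "0 < s"
  shows "m ^ (2 * k) * (s powr (- (\<beta> + 2 * m * real k)) * (x \<bullet> x) ^ k)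
    = s powr (- \<beta>) * cone_var m s x ^ k"
proof -
  have "s powr (- (\<beta> + 2 * m * real k)) = s powr (- \<beta>) * (s powr (- (2 * m))) ^ k"
    using assms by (simp add: powr_realpow[symmetric] powr_powr powr_add[symmetric])
  then show ?thesis
    unfolding cone_var_def power_mult_distrib power_mult[of m 2 k] by (simp only: mult_ac)
qed

lemma test_function_cone_test:
  fixes \<mu> :: real
  assumes S: "0 < S" "ereal (S - 1) < T" and \<rho>: "0 < \<rho>" and q: "0 < q"
  shows "test_function {(t, x). ereal t < T} (cone_test m \<mu> \<beta> q S \<rho> N :: real \<times> (real^'n) \<Rightarrow> real)"
proof -
  let ?\<psi> = "cone_test m \<mu> \<beta> q S \<rho> N :: real \<times> (real^'n) \<Rightarrow> real"
  let ?K = "{- 1 / 2..S - 1} \<times> (cball 0 (2 * \<rho>) :: (real^'n) set)"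
  have "smooth ?\<psi>"
    unfolding cone_test_def
    by (intro smooth_sum smooth_mult smooth_const smooth_time_factor_fst smooth_space_factor_snd)
  moreover have sub: "closure {z. ?\<psi> z \<noteq> 0} \<subseteq> ?K"
  proof (rule closure_minimal)
    have tf: "time_factor q S r t = 0" if "t \<notin> {- 1 / 2..S - 1}" for r t
    proof (cases "t \<le> - 1 / 2")
      case False
      with that have "1 \<le> 1 / S + (1 / S) * t" using S by (auto simp: field_simps)
      then show ?thesis using q by (simp only: time_factor_def smooth_step_eq_0) simp
    qed (simp add: time_factor_def past_cutoff_eq_0)
    have sf: "space_factor \<rho> k x = 0" if "x \<notin> cball 0 (2 * \<rho>)" for k and x :: "real^'n"
    proof -
      have "(2 * \<rho>)\<^sup>2 \<le> (norm x)\<^sup>2" using that \<rho> by (intro power_mono) auto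
      then have "4 * \<rho>\<^sup>2 \<le> x \<bullet> x" by (simp add: power2_norm_eq_inner power_mult_distrib)
      moreover have "0 \<le> \<rho>\<^sup>2" by simp
      ultimately have "2 * \<rho>\<^sup>2 \<le> x \<bullet> x" by linarith
      then have "1 \<le> (1 / (2 * \<rho>\<^sup>2)) * (x \<bullet> x)" using \<rho> by (simp add: field_simps)
      then show ?thesis by (simp only: space_factor_def smooth_step_eq_0 mult_zero_right)
    qed
    have "?\<psi> z = 0" if "z \<notin> ?K" for z
      using that tf sf by (cases z) (auto simp: cone_test_def intro!: sum.neutral)
    then show "{z. ?\<psi> z \<noteq> 0} \<subseteq> ?K" by blast
    show "closed ?K" by (intro closed_Times) auto
  qed
  moreover have "compact ?K" by (intro compact_Times) auto
  then have "compact (closure {z. ?\<psi> z \<noteq> 0})"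
    using sub by (meson closed_closure compact_Int_closed compact_closure
        compact_imp_bounded bounded_subset bounded_closure closure_subset)
  moreover have "?K \<subseteq> {(t, x). ereal t < T}"
    using S(2) by (auto intro: le_less_trans[of _ "ereal (S - 1)"])
  ultimately show ?thesis unfolding test_function_def by blast
qed

lemma cone_test_eq:
  fixes x :: "real^'n"
  assumes "0 \<le> t" "0 < \<rho>" "norm x \<le> \<rho>"
  shows "cone_test m \<mu> \<beta> q S \<rho> N (t, x) = profile q ((1 + t) / S) * (1 + t) powr (- \<beta>)
    * (\<Sum>k\<le>N. hyp_coeff m CARD('n) \<mu> \<beta> k * cone_var m (1 + t) x ^ k)"
proof -
  have "cone_test m \<mu> \<beta> q S \<rho> N (t, x) = (\<Sum>k\<le>N. profile q ((1 + t) / S)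
      * (hyp_coeff m CARD('n) \<mu> \<beta> k
         * (m ^ (2 * k) * ((1 + t) powr (- (\<beta> + 2 * m * real k)) * (x \<bullet> x) ^ k))))"
    unfolding cone_test_def using assms by (simp add: time_factor_eq space_factor_eq mult_ac)
  also have "\<dots> = profile q ((1 + t) / S) * (1 + t) powr (- \<beta>)
    * (\<Sum>k\<le>N. hyp_coeff m CARD('n) \<mu> \<beta> k * cone_var m (1 + t) x ^ k)"
    using assms by (subst cone_var_power) (auto simp: sum_distrib_left mult_ac)
  finally show ?thesis .
qed

lemma profile_eq_1: "y \<le> 1 / 2 \<Longrightarrow> profile q y = 1"
  by (simp add: profile_def smooth_step_eq_1)

lemma profile_eq_0: "0 < q \<Longrightarrow> 1 \<le> y \<Longrightarrow> profile q y = 0"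
  by (simp add: profile_def smooth_step_eq_0)

lemma profile_nonneg: "0 \<le> profile q y"
  by (simp add: profile_def smooth_step_nonneg)

lemma profile_le_1: "profile q y \<le> 1"
  by (simp add: profile_def smooth_step_nonneg smooth_step_le_1 power_le_one)

lemma profile_deriv_eq_0:
  assumes "y < 1 / 2"
  shows "partial 1 (profile q) y = 0"
proof (rule partial_real_eq)
  show "(profile q has_real_derivative 0) (at y)"
    by (rule has_field_derivative_transform_within_open[of "\<lambda>y. 1" _ _ "{..<1/2}"])
       (use assms in \<open>auto simp: profile_eq_1\<close>)
qed

text \<open>As S > 2, time 0 lies where the cutoff is locally 1, and the derivative hits only the
  powers of s. The negative sign is what makes nonnegative f contribute favourably.\<close>

lemma cone_test_time_deriv_0:
  fixes x :: "real^'n"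
  assumes "0 < \<rho>" "norm x \<le> \<rho>" "2 < S"
  shows "time_deriv (cone_test m \<mu> \<beta> q S \<rho> N) (0, x)
    = - (\<Sum>k\<le>N. (\<beta> + 2 * m * real k) * hyp_coeff m CARD('n) \<mu> \<beta> k * cone_var m 1 x ^ k)"
proof -
  have "time_deriv (cone_test m \<mu> \<beta> q S \<rho> N) (0, x)
      = (\<Sum>k\<le>N. hyp_coeff m CARD('n) \<mu> \<beta> k * m ^ (2 * k)
          * (partial 1 (time_factor q S (\<beta> + 2 * m * real k)) 0 * space_factor \<rho> k x))"
    unfolding time_deriv_def cone_test_def
    by (subst partial_separable(1)) (auto intro: smooth_time_factor smooth_space_factor)
  also have "\<dots> = (\<Sum>k\<le>N. - ((\<beta> + 2 * m * real k) * hyp_coeff m CARD('n) \<mu> \<beta> k * cone_var m 1 x ^ k))"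
  proof (rule sum.cong[OF refl])
    fix k
    have "cone_var m 1 x ^ k = m ^ (2 * k) * (x \<bullet> x) ^ k"
      using cone_var_power[of 1 m k 0 x] by simp
    then show "hyp_coeff m CARD('n) \<mu> \<beta> k * m ^ (2 * k)
          * (partial 1 (time_factor q S (\<beta> + 2 * m * real k)) 0 * space_factor \<rho> k x)
        = - ((\<beta> + 2 * m * real k) * hyp_coeff m CARD('n) \<mu> \<beta> k * cone_var m 1 x ^ k)"
      using assms by (simp add: time_factor_deriv space_factor_eq profile_eq_1 profile_deriv_eq_0 algebra_simps)
  qed
  also have "\<dots> = - (\<Sum>k\<le>N. (\<beta> + 2 * m * real k) * hyp_coeff m CARD('n) \<mu> \<beta> k * cone_var m 1 x ^ k)"
    by (rule sum_negf)
  finally show ?thesis .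
qed

text \<open>All terms in which the cutoff is not differentiated telescope to the last line. The
  first line collects the rest: in each summand the second derivative of the cutoff, and twice the
  product of its first derivative with that of the power of s.\<close>

lemma wave_op_cone_test:
  fixes x :: "real^'n" and l m \<mu> \<beta> t :: real
  assumes t: "0 \<le> t" and \<rho>: "0 < \<rho>" "norm x < \<rho>" and m: "m = 1 + l" "0 < m"
  defines "s \<equiv> 1 + t" and "z \<equiv> cone_var m (1 + t) x" and "c \<equiv> hyp_coeff m CARD('n) \<mu> \<beta>"
  shows "wave_op l \<mu> (cone_test m \<mu> \<beta> q S \<rho> N) t x
    = s powr (- \<beta>) * (partial 1 (partial 1 (profile q)) (s / S) / S\<^sup>2 * (\<Sum>k\<le>N. c k * z ^ k)
        - 2 * (partial 1 (profile q) (s / S) / (S * s)) * (\<Sum>k\<le>N. (\<beta> + 2 * m * real k) * c k * z ^ k))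
      + profile q (s / S) * s powr (- \<beta> - 2)
        * (c N * ((\<beta> + 2 * m * real N) * (\<beta> + 2 * m * real N + 1) + \<mu>\<^sup>2) * z ^ N)"
proof -
  have s: "0 < s" "- 1 / 4 < t" using t by (auto simp: s_def)
  define r where "r k = \<beta> + 2 * m * real k" for k
  define H0 H1 H2 where H: "H0 = profile q (s / S)" "H1 = partial 1 (profile q) (s / S) / S"
    "H2 = partial 1 (partial 1 (profile q)) (s / S) / S\<^sup>2"
  define L where "L k = 2 * real k * (2 * real k + real CARD('n) - 2)" for k
  have zk: "m ^ (2 * k) * (s powr (- r k) * (x \<bullet> x) ^ k) = s powr (- \<beta>) * z ^ k" for k
    unfolding r_def z_def s_def[symmetric] by (rule cone_var_power[OF s(1)])
  have p1: "s powr (- r k - 1) = s powr (- r k) / s" and p2: "s powr (- r k - 2) = s powr (- r k) / s\<^sup>2"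
    and p3: "s powr (- \<beta> - 2) = s powr (- \<beta>) / s\<^sup>2" for k
    using s by (simp_all add: powr_diff powr_realpow)
  have sp: "(speed l t)\<^sup>2 = s powr (2 * m) / s\<^sup>2"
  proof -
    have "(s powr l)\<^sup>2 = s powr (2 * l)" using s by (simp add: powr_realpow[symmetric] powr_powr mult.commute)
    also have "\<dots> = s powr (2 * m - 2)" by (simp add: m)
    finally show ?thesis using s by (simp add: speed_def s_def powr_diff powr_realpow)
  qed
  \<comment> \<open>Here the speed enters: its square is s^(2m - 2), which converts the loss of
    |x|^2 under the Laplacian into the loss of one factor z and of s^2.\<close>
  have lap: "m ^ (2 * k) * ((speed l t)\<^sup>2 * (s powr (- r k) * (L k * (x \<bullet> x) ^ (k - 1))))
      = s powr (- \<beta>) / s\<^sup>2 * (m\<^sup>2 * L k * z ^ (k - 1))" for k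
  proof (cases k)
    case (Suc j)
    have "s powr (- r k) * s powr (2 * m) = s powr (- r j)"
      using Suc by (simp add: r_def powr_add[symmetric] algebra_simps)
    moreover have "m ^ (2 * k) = m\<^sup>2 * m ^ (2 * j)" "k - 1 = j"
      using Suc by (simp_all only: mult_Suc_right power_add diff_Suc_1)
    moreover have "(a * b) * ((P / d) * (R * (L * X))) = a * L / d * (b * ((R * P) * X))"
      for a b P d R L X :: real by simp
    ultimately have "m ^ (2 * k) * ((speed l t)\<^sup>2 * (s powr (- r k) * (L k * (x \<bullet> x) ^ (k - 1))))
        = m\<^sup>2 * L k / s\<^sup>2 * (m ^ (2 * j) * (s powr (- r j) * (x \<bullet> x) ^ j))"
      by (simp only: sp)
    then show ?thesis unfolding zk using Suc by (simp add: mult_ac)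
  qed (simp add: L_def)
  have "wave_op l \<mu> (cone_test m \<mu> \<beta> q S \<rho> N) t x = (\<Sum>k\<le>N. c k * m ^ (2 * k)
      * (partial 1 (partial 1 (time_factor q S (r k))) t * space_factor \<rho> k x
        - (speed l t)\<^sup>2 * (time_factor q S (r k) t
            * (\<Sum>i\<in>UNIV. partial (axis i 1) (partial (axis i 1) (space_factor \<rho> k)) x))
        + potential \<mu> t * (time_factor q S (r k) t * space_factor \<rho> k x)))"
    unfolding cone_test_def c_def r_def
    by (intro wave_op_separable smooth_time_factor smooth_space_factor)
  also have "\<dots> = (\<Sum>k\<le>N. c k * (H2 * (m ^ (2 * k) * (s powr (- r k) * (x \<bullet> x) ^ k))
        - 2 * r k * H1 / s * (m ^ (2 * k) * (s powr (- r k) * (x \<bullet> x) ^ k))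
        + (r k * (r k + 1) + \<mu>\<^sup>2) * H0 / s\<^sup>2 * (m ^ (2 * k) * (s powr (- r k) * (x \<bullet> x) ^ k))
        - H0 * (m ^ (2 * k) * ((speed l t)\<^sup>2 * (s powr (- r k) * (L k * (x \<bullet> x) ^ (k - 1)))))))"
  proof (rule sum.cong[OF refl])
    fix k
    have "partial 1 (partial 1 (time_factor q S (r k))) t
        = H2 * s powr (- r k) - 2 * r k * (H1 * (s powr (- r k) / s))
          + r k * (r k + 1) * (H0 * (s powr (- r k) / s\<^sup>2))"
      using time_factor_deriv2[OF s(2), of q S "r k"] by (simp add: H s_def[symmetric] p1 p2)
    moreover have "time_factor q S (r k) t = H0 * s powr (- r k)"
      using s(2) by (simp add: time_factor_eq H s_def)
    moreover have "space_factor \<rho> k x = (x \<bullet> x) ^ k"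
      using \<rho> by (simp add: space_factor_eq)
    moreover have "(\<Sum>i\<in>UNIV. partial (axis i 1) (partial (axis i 1) (space_factor \<rho> k)) x)
        = L k * (x \<bullet> x) ^ (k - 1)"
      using space_factor_laplacian[OF \<rho>] by (simp add: L_def)
    moreover have "potential \<mu> t = \<mu>\<^sup>2 / s\<^sup>2" by (simp add: potential_def s_def)
    ultimately show "c k * m ^ (2 * k)
      * (partial 1 (partial 1 (time_factor q S (r k))) t * space_factor \<rho> k x
        - (speed l t)\<^sup>2 * (time_factor q S (r k) t
            * (\<Sum>i\<in>UNIV. partial (axis i 1) (partial (axis i 1) (space_factor \<rho> k)) x))
        + potential \<mu> t * (time_factor q S (r k) t * space_factor \<rho> k x))
      = c k * (H2 * (m ^ (2 * k) * (s powr (- r k) * (x \<bullet> x) ^ k))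
        - 2 * r k * H1 / s * (m ^ (2 * k) * (s powr (- r k) * (x \<bullet> x) ^ k))
        + (r k * (r k + 1) + \<mu>\<^sup>2) * H0 / s\<^sup>2 * (m ^ (2 * k) * (s powr (- r k) * (x \<bullet> x) ^ k))
        - H0 * (m ^ (2 * k) * ((speed l t)\<^sup>2 * (s powr (- r k) * (L k * (x \<bullet> x) ^ (k - 1))))))"
      by (simp add: ring_distribs add_divide_distrib mult_ac)
  qed
  also have "\<dots> = (\<Sum>k\<le>N. s powr (- \<beta>) * (H2 * (c k * z ^ k))
        - s powr (- \<beta>) * (2 * H1 / s * (r k * c k * z ^ k))
        + H0 * (s powr (- \<beta>) / s\<^sup>2) * (c k * ((r k * (r k + 1) + \<mu>\<^sup>2) * z ^ k - m\<^sup>2 * L k * z ^ (k - 1))))"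
    unfolding zk lap by (intro sum.cong refl) (simp add: ring_distribs add_divide_distrib mult_ac)
  also have "\<dots> = s powr (- \<beta>) * (H2 * (\<Sum>k\<le>N. c k * z ^ k)) - s powr (- \<beta>) * (2 * H1 / s * (\<Sum>k\<le>N. r k * c k * z ^ k))
      + H0 * (s powr (- \<beta>) / s\<^sup>2)
        * (\<Sum>k\<le>N. c k * ((r k * (r k + 1) + \<mu>\<^sup>2) * z ^ k - m\<^sup>2 * L k * z ^ (k - 1)))"
    by (simp only: sum.distrib sum_subtractf sum_distrib_left)
  also have "(\<Sum>k\<le>N. c k * ((r k * (r k + 1) + \<mu>\<^sup>2) * z ^ k - m\<^sup>2 * L k * z ^ (k - 1)))
      = c N * (r N * (r N + 1) + \<mu>\<^sup>2) * z ^ N"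
    using hyp_coeff_telescope[of m "CARD('n)" \<mu> \<beta> z N] m by (simp add: c_def r_def L_def)
  finally show ?thesis
    by (simp add: H r_def p3 right_diff_distrib mult_ac)
qed

subsection \<open>Measure and integration\<close>

text \<open>The complement of the essential support is a union of possibly uncountably many open
  null regions; the Lindelof property leaves countably many.\<close>

lemma ess_supp_AE: "AE x in lebesgue. x \<notin> ess_supp f \<longrightarrow> f x = 0"
proof -
  let ?F = "{U. open U \<and> (AE x in lebesgue. x \<in> U \<longrightarrow> f x = 0)}"
  obtain F where F: "F \<subseteq> ?F" "countable F" "\<Union>F = \<Union>?F"
    using Lindelof[of ?F] by auto
  have "AE x in lebesgue. \<forall>U\<in>F. x \<in> U \<longrightarrow> f x = 0"
    using F by (subst AE_ball_countable) auto
  then show ?thesis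
    by eventually_elim (use F in \<open>auto simp: ess_supp_def\<close>)
qed

text \<open>Nothing is assumed about measurability of \<open>a\<close>: if it is not integrable, its
  integral is 0 by convention and the bound still holds.\<close>

lemma abs_integral_le:
  fixes a b :: "'a \<Rightarrow> real"
  assumes "integrable M b" "AE x in M. \<bar>a x\<bar> \<le> b x"
  shows "\<bar>integral\<^sup>L M a\<bar> \<le> integral\<^sup>L M b"
proof -
  have b: "AE x in M. 0 \<le> b x" "AE x in M. a x \<le> b x" "AE x in M. - a x \<le> b x"
    using assms(2) by (eventually_elim, linarith)+
  have "integral\<^sup>L M a \<le> integral\<^sup>L M b" "integral\<^sup>L M (\<lambda>x. - a x) \<le> integral\<^sup>L M b"
    by (intro integral_mono_AE' assms b)+
  then show ?thesis by simp
qed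

lemma borel_measurable_completion_cong_AE:
  fixes f g :: "'a \<Rightarrow> 'b::topological_space"
  assumes "f \<in> borel_measurable (completion M)" "AE x in completion M. f x = g x"
  shows "g \<in> borel_measurable (completion M)"
proof (rule measurableI)
  fix A :: "'b set" assume A: "A \<in> sets borel"
  show "g -` A \<inter> space (completion M) \<in> sets (completion M)"
  proof (rule completion.in_sets_AE)
    show "f -` A \<inter> space (completion M) \<in> sets (completion M)"
      using assms(1) A by (rule measurable_sets)
    show "AE x in completion M. x \<in> f -` A \<inter> space (completion M) \<longleftrightarrow> x \<in> g -` A \<inter> space (completion M)"
      using assms(2) by eventually_elim auto
  qed simp
qed simp

text \<open>Measurability of \<open>f\<close> for the completed measure is a consequence of agreeing
  almost everywhere with a measurable function.\<close>

lemma integral_completion_cong_AE: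
  fixes f :: "'a \<Rightarrow> real"
  assumes "g \<in> borel_measurable M" "AE x in completion M. f x = g x"
  shows "integral\<^sup>L (completion M) f = integral\<^sup>L M g"
proof -
  have g: "g \<in> borel_measurable (completion M)" by (rule measurable_completion[OF assms(1)])
  moreover have "f \<in> borel_measurable (completion M)"
    using assms(2) by (intro borel_measurable_completion_cong_AE[OF g]) (auto simp: eq_commute)
  ultimately have "integral\<^sup>L (completion M) f = integral\<^sup>L (completion M) g"
    using assms(2) by (intro integral_cong_AE)
  then show ?thesis using assms(1) by (simp add: integral_completion)
qed

text \<open>The weak formulation consists of iterated Lebesgue integrals whose integrand need not be
  jointly measurable. Domination by a jointly integrable Borel function is enough to bound them, and
  Fubini's theorem is applied to the dominating function only.\<close>

lemma iterated_lebesgue_integral_le: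
  fixes B :: "'a::euclidean_space \<times> 'b::euclidean_space \<Rightarrow> real"
  assumes B: "integrable lborel B"
    and le: "AE t in lebesgue. AE x in lebesgue. \<bar>a t x\<bar> \<le> B (t, x)"
  shows "\<bar>LINT t|lebesgue. LINT x|lebesgue. a t x\<bar> \<le> (LINT z|lborel. B z)"
proof -
  have B': "integrable (lborel \<Otimes>\<^sub>M lborel) B" using B by (simp add: lborel_prod)
  have "AE t in lebesgue. integrable lborel (\<lambda>x. B (t, x))"
    using lborel_pair.AE_integrable_fst'[OF B'] by (rule AE_completion)
  with le have "AE t in lebesgue. \<bar>LINT x|lebesgue. a t x\<bar> \<le> (LINT x|lborel. B (t, x))"
  proof eventually_elim
    case (elim t)
    have "integrable lebesgue (\<lambda>x. B (t, x))" "(LINT x|lebesgue. B (t, x)) = (LINT x|lborel. B (t, x))"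
      using elim(2) by (simp_all add: integrable_completion integral_completion borel_measurable_integrable)
    then show ?case using abs_integral_le[of lebesgue "\<lambda>x. B (t, x)" "a t"] elim(1) by simp
  qed
  moreover have f: "integrable lborel (\<lambda>t. LINT x|lborel. B (t, x))"
    by (rule lborel_pair.integrable_fst'[OF B'])
  then have "integrable lebesgue (\<lambda>t. LINT x|lborel. B (t, x))"
    by (simp add: integrable_completion borel_measurable_integrable)
  ultimately have "\<bar>LINT t|lebesgue. LINT x|lebesgue. a t x\<bar> \<le> (LINT t|lebesgue. LINT x|lborel. B (t, x))"
    by (intro abs_integral_le)
  also have "\<dots> = (LINT t|lborel. LINT x|lborel. B (t, x))"
    using f by (intro integral_completion borel_measurable_integrable)
  also have "\<dots> = (LINT z|lborel. B z)"
    using lborel_pair.integral_fst'[OF B'] by (simp add: lborel_prod)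
  finally show ?thesis .
qed

lemma iterated_lebesgue_integral_eq:
  fixes B :: "'a::euclidean_space \<times> 'b::euclidean_space \<Rightarrow> real"
  assumes B: "integrable lborel B"
    and eq: "AE t in lebesgue. AE x in lebesgue. a t x = B (t, x)"
  shows "(LINT t|lebesgue. LINT x|lebesgue. a t x) = (LINT z|lborel. B z)"
proof -
  have B': "integrable (lborel \<Otimes>\<^sub>M lborel) B" using B by (simp add: lborel_prod)
  have [measurable]: "B \<in> borel_measurable (lborel \<Otimes>\<^sub>M lborel)"
    using B' by (rule borel_measurable_integrable)
  have "(LINT t|lebesgue. LINT x|lebesgue. a t x) = (LINT t|lborel. LINT x|lborel. B (t, x))"
  proof (rule integral_completion_cong_AE)
    show "AE t in lebesgue. (LINT x|lebesgue. a t x) = (LINT x|lborel. B (t, x))"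
      using eq by eventually_elim (rule integral_completion_cong_AE, measurable)
    show "(\<lambda>t. LINT x|lborel. B (t, x)) \<in> borel_measurable lborel"
      by (rule borel_measurable_integrable[OF lborel_pair.integrable_fst'[OF B']])
  qed
  also have "\<dots> = (LINT z|lborel. B z)"
    using lborel_pair.integral_fst'[OF B'] by (simp add: lborel_prod)
  finally show ?thesis .
qed

text \<open>A Lebesgue measurable function on the product agrees with a Borel function off a null
  set, almost all of whose slices are null. Hence the statement is in terms of almost every slice,
  as needed for iterated integrals. The absolute value secures nonnegativity everywhere.\<close>

lemma borel_version_on_compact:
  fixes F :: "'a::euclidean_space \<times> 'b::euclidean_space \<Rightarrow> real"
  assumes "set_integrable lebesgue K F" "compact K" "\<And>z. 0 \<le> F z"
  obtains W where "integrable lborel W" "\<And>z. 0 \<le> W z" "\<And>z. z \<notin> K \<Longrightarrow> W z = 0"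
    "AE t in lebesgue. AE x in lebesgue. (t, x) \<in> K \<longrightarrow> W (t, x) = F (t, x)"
proof -
  have int: "integrable lebesgue (\<lambda>z. indicator K z * F z)"
    using assms(1) by (simp add: set_integrable_def)
  obtain W0 where W0: "W0 \<in> borel_measurable lborel" "AE z in lborel. indicator K z * F z = W0 z"
    using completion_ex_borel_measurable_real[OF borel_measurable_integrable[OF int]] by blast
  have [measurable]: "W0 \<in> borel_measurable borel" "K \<in> sets borel"
    using W0(1) compact_imp_closed[OF assms(2)] by auto
  define W where "W z = indicator K z * \<bar>W0 z\<bar>" for z
  have [measurable]: "W \<in> borel_measurable borel" unfolding W_def[abs_def] by measurable
  have ae: "AE z in lborel. indicator K z * F z = W z"
    using W0(2)
  proof eventually_elim
    case (elim z)
    then show ?case using assms(3)[of z] by (cases "z \<in> K") (simp_all add: W_def)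
  qed
  have "integrable lebesgue W"
    by (rule integrable_cong_AE_imp[OF int])
       (auto intro!: AE_completion ae measurable_completion)
  then have "integrable lborel W" by (simp add: integrable_completion)
  moreover have "AE t in lebesgue. AE x in lebesgue. indicator K (t, x) * F (t, x) = W (t, x)"
  proof -
    have "AE z in lborel \<Otimes>\<^sub>M lborel. indicator K z * F z = W z"
      using ae by (subst lborel_prod)
    from lborel_pair.AE_pair[OF this] show ?thesis
      by (auto intro!: AE_completion elim!: eventually_mono)
  qed
  then have "AE t in lebesgue. AE x in lebesgue. (t, x) \<in> K \<longrightarrow> W (t, x) = F (t, x)"
    by (auto elim!: eventually_mono simp: indicator_def)
  ultimately show thesis
    by (intro that[of W]) (auto simp: W_def)
qed

text \<open>Stated with the power 1 / p on \<open>W\<close>, the form needed when \<open>W\<close>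
  stands for |u|^p. Young's inequality gives integrability, and, after normalising both factors, the
  estimate.\<close>

lemma Hoelder_integral:
  fixes W G :: "'a \<Rightarrow> real"
  assumes p: "1 < p" "1 < p'" "1 / p + 1 / p' = 1"
    and W: "integrable M W" "\<And>x. 0 \<le> W x"
    and G: "G \<in> borel_measurable M" "integrable M (\<lambda>x. G x powr p')" "\<And>x. 0 \<le> G x"
  shows "integrable M (\<lambda>x. W x powr (1 / p) * G x)"
    and "(LINT x|M. W x powr (1 / p) * G x)
      \<le> (LINT x|M. W x) powr (1 / p) * (LINT x|M. G x powr p') powr (1 / p')"
proof -
  have [measurable]: "W \<in> borel_measurable M" "G \<in> borel_measurable M"
    using W(1) G(1) by auto
  have young: "W x powr (1 / p) * G x \<le> W x / p + G x powr p' / p'" for x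
    using Youngs_inequality[OF p, of "W x powr (1 / p)" "G x"] W(2)[of x] G(3)[of x] p
    by (simp add: powr_powr)
  show int: "integrable M (\<lambda>x. W x powr (1 / p) * G x)"
  proof (rule Bochner_Integration.integrable_bound)
    show "integrable M (\<lambda>x. W x / p + G x powr p' / p')"
      using W(1) G(2) by (intro Bochner_Integration.integrable_add integrable_divide_zero) auto
    show "AE x in M. norm (W x powr (1 / p) * G x) \<le> norm (W x / p + G x powr p' / p')"
      using young W(2) G(3) p by (auto intro!: AE_I2 order_trans[OF _ abs_ge_self])
  qed measurable
  define P where "P = (LINT x|M. W x)"
  define Q where "Q = (LINT x|M. G x powr p')"
  have P0: "0 \<le> P" and Q0: "0 \<le> Q"
    unfolding P_def Q_def using W(2) by (auto intro: integral_nonneg)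
  show "(LINT x|M. W x powr (1 / p) * G x)
      \<le> (LINT x|M. W x) powr (1 / p) * (LINT x|M. G x powr p') powr (1 / p')"
  \<comment> \<open>A factor with zero integral cannot be normalised, but then the product vanishes
    almost everywhere.\<close>
  proof (cases "P = 0 \<or> Q = 0")
    case True
    have "AE x in M. W x powr (1 / p) * G x = 0"
    proof (cases "P = 0")
      case True
      then have "AE x in M. W x = 0"
        using integral_nonneg_eq_0_iff_AE[OF W(1)] W(2) by (simp add: P_def)
      then show ?thesis by eventually_elim simp
    next
      case False
      then have "AE x in M. G x powr p' = 0"
        using True integral_nonneg_eq_0_iff_AE[OF G(2)] by (simp add: Q_def)
      then show ?thesis by eventually_elim simp
    qed
    then have "(LINT x|M. W x powr (1 / p) * G x) = 0"
      by (simp add: integral_eq_zero_AE)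
    then show ?thesis by simp
  next
    case False
    with P0 Q0 have PQ: "0 < P" "0 < Q" by auto
    have pointwise: "W x powr (1 / p) * G x
        \<le> P powr (1 / p) * Q powr (1 / p') * (W x / P / p + G x powr p' / Q / p')" for x
    proof -
      have "(W x / P) powr (1 / p) * (G x / Q powr (1 / p')) \<le> W x / P / p + G x powr p' / Q / p'"
        using Youngs_inequality[OF p, of "(W x / P) powr (1 / p)" "G x / Q powr (1 / p')"]
          W(2)[of x] G(3)[of x] p PQ by (simp add: powr_powr powr_divide)
      then have "P powr (1 / p) * Q powr (1 / p') * ((W x / P) powr (1 / p) * (G x / Q powr (1 / p')))
          \<le> P powr (1 / p) * Q powr (1 / p') * (W x / P / p + G x powr p' / Q / p')"
        by (intro mult_left_mono) auto
      moreover have "P powr (1 / p) * Q powr (1 / p') * ((W x / P) powr (1 / p) * (G x / Q powr (1 / p')))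
          = W x powr (1 / p) * G x"
        using PQ W(2)[of x] by (simp add: powr_divide)
      ultimately show ?thesis by simp
    qed
    have "(LINT x|M. W x powr (1 / p) * G x)
        \<le> (LINT x|M. P powr (1 / p) * Q powr (1 / p') * (W x / P / p + G x powr p' / Q / p'))"
      using W(1) G(2) int pointwise by (intro integral_mono) auto
    also have "\<dots> = P powr (1 / p) * Q powr (1 / p') * (P / P / p + Q / Q / p')"
      using W(1) G(2) by (simp add: P_def Q_def)
    also have "\<dots> = P powr (1 / p) * Q powr (1 / p')" using p PQ by simp
    finally show ?thesis by (simp add: P_def Q_def)
  qed
qed

section \<open>Integrals over thin layers below the cone\<close>

lemma power_diff_le:
  fixes a b :: real
  assumes "0 \<le> b" "b \<le> a"
  shows "a ^ n - b ^ n \<le> real n * (a - b) * a ^ (n - 1)"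
proof (induction n)
  case (Suc n)
  have "a ^ Suc n - b ^ Suc n = a * (a ^ n - b ^ n) + (a - b) * b ^ n"
    by (simp add: algebra_simps)
  also have "\<dots> \<le> a * (real n * (a - b) * a ^ (n - 1)) + (a - b) * a ^ n"
    using assms Suc by (intro add_mono mult_left_mono power_mono) auto
  also have "\<dots> = real (Suc n) * (a - b) * a ^ (Suc n - 1)"
    by (cases n) (simp_all add: algebra_simps)
  finally show ?case .
qed simp

text \<open>Thickness times the largest surface area. Radii below 0 are allowed: an inner one is
  replaced by 0, and for an outer one the set is empty.\<close>

lemma measure_annulus_le:
  fixes r :: real
  assumes "0 < \<delta>" "r \<le> \<tau>" "0 \<le> \<tau>"
  shows "emeasure lborel (cball 0 r - cball 0 (r - \<delta>) :: 'a::euclidean_space set)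
    \<le> ennreal (unit_ball_vol (real DIM('a)) * real DIM('a) * \<delta> * \<tau> ^ (DIM('a) - 1))"
proof (cases "0 \<le> r")
  case True
  define b where "b = max 0 (r - \<delta>)"
  have b: "0 \<le> b" "b \<le> r" "r - b \<le> \<delta>" using True assms by (auto simp: b_def)
  have "(cball 0 r - cball 0 (r - \<delta>) :: 'a set) \<subseteq> cball 0 r - ball 0 b"
    using True by (auto simp: b_def max_def split: if_splits)
  then have "emeasure lborel (cball 0 r - cball 0 (r - \<delta>) :: 'a set)
      \<le> emeasure lborel (cball 0 r - ball 0 b :: 'a set)"
    by (intro emeasure_mono) auto
  also have "\<dots> = emeasure lborel (cball 0 r :: 'a set) - emeasure lborel (ball 0 b :: 'a set)"
    using b by (intro emeasure_Diff) (auto simp: emeasure_ball)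
  also have "\<dots> = ennreal (unit_ball_vol (real DIM('a)) * (r ^ DIM('a) - b ^ DIM('a)))"
    using b True by (simp add: emeasure_ball emeasure_cball ennreal_minus right_diff_distrib)
  also have "\<dots> \<le> ennreal (unit_ball_vol (real DIM('a)) * (real DIM('a) * \<delta> * \<tau> ^ (DIM('a) - 1)))"
  proof (intro ennreal_leI mult_left_mono)
    have "r ^ DIM('a) - b ^ DIM('a) \<le> real DIM('a) * (r - b) * r ^ (DIM('a) - 1)"
      by (rule power_diff_le[OF b(1,2)])
    also have "\<dots> \<le> real DIM('a) * \<delta> * \<tau> ^ (DIM('a) - 1)"
      using b assms True by (intro mult_mono power_mono) auto
    finally show "r ^ DIM('a) - b ^ DIM('a) \<le> real DIM('a) * \<delta> * \<tau> ^ (DIM('a) - 1)" .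
  qed simp
  finally show ?thesis by (simp add: mult.assoc)
qed auto

text \<open>The ball is cut into layers in which the distance \<tau> - |x| to the cone lies between
  k \<delta> and (k + 1) \<delta>. There the weight is at most (\<tau> / (k \<delta>))^q and the
  volume of order \<delta> \<tau>^(d - 1), d being the dimension. The hypothesis on \<open>K\<close>
  says that the layers up to \<open>K\<close> reach the centre.\<close>

lemma cone_layer_integral_le:
  assumes \<delta>: "0 < \<delta>" and \<tau>: "0 < \<tau>" and q: "0 \<le> q" and K: "\<tau> \<le> real K * \<delta>"
  shows "(\<integral>\<^sup>+x. ennreal (indicator (cball 0 (\<tau> - \<delta>)) x * (\<tau> / (\<tau> - norm x)) powr q)
        \<partial>(lborel :: 'a::euclidean_space measure))
    \<le> ennreal (unit_ball_vol (real DIM('a)) * real DIM('a) * \<delta> powr (1 - q)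
        * \<tau> powr (real DIM('a) - 1 + q) * (\<Sum>k=1..K. real k powr (- q)))"
proof -
  define A :: "nat \<Rightarrow> 'a set" where "A k = cball 0 (\<tau> - real k * \<delta>) - cball 0 (\<tau> - real k * \<delta> - \<delta>)" for k
  have [measurable]: "A k \<in> sets borel" for k by (simp add: A_def)
  define w where "w = unit_ball_vol (real DIM('a)) * real DIM('a) * \<delta> * \<tau> ^ (DIM('a) - 1)"
  have w: "0 \<le> w" using \<delta> \<tau> by (simp add: w_def)
  have pw: "ennreal (indicator (cball 0 (\<tau> - \<delta>)) x * (\<tau> / (\<tau> - norm x)) powr q)
      \<le> (\<Sum>k=1..K. ennreal ((\<tau> / (real k * \<delta>)) powr q) * indicator (A k) x)" for x :: 'a
  proof (cases "x \<in> cball 0 (\<tau> - \<delta>)")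
    case True
    define y where "y = \<tau> - norm x"
    have y: "\<delta> \<le> y" "y \<le> \<tau>" using True by (auto simp: y_def)
    define j where "j = nat \<lfloor>y / \<delta>\<rfloor>"
    have fl: "1 \<le> \<lfloor>y / \<delta>\<rfloor>" using y \<delta> by (simp add: le_floor_iff)
    then have jr: "real j = of_int \<lfloor>y / \<delta>\<rfloor>" unfolding j_def by (intro of_nat_nat) linarith
    have j1: "1 \<le> j" using nat_mono[OF fl] unfolding j_def by (metis nat_1 One_nat_def)
    have j2: "real j * \<delta> \<le> y" "y < real j * \<delta> + \<delta>"
      using \<delta> mult_right_mono[OF of_int_floor_le[of "y / \<delta>"], of \<delta>]
        mult_strict_right_mono[OF conjunct2[OF floor_correct[of "y / \<delta>"]] \<delta>]
      unfolding jr by (simp_all add: distrib_right)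
    have "real j * \<delta> \<le> real K * \<delta>" using j2 y K by linarith
    then have jK: "j \<le> K" using \<delta> by simp
    have xA: "x \<in> A j" using j2 by (auto simp: A_def y_def)
    have "(\<tau> / y) powr q \<le> (\<tau> / (real j * \<delta>)) powr q"
      using y \<delta> \<tau> q j1 j2 by (intro powr_mono2 divide_left_mono) auto
    then have "ennreal (indicator (cball 0 (\<tau> - \<delta>)) x * (\<tau> / (\<tau> - norm x)) powr q)
        \<le> ennreal ((\<tau> / (real j * \<delta>)) powr q) * indicator (A j) x"
      using True xA by (simp add: y_def)
    also have "\<dots> \<le> (\<Sum>k=1..K. ennreal ((\<tau> / (real k * \<delta>)) powr q) * indicator (A k) x)"
      using j1 jK
      by (intro member_le_sum[of j "{1..K}" "\<lambda>k. ennreal ((\<tau> / (real k * \<delta>)) powr q) * indicator (A k) x"]) auto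
    finally show ?thesis .
  qed simp
  have "(\<integral>\<^sup>+x. ennreal (indicator (cball 0 (\<tau> - \<delta>)) x * (\<tau> / (\<tau> - norm x)) powr q) \<partial>(lborel :: 'a measure))
      \<le> (\<integral>\<^sup>+x. (\<Sum>k=1..K. ennreal ((\<tau> / (real k * \<delta>)) powr q) * indicator (A k) x) \<partial>lborel)"
    by (intro nn_integral_mono pw)
  also have "\<dots> = (\<Sum>k=1..K. ennreal ((\<tau> / (real k * \<delta>)) powr q) * emeasure lborel (A k))"
    by (subst nn_integral_sum) (auto simp: nn_integral_cmult_indicator)
  also have "\<dots> \<le> (\<Sum>k=1..K. ennreal ((\<tau> / (real k * \<delta>)) powr q) * ennreal w)"
    unfolding A_def w_def using \<delta> \<tau>
    by (intro sum_mono mult_left_mono measure_annulus_le) auto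
  also have "\<dots> = ennreal (\<Sum>k=1..K. (\<tau> / (real k * \<delta>)) powr q * w)"
    using w by (simp add: ennreal_mult[symmetric] sum_ennreal)
  also have "(\<Sum>k=1..K. (\<tau> / (real k * \<delta>)) powr q * w)
      = unit_ball_vol (real DIM('a)) * real DIM('a) * \<delta> powr (1 - q)
        * \<tau> powr (real DIM('a) - 1 + q) * (\<Sum>k=1..K. real k powr (- q))"
  proof -
    define d where "d = real DIM('a) - 1"
    have "real (DIM('a) - 1) = d" by (simp add: d_def of_nat_diff)
    then have pw: "\<tau> ^ (DIM('a) - 1) = \<tau> powr d"
      using \<tau> by (metis powr_realpow)
    have "(\<tau> / (real k * \<delta>)) powr q * w = unit_ball_vol (real DIM('a)) * real DIM('a) * \<delta> powr (1 - q)
        * \<tau> powr (d + q) * real k powr (- q)" for k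
      using \<tau> \<delta> unfolding w_def pw
      by (simp add: powr_divide powr_mult powr_minus powr_diff powr_add field_simps)
    then have "(\<tau> / (real k * \<delta>)) powr q * w = unit_ball_vol (real DIM('a)) * real DIM('a) * \<delta> powr (1 - q)
        * \<tau> powr (real DIM('a) - 1 + q) * real k powr (- q)" for k
      unfolding d_def .
    then show ?thesis by (simp add: sum_distrib_left)
  qed
  finally show ?thesis .
qed

subsection \<open>A discrete differential inequality\<close>

text \<open>The discrete form of (y^(1 - p))' = -(p - 1) y^(-p) y' \<le> -(p - 1) c. Since x \<le>
  B, the step from x to x + c x^p multiplies x by at most L = 1 + c B^(p - 1), so y^(-p) at the
  intermediate point of the mean value theorem is still comparable with x^(-p).\<close>

lemma powr_increment_le:
  fixes p :: real
  assumes p: "1 < p" and x: "0 < x" "x \<le> B" and c: "0 < c" and y: "x + c * x powr p \<le> y"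
  shows "y powr (1 - p) \<le> x powr (1 - p) - (p - 1) * c * (1 + c * B powr (p - 1)) powr (- p)"
proof -
  define b where "b = x + c * x powr p"
  define L where "L = 1 + c * B powr (p - 1)"
  have xb: "x < b" using x c by (simp add: b_def)
  have "x powr p = x * x powr (p - 1)" using x by (simp add: powr_diff)
  also have "\<dots> \<le> x * B powr (p - 1)" using x p by (intro mult_left_mono powr_mono2) auto
  finally have bL: "b \<le> x * L" using c by (simp add: b_def L_def algebra_simps)
  have L: "0 < L" using c by (simp add: L_def add_pos_nonneg)
  have "\<exists>z>x. z < b \<and> b powr (1 - p) - x powr (1 - p) = (b - x) * ((1 - p) * z powr (- p))"
  proof (rule MVT2[OF xb])
    fix z assume "x \<le> z" "z \<le> b"
    then show "((\<lambda>z. z powr (1 - p)) has_real_derivative (1 - p) * z powr (- p)) (at z)"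
      using x by (auto intro!: derivative_eq_intros)
  qed
  then obtain z where z: "x < z" "z < b"
    and eq: "b powr (1 - p) - x powr (1 - p) = (b - x) * ((1 - p) * z powr (- p))" by blast
  have "x powr (- p) * L powr (- p) = (x * L) powr (- p)" using x L by (simp add: powr_mult)
  also have "\<dots> \<le> z powr (- p)" using z x p bL by (intro powr_mono2') auto
  finally have "(p - 1) * (c * x powr p) * (x powr (- p) * L powr (- p)) \<le> (p - 1) * (c * x powr p) * z powr (- p)"
    using p c by (intro mult_left_mono) auto
  moreover have "(p - 1) * (c * x powr p) * (x powr (- p) * L powr (- p)) = (p - 1) * c * L powr (- p)"
  proof -
    have "x powr p * x powr (- p) = 1" using x by (simp add: powr_minus)
    moreover have "(p - 1) * (c * u) * (v * w) = (p - 1) * c * w * (u * v)" for u v w by simp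
    ultimately show ?thesis by simp
  qed
  moreover have "(p - 1) * (c * x powr p) * z powr (- p) = x powr (1 - p) - b powr (1 - p)"
    using eq by (simp add: b_def algebra_simps)
  moreover have "y powr (1 - p) \<le> b powr (1 - p)"
    using y p x xb unfolding b_def[symmetric] by (intro powr_mono2') auto
  ultimately show ?thesis unfolding L_def[symmetric] by linarith
qed

text \<open>With \<open>y\<^sub>j\<close> the sum of \<open>D\<close> below \<open>j\<close> divided by \<open>J\<close>, this is a discrete version of the
  blow-up of \<open>y' \<ge> y\<^sup>p\<close>.\<close>

lemma discrete_blowup_bound:
  fixes p a B :: real
  assumes p: "1 < p" and a: "0 < a" and B: "0 < B"
  shows "\<exists>C>0. \<forall>D J e. 0 < e \<longrightarrow> (\<forall>i\<in>{2..J}. a * e \<le> D i)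
     \<longrightarrow> (\<forall>j\<in>{2..J}. (\<Sum>i=2..<j. D i) \<le> B * real j)
     \<longrightarrow> (\<forall>j\<in>{2..J}. (\<Sum>i=2..<j. D i) \<le> B * D j powr (1 / p) * real j powr (1 - 1 / p))
     \<longrightarrow> real J \<le> C * (1 + e powr (1 - p))"
proof -
  define c where "c = B powr (- p)"
  define c' where "c' = (p - 1) * c * (1 + c * B powr (p - 1)) powr (- p)"
  have c: "0 < c" using B by (simp add: c_def)
  have "0 < 1 + c * B powr (p - 1)" using c by (simp add: add_pos_nonneg)
  then have c': "0 < c'" using c p by (simp add: c'_def)
  \<comment> \<open>The summand 8 settles small \<open>J\<close>; the other one is the bound
    obtained at the end from the number of steps.\<close>
  define C where "C = 8 + 2 * (a / 8) powr (1 - p) / c'"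
  have C8: "8 \<le> C" using c' by (simp add: C_def)
  have "real J \<le> C * (1 + e powr (1 - p))"
    if e: "0 < e" and low: "\<And>i. i \<in> {2..J} \<Longrightarrow> a * e \<le> D i"
      and up: "\<And>j. j \<in> {2..J} \<Longrightarrow> (\<Sum>i=2..<j. D i) \<le> B * real j"
      and rec: "\<And>j. j \<in> {2..J} \<Longrightarrow> (\<Sum>i=2..<j. D i) \<le> B * D j powr (1 / p) * real j powr (1 - 1 / p)"
    for D J e
  proof (cases "J < 8")
    case True
    have "0 \<le> C * e powr (1 - p)" using C8 by simp
    moreover have "real J \<le> 8" using True by simp
    ultimately show ?thesis using C8 unfolding distrib_left by linarith
  next
    case False
    \<comment> \<open>The lower half of the indices builds up a starting value: it has at least J /
      8 terms, each at least a e, whence g = a e / 8. The upper half leaves at least J / 2 steps for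
      the blow-up.\<close>
    define J0 where "J0 = J div 2"
    have J0: "4 \<le> J0" "J0 \<le> J" "real J \<le> 4 * real J0" "2 * real J0 \<le> real J"
      using False by (auto simp: J0_def)
    define E where "E j = (\<Sum>i=2..<j. D i)" for j
    define y where "y j = E j / real J" for j
    define g where "g = a * e / 8"
    have Jpos: "0 < real J" using False by simp
    have ae: "0 < a * e" using a e by simp
    have g: "0 < g" using ae by (simp add: g_def)
    have y0: "g \<le> y J0"
    proof -
      have "a * e * (real J0 / 2) \<le> a * e * real (card {2..<J0})"
        using J0 ae by (intro mult_left_mono) (auto simp: of_nat_diff)
      also have "\<dots> \<le> E J0"
        using sum_bounded_below[of "{2..<J0}" "a * e" D] low J0 by (simp add: E_def mult.commute)
      finally have "a * e * (real J / 8) \<le> E J0"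
        using J0 ae by (intro order_trans[OF mult_left_mono[of "real J / 8" "real J0 / 2" "a * e"]]) auto
      then show ?thesis using Jpos by (simp add: y_def g_def field_simps)
    qed
    \<comment> \<open>Raising the recursive bound to the power p and using j \<le> J gives D_j \<ge>
      c E_j^p / J^(p - 1); division by J turns this into an inequality without J.\<close>
    have step: "y j + c * y j powr p \<le> y (Suc j)" if j: "J0 \<le> j" "j < J" "0 < y j" for j
    proof -
      have j2: "j \<in> {2..J}" using j J0 by auto
      have Epos: "0 < E j" using j Jpos by (simp add: y_def zero_less_divide_iff)
      have Dj: "0 < D j" using low[OF j2] ae by linarith
      have jpos: "0 < real j" using j2 by simp
      have "E j powr p \<le> (B * D j powr (1 / p) * real j powr (1 - 1 / p)) powr p"
        using rec[OF j2] Epos p by (intro powr_mono2) (auto simp: E_def)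
      also have "\<dots> = B powr p * D j * real j powr (p - 1)"
        using B Dj jpos p by (simp add: powr_mult powr_powr left_diff_distrib)
      also have "\<dots> \<le> B powr p * D j * real J powr (p - 1)"
        using B Dj j p by (intro mult_left_mono powr_mono2) auto
      finally have "E j powr p \<le> B powr p * D j * real J powr (p - 1)" .
      then have "c * (E j powr p / real J powr p) \<le> D j / real J"
        using B Jpos by (simp add: c_def powr_minus powr_diff field_simps)
      moreover have "E j powr p / real J powr p = y j powr p"
        using Epos Jpos by (simp add: y_def powr_divide)
      moreover have "E (Suc j) = E j + D j"
        using j2 by (simp add: E_def)
      ultimately show ?thesis by (simp add: y_def add_divide_distrib)
    qed
    have yB: "y j \<le> B" if "j \<in> {2..J}" for j
    proof -
      have "E j \<le> B * real J"
        using up[OF that] that B by (auto simp: E_def intro: order_trans mult_left_mono)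
      then show ?thesis using Jpos by (simp add: y_def field_simps)
    qed
    have main: "0 < y (J0 + k) \<and> y (J0 + k) powr (1 - p) \<le> g powr (1 - p) - real k * c'"
      if "J0 + k \<le> J" for k
      using that
    proof (induction k)
      case 0
      then show ?case using y0 g p by (auto intro: powr_mono2')
    next
      case (Suc k)
      then have IH: "0 < y (J0 + k)" "y (J0 + k) powr (1 - p) \<le> g powr (1 - p) - real k * c'" by auto
      have st: "y (J0 + k) + c * y (J0 + k) powr p \<le> y (Suc (J0 + k))"
        using step[of "J0 + k"] IH Suc.prems by simp
      have "y (Suc (J0 + k)) powr (1 - p) \<le> y (J0 + k) powr (1 - p) - c'"
        unfolding c'_def using IH(1) yB[of "J0 + k"] Suc.prems J0 st p c
        by (intro powr_increment_le) auto
      moreover have "0 < y (Suc (J0 + k))"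
        using st IH(1) c by (smt (verit) mult_nonneg_nonneg powr_ge_zero)
      ultimately show ?case using IH(2) by (simp add: distrib_right)
    qed
    \<comment> \<open>Each step lowers y^(1 - p) by c', but this power stays nonnegative, which
      limits the number of steps.\<close>
    have "real (J - J0) * c' \<le> g powr (1 - p)"
      using main[of "J - J0"] J0 by (smt (verit) le_add_diff_inverse powr_ge_zero order_refl)
    then have "real J / 2 * c' \<le> g powr (1 - p)"
      using J0 c' by (intro order_trans[OF mult_right_mono[of "real J / 2" "real (J - J0)" c']])
        (auto simp: of_nat_diff)
    then have "real J \<le> 2 * g powr (1 - p) / c'" using c' by (simp add: field_simps)
    also have "g powr (1 - p) = (a / 8) powr (1 - p) * e powr (1 - p)"
      using a e by (simp add: g_def powr_mult[symmetric])
    also have "2 * ((a / 8) powr (1 - p) * e powr (1 - p)) / c' \<le> C * e powr (1 - p)"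
      by (simp add: C_def distrib_right mult.assoc)
    also have "\<dots> \<le> C * (1 + e powr (1 - p))" using C8 by (simp add: distrib_left)
    finally show ?thesis .
  qed
  then show ?thesis using C8 by (intro exI[of _ C] conjI allI impI) (simp, blast)
qed

subsection \<open>Integrals over shells of the light cone\<close>

text \<open>Since A(t) = (s^m - 1) / m, the propagation radius R + A(t) equals s^m / m - \<delta>
  with \<delta> = 1 / m - R; the boundary of the cone is |x| = s^m / m, that is z = 1.\<close>

definition cone_shell :: "real \<Rightarrow> real \<Rightarrow> real \<Rightarrow> (real \<times> (real^'n)) set" where
  "cone_shell m \<delta> S = {(t, x). S / 2 \<le> 1 + t \<and> 1 + t \<le> S \<and> norm x \<le> (1 + t) powr m / m - \<delta>}"

lemma cone_shell_borel [measurable]: "cone_shell m \<delta> S \<in> sets borel"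
proof -
  have "{z \<in> space (borel \<Otimes>\<^sub>M (borel :: (real^'n) measure)). S / 2 \<le> 1 + fst z \<and> 1 + fst z \<le> S
      \<and> norm (snd z) \<le> (1 + fst z) powr m / m - \<delta>} \<in> sets (borel \<Otimes>\<^sub>M borel)"
    by measurable
  then show ?thesis unfolding borel_prod by (simp add: cone_shell_def case_prod_unfold)
qed

lemma cone_var_eq:
  assumes "0 < m" "0 < s"
  shows "cone_var m s x = (norm x / (s powr m / m))\<^sup>2"
proof -
  have "s powr (- (2 * m)) = inverse (s powr m) ^ 2"
    using assms by (simp add: powr_minus powr_realpow[symmetric] powr_powr mult.commute power_inverse)
  then show ?thesis
    by (simp add: cone_var_def power2_norm_eq_inner[symmetric] power_divide power_mult_distrib field_simps)
qed

text \<open>For r = |x| / \<tau> \<le> 1 one has r^2 \<le> r, so 1 - z is bounded below by the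
  relative distance to the cone, the quantity that is constant up to a factor on a layer.\<close>

lemma one_minus_cone_var_ge:
  assumes "0 < m" "0 < s" "0 < \<delta>" "norm x \<le> s powr m / m - \<delta>"
  shows "(s powr m / m - norm x) / (s powr m / m) \<le> 1 - cone_var m s x"
    and "0 < (s powr m / m - norm x) / (s powr m / m)"
    and "0 \<le> cone_var m s x"
proof -
  define \<tau> where "\<tau> = s powr m / m"
  have \<tau>: "0 < \<tau>" "norm x < \<tau>" using assms by (auto simp: \<tau>_def)
  have "(norm x / \<tau>)\<^sup>2 \<le> norm x / \<tau>"
    using \<tau> power_decreasing[of 1 2 "norm x / \<tau>"] by simp
  then show "(s powr m / m - norm x) / (s powr m / m) \<le> 1 - cone_var m s x"
    using \<tau> assms unfolding cone_var_eq[OF assms(1,2)] \<tau>_def[symmetric]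
    by (simp add: diff_divide_distrib)
  show "0 < (s powr m / m - norm x) / (s powr m / m)" "0 \<le> cone_var m s x"
    using \<tau> unfolding cone_var_eq[OF assms(1,2)] \<tau>_def[symmetric] by auto
qed

lemma powr_le_dyadic:
  fixes a s S :: real
  assumes "0 < S" "S / 2 \<le> s" "s \<le> S"
  shows "s powr a \<le> 2 powr \<bar>a\<bar> * S powr a"
proof (cases "0 \<le> a")
  case True
  then have "s powr a \<le> 1 * S powr a" using assms by (simp add: powr_mono2)
  also have "\<dots> \<le> 2 powr \<bar>a\<bar> * S powr a" by (intro mult_right_mono) (auto simp: ge_one_powr_ge_zero)
  finally show ?thesis .
next
  case False
  then have "s powr a \<le> (S / 2) powr a" using assms by (intro powr_mono2') auto
  also have "\<dots> = 2 powr \<bar>a\<bar> * S powr a" using assms False by (simp add: powr_divide powr_minus field_simps)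
  finally show ?thesis .
qed

text \<open>The layer estimate at each time, integrated in time. In the exponent of S,
  \<open>a\<close> comes from the weight, 1 from the length of the time interval and the rest from
  the radius s^m / m \<le> S^m / m of the cone; S^m / (m \<delta>) layers suffice at every time of
  the shell.\<close>

lemma cone_shell_integral:
  fixes a q m \<delta> :: real
  assumes m: "0 < m" and \<delta>: "0 < \<delta>" and q: "0 \<le> q"
  obtains C where "0 < C"
    "\<And>S. 0 < S \<Longrightarrow> integrable lborel (\<lambda>z::real \<times> (real^'n). indicator (cone_shell m \<delta> S) z
        * ((1 + fst z) powr a * (1 - cone_var m (1 + fst z) (snd z)) powr (- q)))"
    "\<And>S. 0 < S \<Longrightarrow> (LINT z::real \<times> (real^'n)|lborel. indicator (cone_shell m \<delta> S) z
        * ((1 + fst z) powr a * (1 - cone_var m (1 + fst z) (snd z)) powr (- q)))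
       \<le> C * S powr (a + 1 + m * (real CARD('n) - 1 + q)) * (\<Sum>k=1..nat \<lceil>S powr m / (m * \<delta>)\<rceil>. real k powr (- q))"
proof -
  define n where "n = real CARD('n)"
  define w where "w = unit_ball_vol n * n * \<delta> powr (1 - q)"
  have n1: "1 \<le> n" by (simp add: n_def Suc_leI)
  have w: "0 < w" using n1 \<delta> unfolding w_def
    by (intro mult_pos_pos unit_ball_vol_pos) auto
  define C where "C = 2 powr \<bar>a\<bar> * w * m powr (- (n - 1 + q))"
  have C: "0 < C" using w m by (simp add: C_def)
  define f where "f S z = indicator (cone_shell m \<delta> S) z
        * ((1 + fst z) powr a * (1 - cone_var m (1 + fst z) (snd z)) powr (- q))" for S and z :: "real \<times> (real^'n)"
  have f0: "0 \<le> f S z" for S z by (simp add: f_def)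
  have fm[measurable]: "f S \<in> borel_measurable borel" for S
  proof -
    have [measurable]: "cone_shell m \<delta> S \<in> sets (borel \<Otimes>\<^sub>M (borel :: (real^'n) measure))"
      unfolding borel_prod by (rule cone_shell_borel)
    have "f S \<in> borel_measurable (borel \<Otimes>\<^sub>M borel)"
      unfolding f_def[abs_def] cone_var_def by measurable
    then show ?thesis by (simp add: borel_prod)
  qed
  have main: "(\<integral>\<^sup>+z. ennreal (f S z) \<partial>lborel)
      \<le> ennreal (C * S powr (a + 1 + m * (n - 1 + q)) * (\<Sum>k=1..nat \<lceil>S powr m / (m * \<delta>)\<rceil>. real k powr (- q)))"
    (is "_ \<le> ennreal (?R S)") if S: "0 < S" for S
  proof -
    define K where "K = nat \<lceil>S powr m / (m * \<delta>)\<rceil>"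
    define \<Sigma> where "\<Sigma> = (\<Sum>k=1..K. real k powr (- q))"
    have \<Sigma>: "0 \<le> \<Sigma>" unfolding \<Sigma>_def by (intro sum_nonneg) auto
    define b where "b = 2 powr \<bar>a\<bar> * S powr a * (w * (S powr m / m) powr (n - 1 + q) * \<Sigma>)"
    have b: "0 \<le> b" using w \<Sigma> by (simp add: b_def)
    have inner: "(\<integral>\<^sup>+x. ennreal (f S (t, x)) \<partial>lborel) \<le> ennreal b * indicator {S / 2 - 1..S - 1} t" for t
    proof (cases "S / 2 \<le> 1 + t \<and> 1 + t \<le> S")
      case True
      define s where "s = 1 + t"
      define \<tau> where "\<tau> = s powr m / m"
      have s: "0 < s" "S / 2 \<le> s" "s \<le> S" using True S by (auto simp: s_def)
      have \<tau>: "0 < \<tau>" "\<tau> \<le> S powr m / m"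
        using s m by (auto simp: \<tau>_def intro!: divide_right_mono powr_mono2)
      have K: "\<tau> \<le> real K * \<delta>"
      proof -
        have "S powr m / (m * \<delta>) \<le> real K" unfolding K_def by (rule real_nat_ceiling_ge)
        then have "S powr m / m \<le> real K * \<delta>" using m \<delta> by (simp add: field_simps)
        with \<tau> show ?thesis by simp
      qed
      have "f S (t, x) \<le> 2 powr \<bar>a\<bar> * S powr a * (indicator (cball 0 (\<tau> - \<delta>)) x * (\<tau> / (\<tau> - norm x)) powr q)" for x
      proof (cases "norm x \<le> \<tau> - \<delta>")
        case nx: True
        note z = one_minus_cone_var_ge[OF m s(1) \<delta> nx[unfolded \<tau>_def], folded \<tau>_def]
        have "(1 - cone_var m s x) powr (- q) \<le> ((\<tau> - norm x) / \<tau>) powr (- q)"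
          using z q by (intro powr_mono2') auto
        also have "\<dots> = (\<tau> / (\<tau> - norm x)) powr q"
          using z(2) \<tau> nx \<delta> by (simp add: powr_minus powr_divide)
        finally have "s powr a * (1 - cone_var m s x) powr (- q)
            \<le> (2 powr \<bar>a\<bar> * S powr a) * (\<tau> / (\<tau> - norm x)) powr q"
          using powr_le_dyadic[OF S s(2,3), of a] by (intro mult_mono) auto
        moreover have "(t, x) \<in> cone_shell m \<delta> S" "x \<in> cball 0 (\<tau> - \<delta>)"
          using nx True by (auto simp: cone_shell_def \<tau>_def s_def)
        ultimately show ?thesis by (simp add: f_def s_def)
      next
        case False
        then have "(t, x) \<notin> cone_shell m \<delta> S" by (simp add: cone_shell_def \<tau>_def s_def)
        then show ?thesis by (simp add: f_def)
      qed
      then have "(\<integral>\<^sup>+x. ennreal (f S (t, x)) \<partial>lborel)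
          \<le> (\<integral>\<^sup>+x. ennreal (2 powr \<bar>a\<bar> * S powr a)
              * ennreal (indicator (cball 0 (\<tau> - \<delta>)) x * (\<tau> / (\<tau> - norm x)) powr q) \<partial>(lborel :: (real^'n) measure))"
        by (intro nn_integral_mono) (simp add: ennreal_mult[symmetric] ennreal_leI)
      also have "\<dots> = ennreal (2 powr \<bar>a\<bar> * S powr a)
          * (\<integral>\<^sup>+x. ennreal (indicator (cball 0 (\<tau> - \<delta>)) x * (\<tau> / (\<tau> - norm x)) powr q) \<partial>(lborel :: (real^'n) measure))"
      proof (rule nn_integral_cmult)
        have "(\<lambda>x::real^'n. (\<tau> / (\<tau> - norm x)) powr q) \<in> borel_measurable borel" by measurable
        then show "(\<lambda>x::real^'n. ennreal (indicator (cball 0 (\<tau> - \<delta>)) x * (\<tau> / (\<tau> - norm x)) powr q))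
            \<in> borel_measurable lborel"
          by (intro measurable_compose[OF _ measurable_ennreal] borel_measurable_times
              borel_measurable_indicator) simp_all
      qed
      also have "\<dots> \<le> ennreal (2 powr \<bar>a\<bar> * S powr a) * ennreal (w * \<tau> powr (n - 1 + q) * \<Sigma>)"
        using cone_layer_integral_le[where 'a = "real^'n", OF \<delta> \<tau>(1) q K]
        by (intro mult_left_mono) (simp_all add: w_def n_def \<Sigma>_def)
      also have "\<dots> \<le> ennreal b"
        unfolding b_def using w \<Sigma> \<tau> q n1
        by (subst ennreal_mult[symmetric]) (auto intro!: ennreal_leI mult_left_mono mult_right_mono powr_mono2)
      finally show ?thesis using True by simp
    next
      case False
      then have "(t, x) \<notin> cone_shell m \<delta> S" for x :: "real^'n" by (auto simp: cone_shell_def)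
      then have "f S (t, x) = 0" for x by (simp add: f_def)
      then show ?thesis by simp
    qed
    have "(\<integral>\<^sup>+z. ennreal (f S z) \<partial>lborel) = (\<integral>\<^sup>+t. \<integral>\<^sup>+x. ennreal (f S (t, x)) \<partial>lborel \<partial>lborel)"
    proof -
      have "(\<lambda>z. ennreal (f S z)) \<in> borel_measurable (lborel \<Otimes>\<^sub>M lborel)"
        by (simp add: lborel_prod)
      from lborel.nn_integral_fst[OF this] show ?thesis by (simp add: lborel_prod)
    qed
    also have "\<dots> \<le> (\<integral>\<^sup>+t. ennreal b * indicator {S / 2 - 1..S - 1} t \<partial>lborel)"
      by (intro nn_integral_mono inner)
    also have "\<dots> = ennreal (b * (S / 2))"
      using S b by (simp add: nn_integral_cmult_indicator ennreal_mult[symmetric])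
    also have "\<dots> \<le> ennreal (b * S)" using b S by (intro ennreal_leI mult_left_mono) auto
    also have "b * S = ?R S"
    proof -
      have "(S powr m / m) powr (n - 1 + q) = S powr (m * (n - 1 + q)) * m powr (- (n - 1 + q))"
        using S m unfolding powr_minus divide_inverse[symmetric] by (simp add: powr_divide powr_powr)
      moreover have "S powr (a + 1 + m * (n - 1 + q)) = S powr a * S * S powr (m * (n - 1 + q))"
        using S by (simp add: powr_add)
      ultimately show ?thesis by (simp add: b_def C_def \<Sigma>_def K_def)
    qed
    finally show ?thesis .
  qed
  have R0: "0 \<le> ?R S" for S using C by (intro mult_nonneg_nonneg sum_nonneg) auto
  show thesis
  proof (rule that[OF C])
    fix S :: real assume S: "0 < S"
    have int: "integrable lborel (f S)"
      using main[OF S] f0 by (intro integrableI_nonneg) (auto intro: le_less_trans)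
    then show "integrable lborel (\<lambda>z::real \<times> (real^'n). indicator (cone_shell m \<delta> S) z
        * ((1 + fst z) powr a * (1 - cone_var m (1 + fst z) (snd z)) powr (- q)))"
      by (simp add: f_def[abs_def])
    have "ennreal (LINT z|lborel. f S z) \<le> ennreal (?R S)"
      using main[OF S] nn_integral_eq_integral[OF int] f0 by simp
    then have "(LINT z|lborel. f S z) \<le> ?R S" using R0 by (simp add: ennreal_le_iff)
    then show "(LINT z::real \<times> (real^'n)|lborel. indicator (cone_shell m \<delta> S) z
        * ((1 + fst z) powr a * (1 - cone_var m (1 + fst z) (snd z)) powr (- q)))
       \<le> C * S powr (a + 1 + m * (real CARD('n) - 1 + q)) * (\<Sum>k=1..nat \<lceil>S powr m / (m * \<delta>)\<rceil>. real k powr (- q))"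
      by (simp add: f_def[abs_def] n_def)
  qed
qed

subsection \<open>Cutoff profiles and the wave operator\<close>

lemma smooth_vanishing_outside_bounded:
  fixes f :: "real \<Rightarrow> real"
  assumes "smooth f" "\<And>y. y < a \<or> b < y \<Longrightarrow> f y = 0"
  obtains M where "0 \<le> M" "\<And>y. \<bar>f y\<bar> \<le> M"
proof -
  have "compact (f ` {a..b})"
    by (intro compact_continuous_image smooth_continuous assms) auto
  then obtain M where M: "\<And>y. y \<in> {a..b} \<Longrightarrow> \<bar>f y\<bar> \<le> M"
    using compact_imp_bounded bounded_iff by (metis imageI real_norm_def)
  have "\<bar>f y\<bar> \<le> max 0 M" for y
    using M[of y] assms(2)[of y] by (cases "y \<in> {a..b}") auto
  then show thesis by (intro that[of "max 0 M"]) auto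
qed

lemma partial_eq_0_locally_constant:
  fixes f :: "real \<Rightarrow> real"
  assumes "open U" "y \<in> U" "\<And>x. x \<in> U \<Longrightarrow> f x = c"
  shows "partial 1 f y = 0"
proof (rule partial_real_eq)
  show "(f has_real_derivative 0) (at y)"
    by (rule has_field_derivative_transform_within_open[of "\<lambda>y. c" _ _ U]) (use assms in auto)
qed

lemma profile_derivs_eq_0:
  assumes "0 < q" "y < 1 / 2 \<or> 1 < y"
  shows "partial 1 (profile q) y = 0" "partial 1 (partial 1 (profile q)) y = 0"
proof -
  have d: "partial 1 (profile q) y = 0" if "y < 1 / 2 \<or> 1 < y" for y
    using that
  proof
    assume "y < 1 / 2"
    then show ?thesis
      by (intro partial_eq_0_locally_constant[of "{..<1/2}" _ _ 1]) (auto simp: profile_eq_1)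
  next
    assume "1 < y"
    then show ?thesis
      by (intro partial_eq_0_locally_constant[of "{1<..}" _ _ 0]) (auto simp: profile_eq_0 assms)
  qed
  show "partial 1 (profile q) y = 0" by (rule d[OF assms(2)])
  have "open ({..<1/2} \<union> {1<..} :: real set)" by auto
  then show "partial 1 (partial 1 (profile q)) y = 0"
    by (rule partial_eq_0_locally_constant[of _ _ _ 0]) (use assms d in auto)
qed

text \<open>The reason for taking a power of the cutoff: its derivatives are then controlled by
  a fractional power of the cutoff itself.\<close>

lemma profile_deriv_bounds:
  assumes p: "1 < p" and q: "2 * (p / (p - 1)) \<le> real q"
  obtains M where "0 < M" "\<And>y. \<bar>partial 1 (profile q) y\<bar> \<le> M * profile q y powr (1 / p)"
    "\<And>y. \<bar>partial 1 (partial 1 (profile q)) y\<bar> \<le> M * profile q y powr (1 / p)"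
proof -
  let ?s = smooth_step
  define s1 where "s1 = partial 1 smooth_step"
  define s2 where "s2 = partial 1 s1"
  \<comment> \<open>The cutoff itself is the profile of power 1, so its derivatives vanish off
    [1/2, 1] and are therefore bounded.\<close>
  have prof1: "profile 1 = smooth_step" by (simp add: profile_def fun_eq_iff)
  have sm: "smooth s1" "smooth s2"
    unfolding s2_def s1_def by (intro smooth_deriv smooth_smooth_step)+
  obtain M1 where M1: "0 \<le> M1" "\<And>y. \<bar>s1 y\<bar> \<le> M1"
    using profile_derivs_eq_0(1)[of 1] sm(1) unfolding prof1 s1_def[symmetric]
    by (elim smooth_vanishing_outside_bounded[of s1 "1/2" 1]) auto
  obtain M2 where M2: "0 \<le> M2" "\<And>y. \<bar>s2 y\<bar> \<le> M2"
    using profile_derivs_eq_0(2)[of 1] sm(2) unfolding prof1 s1_def[symmetric] s2_def[symmetric]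
    by (elim smooth_vanishing_outside_bounded[of s2 "1/2" 1]) auto
  have "1 < p / (p - 1)" using p by simp
  then have q2: "2 < q" using q by linarith
  \<comment> \<open>Two derivatives cost at most two factors of the cutoff. The hypothesis q \<ge> 2
    p' says precisely that the remaining power q - 2 is still at least q / p.\<close>
  have q3: "real q / p \<le> real q - 2"
  proof -
    have "2 * p \<le> real q * (p - 1)" using q p by (simp add: pos_divide_le_eq)
    then show ?thesis using p by (simp add: field_simps)
  qed
  have pow: "?s y ^ k \<le> profile q y powr (1 / p)" if "q - 2 \<le> k" for y k
  proof (cases "?s y = 0")
    case True
    then show ?thesis using that q2 by (simp add: zero_power)
  next
    case False
    then have s: "0 < ?s y" "?s y \<le> 1"
      using smooth_step_nonneg[of y] smooth_step_le_1[of y] by auto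
    have "?s y ^ k = ?s y powr real k" using s by (simp add: powr_realpow)
    also have "\<dots> \<le> ?s y powr (real q / p)"
      using s q3 that q2 by (intro powr_mono') auto
    also have "\<dots> = profile q y powr (1 / p)"
      using s by (simp add: profile_def powr_realpow[symmetric] powr_powr)
    finally show ?thesis .
  qed
  have der: "(?s has_real_derivative s1 y) (at y)" "(s1 has_real_derivative s2 y) (at y)" for y
    unfolding s1_def s2_def
    by (intro smooth_has_real_derivative smooth_deriv smooth_smooth_step)+
  have d1: "partial 1 (profile q) = (\<lambda>y. real q * ?s y ^ (q - 1) * s1 y)"
  proof
    fix y
    have "(profile q has_real_derivative real q * ?s y ^ (q - 1) * s1 y) (at y)"
      unfolding profile_def[abs_def] using DERIV_power[OF der(1)[of y], of q] by (simp add: mult_ac)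
    then show "partial 1 (profile q) y = real q * ?s y ^ (q - 1) * s1 y" by (rule partial_real_eq)
  qed
  have d2: "partial 1 (partial 1 (profile q)) y
      = real q * (real (q - 1) * ?s y ^ (q - 2) * s1 y * s1 y + ?s y ^ (q - 1) * s2 y)" for y
  proof (rule partial_real_eq)
    have "((\<lambda>y. ?s y ^ (q - 1)) has_real_derivative real (q - 1) * ?s y ^ (q - 2) * s1 y) (at y)"
      using DERIV_power[OF der(1)[of y], of "q - 1"] by (simp add: mult_ac numeral_2_eq_2)
    from DERIV_cmult[OF DERIV_mult[OF this der(2)], of "real q"]
    show "(partial 1 (profile q) has_real_derivative
        real q * (real (q - 1) * ?s y ^ (q - 2) * s1 y * s1 y + ?s y ^ (q - 1) * s2 y)) (at y)"
      unfolding d1 by (simp add: mult_ac)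
  qed
  define M where "M = 1 + real q * M1 + real q * (real (q - 1) * M1 * M1 + M2)"
  have le: "\<bar>a * ?s y ^ k * b\<bar> \<le> a * B * profile q y powr (1 / p)"
    if "0 \<le> a" "q - 2 \<le> k" "\<bar>b\<bar> \<le> B" for a b B y k
  proof -
    have "\<bar>a * ?s y ^ k * b\<bar> = a * (\<bar>b\<bar> * ?s y ^ k)"
      using that smooth_step_nonneg[of y] by (simp add: abs_mult mult_ac)
    also have "\<dots> \<le> a * (B * profile q y powr (1 / p))"
      using that pow[OF that(2)] smooth_step_nonneg[of y]
      by (intro mult_left_mono mult_mono) auto
    finally show ?thesis by (simp add: mult_ac)
  qed
  have M11: "\<bar>s1 y * s1 y\<bar> \<le> M1 * M1" for y
    using M1 unfolding abs_mult by (intro mult_mono) auto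
  show thesis
  proof (rule that[of M])
    show "0 < M" using M1 M2 by (simp add: M_def add_pos_nonneg)
    fix y
    let ?h = "profile q y powr (1 / p)"
    have "\<bar>partial 1 (profile q) y\<bar> \<le> real q * M1 * ?h"
      unfolding d1 using M1 by (intro le) auto
    also have "\<dots> \<le> M * ?h" using M1 M2 unfolding M_def by (intro mult_right_mono) auto
    finally show "\<bar>partial 1 (profile q) y\<bar> \<le> M * ?h" .
    have "\<bar>partial 1 (partial 1 (profile q)) y\<bar>
        \<le> \<bar>real q * real (q - 1) * ?s y ^ (q - 2) * (s1 y * s1 y)\<bar> + \<bar>real q * ?s y ^ (q - 1) * s2 y\<bar>"
      unfolding d2 by (rule order_trans[OF _ abs_triangle_ineq]) (simp add: algebra_simps)
    also have "\<dots> \<le> real q * real (q - 1) * (M1 * M1) * ?h + real q * M2 * ?h"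
      using M2 by (intro add_mono le M11) auto
    also have "\<dots> = (real q * (real (q - 1) * M1 * M1 + M2)) * ?h" by (simp add: algebra_simps)
    also have "\<dots> \<le> M * ?h" using M1 M2 unfolding M_def by (intro mult_right_mono) auto
    finally show "\<bar>partial 1 (partial 1 (profile q)) y\<bar> \<le> M * ?h" .
  qed
qed

lemma cone_test_eq_0:
  fixes x :: "real^'n"
  assumes "0 < q" "0 < S" "0 \<le> t" "S \<le> 1 + t"
  shows "cone_test m \<mu> \<beta> q S \<rho> N (t, x) = 0"
  using assms by (auto simp: cone_test_def time_factor_eq profile_eq_0 intro!: sum.neutral)

lemma wave_op_cone_test_eq_0:
  fixes x :: "real^'n"
  assumes q: "0 < q" and "0 < S" "0 \<le> t" "S < 1 + t"
  shows "wave_op l \<mu> (cone_test m \<mu> \<beta> q S \<rho> N) t x = 0"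
proof -
  have "1 < (1 + t) / S" using assms by simp
  then have "partial 1 (partial 1 (time_factor q S r)) t = 0" "time_factor q S r t = 0" for r
    using assms by (simp_all add: time_factor_deriv2 time_factor_eq profile_derivs_eq_0 profile_eq_0)
  then show ?thesis
    unfolding cone_test_def by (subst wave_op_separable) (auto intro: smooth_time_factor smooth_space_factor)
qed

text \<open>The first term, with \<beta> + 2 m k split into its two parts, is estimated by F and z
  F'; its factor \<open>profile\<close> to the power 1 / p is what Hoelder's inequality will pair
  with the mass. The second is the error of truncation after index N.\<close>

lemma wave_op_cone_test_le:
  fixes x :: "real^'n" and l m \<mu> \<beta> t :: real
  assumes t: "0 \<le> t" and \<rho>: "norm x < \<rho>" and m: "m = 1 + l" "0 < m" and \<beta>: "0 < \<beta>"
    and \<delta>: "0 < \<delta>" "norm x \<le> (1 + t) powr m / m - \<delta>" and S: "0 < S" and q: "0 < q"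
    and M: "0 < M" "\<And>y. \<bar>partial 1 (profile q) y\<bar> \<le> M * profile q y powr (1 / p)"
      "\<And>y. \<bar>partial 1 (partial 1 (profile q)) y\<bar> \<le> M * profile q y powr (1 / p)"
    and K: "0 < K" "\<And>k. hyp_coeff m CARD('n) \<mu> \<beta> k \<le> K"
    "\<And>N z. 0 \<le> z \<Longrightarrow> z < 1 \<Longrightarrow>
       (\<Sum>k\<le>N. hyp_coeff m CARD('n) \<mu> \<beta> k * z ^ k) \<le> K * (1 - z) powr (- \<kappa>)"
    "\<And>N z. 0 \<le> z \<Longrightarrow> z < 1 \<Longrightarrow>
       (\<Sum>k\<le>N. real k * hyp_coeff m CARD('n) \<mu> \<beta> k * z ^ k) \<le> K * (1 - z) powr (- \<kappa>)"
  shows "\<bar>wave_op l \<mu> (cone_test m \<mu> \<beta> q S \<rho> N) t x\<bar>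
    \<le> M * K * (1 + 2 * \<beta> + 4 * m) * (indicator (cone_shell m \<delta> S) (t, x)
         * ((1 + t) powr (- \<beta> - 2) * (1 - cone_var m (1 + t) x) powr (- \<kappa>)
            * profile q ((1 + t) / S) powr (1 / p)))
      + K * ((\<beta> + 2 * m * real N) * (\<beta> + 2 * m * real N + 1) + \<mu>\<^sup>2) * cone_var m (1 + t) x ^ N"
proof -
  define s where "s = 1 + t"
  define z where "z = cone_var m s x"
  define c where "c = hyp_coeff m CARD('n) \<mu> \<beta>"
  define h where "h = profile q (s / S) powr (1 / p)"
  define H1 H2 where H: "H1 = partial 1 (profile q) (s / S)" "H2 = partial 1 (partial 1 (profile q)) (s / S)"
  define F where "F = (\<Sum>k\<le>N. c k * z ^ k)"
  define G where "G = (\<Sum>k\<le>N. (\<beta> + 2 * m * real k) * c k * z ^ k)"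
  define r where "r = (\<beta> + 2 * m * real N) * (\<beta> + 2 * m * real N + 1) + \<mu>\<^sup>2"
  have s: "1 \<le> s" "0 < s" using t by (auto simp: s_def)
  have z: "0 \<le> z" "z < 1"
    using one_minus_cone_var_ge[OF m(2) s(2) \<delta>(1), of x] \<delta>(2) by (auto simp: z_def s_def)
  have cpos: "0 < c k" for k unfolding c_def using m \<beta> by (intro hyp_coeff_pos) auto
  have r0: "0 \<le> r" using \<beta> m unfolding r_def by (intro add_nonneg_nonneg mult_nonneg_nonneg) auto
  have F0: "0 \<le> F" and G0: "0 \<le> G"
    unfolding F_def G_def using z cpos \<beta> m
    by (auto intro!: sum_nonneg mult_nonneg_nonneg less_imp_le[OF cpos])
  have FK: "F \<le> K * (1 - z) powr (- \<kappa>)" using K(3)[OF z] by (simp add: F_def c_def)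
  have "G = \<beta> * F + 2 * m * (\<Sum>k\<le>N. real k * c k * z ^ k)"
    by (simp add: F_def G_def sum_distrib_left sum.distrib[symmetric] algebra_simps)
  also have "\<dots> \<le> \<beta> * (K * (1 - z) powr (- \<kappa>)) + 2 * m * (K * (1 - z) powr (- \<kappa>))"
    using FK K(4)[OF z, of N] \<beta> m by (intro add_mono mult_left_mono) (auto simp: c_def)
  finally have GK: "G \<le> (\<beta> + 2 * m) * K * (1 - z) powr (- \<kappa>)" by (simp add: algebra_simps)
  have eq: "wave_op l \<mu> (cone_test m \<mu> \<beta> q S \<rho> N) t x
      = s powr (- \<beta>) * (H2 / S\<^sup>2 * F - 2 * (H1 / (S * s)) * G)
        + profile q (s / S) * s powr (- \<beta> - 2) * (c N * r * z ^ N)"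
    using wave_op_cone_test[OF t _ \<rho> m, of \<mu> \<beta> q S N] \<rho>
    by (simp add: s_def z_def c_def F_def G_def H r_def le_less_trans[OF norm_ge_zero \<rho>])
  have "\<bar>profile q (s / S) * s powr (- \<beta> - 2) * (c N * r * z ^ N)\<bar> \<le> (1 * 1) * (K * r * z ^ N)"
  proof -
    have "s powr (- \<beta> - 2) \<le> s powr 0" using s \<beta> by (intro powr_mono) auto
    then have "s powr (- \<beta> - 2) \<le> 1" using s by simp
    then have "profile q (s / S) * s powr (- \<beta> - 2) * (c N * r * z ^ N) \<le> (1 * 1) * (K * r * z ^ N)"
      using profile_nonneg profile_le_1 cpos[of N] K(2)[of N] r0 z
      by (intro mult_mono mult_right_mono mult_nonneg_nonneg) (auto simp: c_def less_imp_le)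
    moreover have "0 \<le> profile q (s / S) * s powr (- \<beta> - 2) * (c N * r * z ^ N)"
      using profile_nonneg cpos[of N] r0 z by (intro mult_nonneg_nonneg) (auto simp: less_imp_le)
    ultimately show ?thesis by simp
  qed
  moreover have "\<bar>s powr (- \<beta>) * (H2 / S\<^sup>2 * F - 2 * (H1 / (S * s)) * G)\<bar>
      \<le> M * K * (1 + 2 * \<beta> + 4 * m) * (indicator (cone_shell m \<delta> S) (t, x)
          * (s powr (- \<beta> - 2) * (1 - z) powr (- \<kappa>) * h))"
  proof (cases "S / 2 \<le> s \<and> s \<le> S")
    case True
    then have sh: "(t, x) \<in> cone_shell m \<delta> S" using \<delta> by (simp add: cone_shell_def s_def)
    have h0: "0 \<le> h" by (simp add: h_def)
    \<comment> \<open>On the shell s \<le> S, so every 1 / S may be replaced by 1 / s.\<close>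
    have H1: "\<bar>H1 / (S * s)\<bar> \<le> M * h / s\<^sup>2" and H2: "\<bar>H2 / S\<^sup>2\<bar> \<le> M * h / s\<^sup>2"
    proof -
      have "\<bar>H1 / (S * s)\<bar> = \<bar>H1\<bar> / (S * s)" "\<bar>H2 / S\<^sup>2\<bar> = \<bar>H2\<bar> / S\<^sup>2" using S s by auto
      moreover have "\<bar>H1\<bar> / (S * s) \<le> M * h / s\<^sup>2" "\<bar>H2\<bar> / S\<^sup>2 \<le> M * h / s\<^sup>2"
        using M True s S h0 unfolding H h_def power2_eq_square
        by (intro frac_le mult_mono; auto)+
      ultimately show "\<bar>H1 / (S * s)\<bar> \<le> M * h / s\<^sup>2" "\<bar>H2 / S\<^sup>2\<bar> \<le> M * h / s\<^sup>2" by auto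
    qed
    have "\<bar>H2 / S\<^sup>2 * F - 2 * (H1 / (S * s)) * G\<bar> \<le> \<bar>H2 / S\<^sup>2\<bar> * F + 2 * \<bar>H1 / (S * s)\<bar> * G"
      using F0 G0 abs_triangle_ineq4[of "H2 / S\<^sup>2 * F" "2 * (H1 / (S * s)) * G"]
      by (simp only: abs_mult abs_of_nonneg abs_numeral)
    also have "\<dots> \<le> M * h / s\<^sup>2 * (K * (1 - z) powr (- \<kappa>))
        + 2 * (M * h / s\<^sup>2) * ((\<beta> + 2 * m) * K * (1 - z) powr (- \<kappa>))"
      using H1 H2 FK GK F0 G0 M(1) h0 by (intro add_mono mult_mono) auto
    also have "\<dots> = M * K * (1 + 2 * \<beta> + 4 * m) * (1 - z) powr (- \<kappa>) * h / s\<^sup>2"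
      using s by (simp add: field_simps)
    finally have "s powr (- \<beta>) * \<bar>H2 / S\<^sup>2 * F - 2 * (H1 / (S * s)) * G\<bar>
        \<le> s powr (- \<beta>) * (M * K * (1 + 2 * \<beta> + 4 * m) * (1 - z) powr (- \<kappa>) * h / s\<^sup>2)"
      by (intro mult_left_mono) auto
    then show ?thesis
      using sh s by (simp add: abs_mult powr_diff powr_realpow mult_ac)
  next
    case False
    then have "s / S < 1 / 2 \<or> 1 < s / S" using S by (auto simp: field_simps)
    then have "H1 = 0" "H2 = 0" using q by (simp_all add: H profile_derivs_eq_0)
    then show ?thesis using M(1) K(1) \<beta> m by (simp add: h_def mult_nonneg_nonneg)
  qed
  ultimately show ?thesis
    unfolding eq s_def[symmetric] z_def[symmetric] h_def[symmetric] r_def[symmetric]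
    by (intro order_trans[OF abs_triangle_ineq] add_mono) auto
qed

subsection \<open>From weak solutions to integral inequalities\<close>

text \<open>The bound is required only where \<open>f\<close> does not vanish, because weights such
  as negative powers of 1 - z are bounded only on the support of the solution.\<close>

lemma integrable_mult_bounded:
  fixes f h :: "'a \<Rightarrow> real"
  assumes "integrable M f" "h \<in> borel_measurable M" "\<And>x. f x \<noteq> 0 \<Longrightarrow> \<bar>h x\<bar> \<le> B"
  shows "integrable M (\<lambda>x. f x * h x)"
proof (rule Bochner_Integration.integrable_bound)
  show "integrable M (\<lambda>x. B * f x)" using assms(1) by simp
  show "(\<lambda>x. f x * h x) \<in> borel_measurable M"
    using assms(1,2) by measurable
  have "norm (f x * h x) \<le> norm (B * f x)" for x
  proof (cases "f x = 0")
    case False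
    then have "\<bar>f x\<bar> * \<bar>h x\<bar> \<le> \<bar>f x\<bar> * \<bar>B\<bar>"
      using assms(3)[of x] by (intro mult_left_mono) auto
    then show ?thesis by (simp add: abs_mult mult.commute)
  qed simp
  then show "AE x in M. norm (f x * h x) \<le> norm (B * f x)" by simp
qed

text \<open>On the ball 2 |f| \<le> 1 + f^2, and outside of it f vanishes.\<close>

lemma L2_integrable:
  fixes f :: "'a::euclidean_space \<Rightarrow> real"
  assumes "L2 f" "ess_supp f \<subseteq> cball 0 R"
  shows "integrable lebesgue f"
proof (rule Bochner_Integration.integrable_bound)
  have "integrable lebesgue (indicator (cball 0 R :: 'a set) :: 'a \<Rightarrow> real)"
    using emeasure_lborel_cball_finite[of "0 :: 'a" R] by (intro integrable_real_indicator) auto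
  then show "integrable lebesgue (\<lambda>x. indicator (cball 0 R) x + (f x)\<^sup>2)"
    using assms(1) by (auto simp: L2_def)
  show "f \<in> borel_measurable lebesgue" using assms(1) by (simp add: L2_def)
  show "AE x in lebesgue. norm (f x) \<le> norm (indicator (cball 0 R) x + (f x)\<^sup>2)"
    using ess_supp_AE[of f]
  proof eventually_elim
    case (elim x)
    show ?case
    proof (cases "x \<in> cball 0 R")
      case True
      have "0 \<le> (\<bar>f x\<bar> - 1)\<^sup>2" by simp
      then have "2 * \<bar>f x\<bar> \<le> 1 + (f x)\<^sup>2" by (simp add: power2_diff)
      moreover have "0 \<le> \<bar>f x\<bar>" by simp
      ultimately have "\<bar>f x\<bar> \<le> 1 + (f x)\<^sup>2" by linarith
      then show ?thesis using True by simp
    qed (use elim assms(2) in auto)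
  qed
qed

text \<open>The function \<open>W\<close> replaces |u|^p up to time \<open>T0\<close> in all later
  integrals. Multiplying a Borel version by the indicator of the truncated cone makes the support
  property hold everywhere and not only almost everywhere, which permits pointwise estimates of the
  weights.\<close>

lemma weak_solution_density:
  fixes u :: "real \<Rightarrow> real^'n \<Rightarrow> real"
  assumes ws: "weak_solution l \<mu> p R \<epsilon> f g T u" and l: "-1 < l" and m: "m = 1 + l"
    and R: "0 < \<delta>" "\<delta> = 1 / m - R" and T0: "0 \<le> T0" "ereal T0 < T"
  obtains W where "integrable lborel W" "\<And>z. 0 \<le> W z"
    "\<And>t x. W (t, x) \<noteq> 0 \<Longrightarrow> 0 \<le> t \<and> t \<le> T0 \<and> norm x \<le> (1 + t) powr m / m - \<delta>"
    "AE t in lebesgue. AE x in lebesgue. 0 \<le> t \<and> t \<le> T0 \<longrightarrow>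
       W (t, x) = \<bar>u t x\<bar> powr p \<and> (\<not> norm x \<le> (1 + t) powr m / m - \<delta> \<longrightarrow> u t x = 0)"
proof -
  have m0: "0 < m" using l m by simp
  define \<rho> where "\<rho> = (1 + T0) powr m / m"
  define Q where "Q = {0..T0} \<times> (cball 0 \<rho> :: (real^'n) set)"
  have Q: "compact Q" unfolding Q_def by (intro compact_Times) auto
  have "t \<in> time_interval T" if "0 \<le> t" "t \<le> T0" for t
    using that T0 by (auto simp: time_interval_def intro: le_less_trans[of _ "ereal T0"])
  note ti = this
  have "Q \<subseteq> time_interval T \<times> UNIV" using ti by (auto simp: Q_def)
  then have "set_integrable lebesgue Q (\<lambda>(t, x). \<bar>u t x\<bar> powr p)"
    using ws Q by (auto simp: weak_solution_def L1_loc_def)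
  then obtain W0 where W0: "integrable lborel W0" "\<And>z. 0 \<le> W0 z"
    "AE t in lebesgue. AE x in lebesgue. (t, x) \<in> Q \<longrightarrow> W0 (t, x) = (case (t, x) of (t, x) \<Rightarrow> \<bar>u t x\<bar> powr p)"
    by (rule borel_version_on_compact[OF _ Q]) auto
  define C where "C = {z :: real \<times> (real^'n). 0 \<le> fst z \<and> fst z \<le> T0 \<and> norm (snd z) \<le> (1 + fst z) powr m / m - \<delta>}"
  have "{z \<in> space (borel \<Otimes>\<^sub>M (borel :: (real^'n) measure)). 0 \<le> fst z \<and> fst z \<le> T0
      \<and> norm (snd z) \<le> (1 + fst z) powr m / m - \<delta>} \<in> sets (borel \<Otimes>\<^sub>M borel)"
    by measurable
  then have C: "C \<in> sets borel" unfolding borel_prod by (simp add: C_def)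
  define W where "W z = W0 z * indicator C z" for z
  show thesis
  proof (rule that[of W])
    show "integrable lborel W"
      unfolding W_def[abs_def] using C
      by (intro integrable_mult_bounded[OF W0(1), of _ 1]) (auto simp: indicator_def)
    show "0 \<le> W z" for z using W0(2) by (simp add: W_def)
    show "0 \<le> t \<and> t \<le> T0 \<and> norm x \<le> (1 + t) powr m / m - \<delta>" if "W (t, x) \<noteq> 0" for t x
      using that by (auto simp: W_def C_def indicator_def split: if_splits)
    show "AE t in lebesgue. AE x in lebesgue. 0 \<le> t \<and> t \<le> T0 \<longrightarrow>
       W (t, x) = \<bar>u t x\<bar> powr p \<and> (\<not> norm x \<le> (1 + t) powr m / m - \<delta> \<longrightarrow> u t x = 0)"
      using W0(3)
    proof eventually_elim
      case (elim t)
      show ?case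
        using elim ess_supp_AE[of "u t"]
      proof eventually_elim
        case (elim x)
        show ?case
        proof (intro impI)
          assume t: "0 \<le> t \<and> t \<le> T0"
          have "R + distance l t = (1 + t) powr m / m - \<delta>"
            using distance_eq[OF l, of t] t by (simp add: m R(2) diff_divide_distrib)
          moreover have "ess_supp (u t) \<subseteq> cball 0 (R + distance l t)"
            using ws ti[of t] t unfolding weak_solution_def by blast
          ultimately have "x \<notin> ess_supp (u t)" if "\<not> norm x \<le> (1 + t) powr m / m - \<delta>"
            using that by auto
          then have supp: "u t x = 0" if "\<not> norm x \<le> (1 + t) powr m / m - \<delta>"
            using elim(2) that by blast
          have "W (t, x) = \<bar>u t x\<bar> powr p"
          proof (cases "norm x \<le> (1 + t) powr m / m - \<delta>")
            case True
            have "(1 + t) powr m / m \<le> \<rho>"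
              using t m0 unfolding \<rho>_def by (intro divide_right_mono powr_mono2) auto
            then have "(t, x) \<in> Q" using True t R(1) by (auto simp: Q_def)
            then show ?thesis using elim(1) True t by (simp add: W_def C_def)
          next
            case False
            then show ?thesis using supp by (simp add: W_def C_def)
          qed
          then show "W (t, x) = \<bar>u t x\<bar> powr p \<and> (\<not> norm x \<le> (1 + t) powr m / m - \<delta> \<longrightarrow> u t x = 0)"
            using supp by blast
        qed
      qed
    qed
  qed
qed

text \<open>At time 0 all terms of the series are nonnegative, and so are f and g; the terms with k
  = 0 alone give the lower bound, with coefficients 1 and \<beta>.\<close>

lemma cone_test_data_ge:
  fixes f g :: "real^'n \<Rightarrow> real"
  assumes fg: "integrable lebesgue f" "integrable lebesgue g"
    "AE x in lebesgue. 0 \<le> f x" "AE x in lebesgue. 0 \<le> g x"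
    "ess_supp f \<union> ess_supp g \<subseteq> cball 0 R"
    and R: "R < 1 / m" "R \<le> \<rho>" "0 < \<rho>" and m: "0 < m" and \<beta>: "0 < \<beta>" and S: "2 < S"
  shows "(LINT x|lebesgue. g x) + \<beta> * (LINT x|lebesgue. f x)
    \<le> (LINT x|lebesgue. g x * cone_test m \<mu> \<beta> q S \<rho> N (0, x)
        - f x * time_deriv (cone_test m \<mu> \<beta> q S \<rho> N) (0, x))"
proof -
  define c where "c = hyp_coeff m CARD('n) \<mu> \<beta>"
  have cpos: "0 < c k" for k unfolding c_def using m \<beta> by (intro hyp_coeff_pos) auto
  define \<psi> where "\<psi> = (cone_test m \<mu> \<beta> q S \<rho> N :: real \<times> (real^'n) \<Rightarrow> real)"
  define Z where "Z x = cone_var m 1 x" for x :: "real^'n"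
  \<comment> \<open>Cut off at radius \<open>R\<close> < 1 / m, where z \<le> 1 at time 0; thus both
    are bounded Borel functions.\<close>
  define G1 where "G1 x = indicator (cball 0 R) x * (\<Sum>k\<le>N. c k * Z x ^ k)" for x
  define G2 where "G2 x = indicator (cball 0 R) x * (\<Sum>k\<le>N. (\<beta> + 2 * m * real k) * c k * Z x ^ k)" for x
  have Z: "0 \<le> Z x" "Z x \<le> 1" if "norm x \<le> R" for x
  proof -
    have "m * norm x \<le> m * R" using that m by simp
    also have "\<dots> \<le> 1" using R m by (simp add: field_simps)
    finally have "norm x * m \<le> 1" by (simp add: mult.commute)
    then show "0 \<le> Z x" "Z x \<le> 1" using m
      unfolding Z_def cone_var_eq[OF m zero_less_one] by (auto simp: power_le_one)
  qed
  have meas: "G1 \<in> borel_measurable lebesgue" "G2 \<in> borel_measurable lebesgue"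
  proof -
    have [measurable]: "(cball 0 R :: (real^'n) set) \<in> sets borel" by simp
    have "G1 \<in> borel_measurable borel" "G2 \<in> borel_measurable borel"
      unfolding G1_def[abs_def] G2_def[abs_def] Z_def cone_var_def by measurable
    then show "G1 \<in> borel_measurable lebesgue" "G2 \<in> borel_measurable lebesgue"
      by (auto intro: measurable_completion)
  qed
  have bound: "\<bar>indicator (cball 0 R) x * (\<Sum>k\<le>N. a k * Z x ^ k)\<bar> \<le> (\<Sum>k\<le>N. a k)"
    if "\<And>k. 0 \<le> a k" for a x
  proof (cases "norm x \<le> R")
    case True
    have "0 \<le> (\<Sum>k\<le>N. a k * Z x ^ k)"
      using Z[OF True] that by (intro sum_nonneg mult_nonneg_nonneg zero_le_power)
    moreover have "(\<Sum>k\<le>N. a k * Z x ^ k) \<le> (\<Sum>k\<le>N. a k * 1)"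
      using Z[OF True] that by (intro sum_mono mult_left_mono power_le_one)
    ultimately show ?thesis using True by simp
  qed (use that in \<open>auto intro: sum_nonneg\<close>)
  have int: "integrable lebesgue (\<lambda>x. g x * G1 x)" "integrable lebesgue (\<lambda>x. f x * G2 x)"
  proof -
    have b: "\<bar>G1 x\<bar> \<le> (\<Sum>k\<le>N. c k)" "\<bar>G2 x\<bar> \<le> (\<Sum>k\<le>N. (\<beta> + 2 * m * real k) * c k)" for x
      unfolding G1_def G2_def using cpos m \<beta> by (intro bound; simp add: less_imp_le)+
    show "integrable lebesgue (\<lambda>x. g x * G1 x)" "integrable lebesgue (\<lambda>x. f x * G2 x)"
      by (rule integrable_mult_bounded[OF fg(2) meas(1) b(1)] integrable_mult_bounded[OF fg(1) meas(2) b(2)])+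
  qed
  have ge: "1 \<le> G1 x" "\<beta> \<le> G2 x" if "norm x \<le> R" for x
  proof -
    have "c 0 * Z x ^ 0 \<le> (\<Sum>k\<le>N. c k * Z x ^ k)"
      using Z[OF that] cpos by (intro member_le_sum) (auto simp: less_imp_le)
    moreover have "(\<beta> + 2 * m * real 0) * c 0 * Z x ^ 0 \<le> (\<Sum>k\<le>N. (\<beta> + 2 * m * real k) * c k * Z x ^ k)"
      using Z[OF that] cpos m \<beta> by (intro member_le_sum[of 0]) (auto simp: less_imp_le)
    ultimately show "1 \<le> G1 x" "\<beta> \<le> G2 x" using that by (simp_all add: G1_def G2_def c_def)
  qed
  have fg0: "AE x in lebesgue. \<not> norm x \<le> R \<longrightarrow> f x = 0 \<and> g x = 0"
    using ess_supp_AE[of f] ess_supp_AE[of g] by eventually_elim (use fg(5) in auto)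
  have eq: "AE x in lebesgue. g x * G1 x + f x * G2 x = g x * \<psi> (0, x) - f x * time_deriv \<psi> (0, x)"
    using fg0
  proof eventually_elim
    case (elim x)
    show ?case
    proof (cases "norm x \<le> R")
      case True
      have "\<psi> (0, x) = G1 x"
        using True R S unfolding \<psi>_def by (subst cone_test_eq) (auto simp: profile_eq_1 G1_def c_def Z_def)
      moreover have "time_deriv \<psi> (0, x) = - G2 x"
        using True R S unfolding \<psi>_def by (subst cone_test_time_deriv_0) (auto simp: G2_def c_def Z_def)
      ultimately show ?thesis by simp
    qed (use elim in simp)
  qed
  have "(LINT x|lebesgue. g x) + \<beta> * (LINT x|lebesgue. f x) = (LINT x|lebesgue. g x + \<beta> * f x)"
    using fg by simp
  also have "\<dots> \<le> (LINT x|lebesgue. g x * G1 x + f x * G2 x)"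
  proof (rule integral_mono_AE)
    show "AE x in lebesgue. g x + \<beta> * f x \<le> g x * G1 x + f x * G2 x"
      using fg(3,4) fg0
    proof eventually_elim
      case (elim x)
      show ?case
      proof (cases "norm x \<le> R")
        case True
        show ?thesis
          using mult_left_mono[OF ge(1)[OF True] elim(2)] mult_left_mono[OF ge(2)[OF True] elim(1)]
          by (simp add: mult.commute)
      qed (use elim in simp)
    qed
  qed (use fg int in auto)
  also have "\<dots> = (LINT x|lebesgue. g x * \<psi> (0, x) - f x * time_deriv \<psi> (0, x))"
  proof (rule integral_cong_AE)
    show m: "(\<lambda>x. g x * G1 x + f x * G2 x) \<in> borel_measurable lebesgue"
      using int by (intro borel_measurable_add borel_measurable_integrable)
    show "(\<lambda>x. g x * \<psi> (0, x) - f x * time_deriv \<psi> (0, x)) \<in> borel_measurable lebesgue"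
      by (rule borel_measurable_completion_cong_AE[OF m eq])
  qed (rule eq)
  finally show ?thesis unfolding \<psi>_def .
qed

lemma time_interval_integral_eq:
  "(LINT t:time_interval T|lebesgue. LINT x|lebesgue. a t x)
    = (LINT t|lebesgue. LINT x|lebesgue. indicator (time_interval T) t * a t x)" for a :: "real \<Rightarrow> real^'n \<Rightarrow> real"
  by (simp add: set_lebesgue_integral_def)

text \<open>The truncated test function is inserted into the weak formulation, and N tends to
  infinity with \<open>T0\<close> fixed. The constants \<open>M\<close> and \<open>K\<close> are
  given in advance, so nothing depends on S, on \<open>T0\<close> or on the solution.\<close>

lemma weak_solution_cone_inequality:
  fixes u :: "real \<Rightarrow> real^'n \<Rightarrow> real" and f g :: "real^'n \<Rightarrow> real"
  assumes ws: "weak_solution l \<mu> p R \<epsilon> f g T u" and p: "1 < p" and m: "m = 1 + l" "0 < m"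
    and R: "0 < R" "0 < \<delta>" "\<delta> = 1 / m - R" and T0: "0 \<le> T0" "ereal T0 < T" and S: "2 < S" "S \<le> 1 + T0"
    and \<epsilon>: "0 < \<epsilon>" and fg: "integrable lebesgue f" "integrable lebesgue g"
    "AE x in lebesgue. 0 \<le> f x" "AE x in lebesgue. 0 \<le> g x"
    and W: "integrable lborel W" "\<And>z. 0 \<le> W z"
    "\<And>t x. W (t, x) \<noteq> 0 \<Longrightarrow> 0 \<le> t \<and> t \<le> T0 \<and> norm x \<le> (1 + t) powr m / m - \<delta>"
    "AE t in lebesgue. AE x in lebesgue. 0 \<le> t \<and> t \<le> T0 \<longrightarrow>
       W (t, x) = \<bar>u t x\<bar> powr p \<and> (\<not> norm x \<le> (1 + t) powr m / m - \<delta> \<longrightarrow> u t x = 0)"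
    and \<beta>: "0 < \<beta>" and q: "0 < q" and \<kappa>: "0 \<le> \<kappa>"
    and M: "0 < M" "\<And>y. \<bar>partial 1 (profile q) y\<bar> \<le> M * profile q y powr (1 / p)"
      "\<And>y. \<bar>partial 1 (partial 1 (profile q)) y\<bar> \<le> M * profile q y powr (1 / p)"
    and K: "0 < K" "\<And>k. hyp_coeff m CARD('n) \<mu> \<beta> k \<le> K"
    "\<And>N z. 0 \<le> z \<Longrightarrow> z < 1 \<Longrightarrow>
       (\<Sum>k\<le>N. hyp_coeff m CARD('n) \<mu> \<beta> k * z ^ k) \<le> K * (1 - z) powr (- \<kappa>)"
    "\<And>N z. 0 \<le> z \<Longrightarrow> z < 1 \<Longrightarrow>
       (\<Sum>k\<le>N. real k * hyp_coeff m CARD('n) \<mu> \<beta> k * z ^ k) \<le> K * (1 - z) powr (- \<kappa>)"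
  defines "G \<equiv> \<lambda>z. indicator (cone_shell m \<delta> S) z
      * ((1 + fst z) powr (- \<beta> - 2) * (1 - cone_var m (1 + fst z) (snd z)) powr (- \<kappa>)
         * profile q ((1 + fst z) / S) powr (1 / p))"
  shows "(LINT z|lborel. W z * ((1 + fst z) powr (- \<beta>) * profile q ((1 + fst z) / S)))
      + \<epsilon> * ((LINT x|lebesgue. g x) + \<beta> * (LINT x|lebesgue. f x))
    \<le> M * K * (1 + 2 * \<beta> + 4 * m) * (LINT z|lborel. W z powr (1 / p) * G z)"
proof -
  define \<rho> where "\<rho> = (1 + T0) powr m / m"
  define c where "c = hyp_coeff m CARD('n) \<mu> \<beta>"
  have cpos: "0 < c k" for k unfolding c_def using m \<beta> by (intro hyp_coeff_pos) auto
  have rho1: "1 / m \<le> \<rho>"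
    using m T0 unfolding \<rho>_def by (intro divide_right_mono) (auto simp: ge_one_powr_ge_zero)
  then have \<rho>: "0 < \<rho>" "\<delta> < \<rho>" "R \<le> \<rho>" using R m by (auto intro: less_le_trans[of 0 "1 / m"])
  have radius: "(1 + t) powr m / m \<le> \<rho>" if "0 \<le> t" "t \<le> T0" for t
    using that m unfolding \<rho>_def by (intro divide_right_mono powr_mono2) auto
  \<comment> \<open>Uniform bound for z up to time \<open>T0\<close>: |x| / \<tau> \<le> 1 -
    \<delta> / \<tau>, and the radius \<tau> of the cone is at most \<rho>. It deteriorates as
    \<open>T0\<close> grows, which does not matter for the limit in N.\<close>
  define \<zeta> where "\<zeta> = (1 - \<delta> / \<rho>)\<^sup>2"
  have \<zeta>: "0 \<le> \<zeta>" "\<zeta> < 1"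
    using \<rho> R by (auto simp: \<zeta>_def power_less_one_iff abs_less_iff)
  have cone: "0 \<le> cone_var m (1 + t) x" "cone_var m (1 + t) x \<le> \<zeta>" "\<delta> / \<rho> \<le> 1 - cone_var m (1 + t) x"
      "cone_var m (1 + t) x < 1" "norm x < \<rho>"
    if "0 \<le> t" "t \<le> T0" "norm x \<le> (1 + t) powr m / m - \<delta>" for t and x :: "real^'n"
  proof -
    define \<tau> where "\<tau> = (1 + t) powr m / m"
    have t1: "0 < 1 + t" using that by simp
    have \<tau>: "0 < \<tau>" "\<tau> \<le> \<rho>" "norm x \<le> \<tau> - \<delta>" using that m t1 radius by (auto simp: \<tau>_def)
    note ge = one_minus_cone_var_ge[OF m(2) t1 R(2) that(3), folded \<tau>_def]
    show "0 \<le> cone_var m (1 + t) x" "cone_var m (1 + t) x < 1" using ge by auto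
    show "norm x < \<rho>" using \<tau> R by linarith
    have d: "\<delta> / \<rho> \<le> \<delta> / \<tau>" using \<tau> R \<rho> by (intro divide_left_mono) auto
    also have "\<dots> \<le> (\<tau> - norm x) / \<tau>" using \<tau> by (intro divide_right_mono) auto
    finally show "\<delta> / \<rho> \<le> 1 - cone_var m (1 + t) x" using ge(1) by linarith
    have "norm x / \<tau> \<le> (\<tau> - \<delta>) / \<tau>" using \<tau> by (intro divide_right_mono) auto
    also have "\<dots> = 1 - \<delta> / \<tau>" using \<tau> by (simp add: diff_divide_distrib)
    also have "\<dots> \<le> 1 - \<delta> / \<rho>" using d by simp
    finally show "cone_var m (1 + t) x \<le> \<zeta>"
      using \<tau> unfolding cone_var_eq[OF m(2) t1] \<tau>_def[symmetric] \<zeta>_def by (intro power_mono) auto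
  qed
  have Wm[measurable]: "W \<in> borel_measurable (borel \<Otimes>\<^sub>M borel)"
    using borel_measurable_integrable[OF W(1)] by (simp add: borel_prod)
  have Pm[measurable]: "profile q \<in> borel_measurable borel"
    by (intro borel_measurable_continuous_onI smooth_continuous smooth_profile)
  have in_time: "t \<in> time_interval T" if "0 \<le> t" "t \<le> T0" for t
    using that T0 by (auto simp: time_interval_def intro: le_less_trans[of _ "ereal T0"])
  have time_nonneg: "0 \<le> t" if "t \<in> time_interval T" for t using that by (simp add: time_interval_def)
  \<comment> \<open>Almost everywhere up to \<open>T0\<close> this is |u|.\<close>
  define V where "V z = W z powr (1 / p)" for z
  have V: "integrable lborel V"
  proof (rule Bochner_Integration.integrable_bound)
    have "integrable lborel (indicator ({0..T0} \<times> (cball 0 \<rho> :: (real^'n) set)) :: _ \<Rightarrow> real)"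
    proof (rule integrable_real_indicator)
      have "compact ({0..T0} \<times> (cball 0 \<rho> :: (real^'n) set))" by (intro compact_Times) auto
      from emeasure_compact_finite[OF this] borel_compact[OF this]
      show "emeasure lborel ({0..T0} \<times> (cball 0 \<rho> :: (real^'n) set)) < \<infinity>"
        "{0..T0} \<times> (cball 0 \<rho> :: (real^'n) set) \<in> sets lborel"
        by simp_all
    qed
    then show "integrable lborel (\<lambda>z. indicator ({0..T0} \<times> (cball 0 \<rho> :: (real^'n) set)) z + W z)"
      using W(1) by simp
    show "V \<in> borel_measurable lborel"
    proof -
      have "V \<in> borel_measurable (borel \<Otimes>\<^sub>M borel)" unfolding V_def[abs_def] by measurable
      then show ?thesis by (simp add: borel_prod)
    qed
    have "norm (V z) \<le> norm (indicator ({0..T0} \<times> cball 0 \<rho>) z + W z)" for z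
    proof (cases "W z = 0")
      case True
      then show ?thesis by (simp add: V_def)
    next
      case False
      obtain t x where z: "z = (t, x)" by (cases z)
      have tx: "0 \<le> t" "t \<le> T0" "norm x \<le> (1 + t) powr m / m - \<delta>" using W(3)[of t x] False z by auto
      have "z \<in> {0..T0} \<times> cball 0 \<rho>" using tx cone(5)[OF tx] z by auto
      moreover have "V z \<le> 1 + W z"
      proof (cases "W z \<le> 1")
        case True
        then have "V z \<le> 1 powr (1 / p)" unfolding V_def using W(2) p by (intro powr_mono2) auto
        then show ?thesis using W(2)[of z] by simp
      next
        case False
        then have "V z \<le> W z powr 1" unfolding V_def using p by (intro powr_mono) auto
        then show ?thesis using False by simp
      qed
      ultimately show ?thesis using W(2)[of z] by (simp add: V_def)
    qed
    then show "AE z in lborel. norm (V z) \<le> norm (indicator ({0..T0} \<times> cball 0 \<rho>) z + W z)" by simp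
  qed
  have V0: "0 \<le> V z" for z by (simp add: V_def)
  have VW: "V z \<noteq> 0 \<Longrightarrow> W z \<noteq> 0" for z by (auto simp: V_def)
  have VG: "integrable lborel (\<lambda>z. V z * G z)"
  proof (rule integrable_mult_bounded[OF V])
    have [measurable]: "cone_shell m \<delta> S \<in> sets (borel \<Otimes>\<^sub>M (borel :: (real^'n) measure))"
      unfolding borel_prod by (rule cone_shell_borel)
    have "G \<in> borel_measurable (borel \<Otimes>\<^sub>M borel)"
      unfolding G_def cone_var_def by measurable
    then show "G \<in> borel_measurable lborel" by (simp add: borel_prod)
    fix z assume "V z \<noteq> 0"
    then have "W z \<noteq> 0" by (rule VW)
    obtain t x where z: "z = (t, x)" by (cases z)
    have tx: "0 \<le> t" "t \<le> T0" "norm x \<le> (1 + t) powr m / m - \<delta>" using W(3)[of t x] \<open>W z \<noteq> 0\<close> z by auto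
    have "(1 + t) powr (- \<beta> - 2) \<le> (1 + t) powr 0" using tx \<beta> by (intro powr_mono) auto
    moreover have "(1 - cone_var m (1 + t) x) powr (- \<kappa>) \<le> (\<delta> / \<rho>) powr (- \<kappa>)"
      using cone[OF tx] R \<rho> \<kappa> by (intro powr_mono2') auto
    moreover have "profile q ((1 + t) / S) powr (1 / p) \<le> 1 powr (1 / p)"
      using p profile_nonneg profile_le_1 by (intro powr_mono2) auto
    ultimately have "indicator (cone_shell m \<delta> S) z * ((1 + t) powr (- \<beta> - 2) * (1 - cone_var m (1 + t) x) powr (- \<kappa>)
         * profile q ((1 + t) / S) powr (1 / p)) \<le> 1 * (1 * (\<delta> / \<rho>) powr (- \<kappa>) * 1)"
      using tx by (intro mult_mono mult_nonneg_nonneg) (auto simp: indicator_def)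
    then show "\<bar>G z\<bar> \<le> (\<delta> / \<rho>) powr (- \<kappa>)" by (simp add: G_def z)
  qed
  \<comment> \<open>A bound for the truncation error, a quadratic polynomial in N times a geometric
    sequence.\<close>
  define b where "b N = K * ((\<beta> + 2 * m * real N) * (\<beta> + 2 * m * real N + 1) + \<mu>\<^sup>2) * \<zeta> ^ N" for N
  have b: "b \<longlonglongrightarrow> 0"
  proof -
    define \<eta> where "\<eta> = 1 - \<delta> / \<rho>"
    have \<eta>: "norm \<eta> < 1" "\<zeta> = \<eta>\<^sup>2" using \<rho> R by (auto simp: \<eta>_def \<zeta>_def)
    have l1: "(\<lambda>N. real N * \<zeta> ^ N) \<longlonglongrightarrow> 0"
      using \<zeta> by (intro powser_times_n_limit_0) simp
    have "(\<lambda>N. (real N * \<eta> ^ N)\<^sup>2) \<longlonglongrightarrow> 0\<^sup>2"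
      using \<eta> by (intro tendsto_power powser_times_n_limit_0)
    then have l2: "(\<lambda>N. real N ^ 2 * \<zeta> ^ N) \<longlonglongrightarrow> 0"
      by (simp add: \<eta>(2) power_mult_distrib power_mult[symmetric] mult.commute)
    have "(\<lambda>N. K * (4 * m\<^sup>2) * (real N ^ 2 * \<zeta> ^ N) + K * (4 * m * \<beta> + 2 * m) * (real N * \<zeta> ^ N)
        + K * (\<beta> * (\<beta> + 1) + \<mu>\<^sup>2) * \<zeta> ^ N) \<longlonglongrightarrow> K * (4 * m\<^sup>2) * 0 + K * (4 * m * \<beta> + 2 * m) * 0 + K * (\<beta> * (\<beta> + 1) + \<mu>\<^sup>2) * 0"
      using \<zeta> by (intro tendsto_add tendsto_mult tendsto_const l1 l2 LIMSEQ_realpow_zero) auto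
    then show ?thesis by (simp add: b_def[abs_def] algebra_simps power2_eq_square)
  qed
  have bound: "(LINT z|lborel. W z * ((1 + fst z) powr (- \<beta>) * profile q ((1 + fst z) / S)))
      + \<epsilon> * ((LINT x|lebesgue. g x) + \<beta> * (LINT x|lebesgue. f x))
    \<le> M * K * (1 + 2 * \<beta> + 4 * m) * (LINT z|lborel. V z * G z) + b N * (LINT z|lborel. V z)" for N
  proof -
    define \<psi> where "\<psi> = (cone_test m \<mu> \<beta> q S \<rho> N :: real \<times> (real^'n) \<Rightarrow> real)"
    have "ereal (S - 1) \<le> ereal T0" using S by simp
    then have "ereal (S - 1) < T" using T0(2) by (rule le_less_trans)
    then have "test_function {(t, x). ereal t < T} \<psi>"
      unfolding \<psi>_def using S \<rho> q by (intro test_function_cone_test) auto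
    then have weak: "(LINT t:time_interval T|lebesgue. LINT x|lebesgue. u t x * wave_op l \<mu> \<psi> t x)
        = (LINT t:time_interval T|lebesgue. LINT x|lebesgue. \<bar>u t x\<bar> powr p * \<psi> (t, x))
          + \<epsilon> * (LINT x|lebesgue. g x * \<psi> (0, x) - f x * time_deriv \<psi> (0, x))"
      using ws unfolding weak_solution_def by blast
    define F where "F z = (\<Sum>k\<le>N. c k * cone_var m (1 + fst z) (snd z) ^ k)" for z :: "real \<times> (real^'n)"
    have Fm: "F \<in> borel_measurable (borel \<Otimes>\<^sub>M borel)"
      unfolding F_def[abs_def] cone_var_def by measurable
    define w where "w z = (1 + fst z) powr (- \<beta>) * profile q ((1 + fst z) / S)" for z :: "real \<times> (real^'n)"
    have w_meas: "w \<in> borel_measurable (borel \<Otimes>\<^sub>M borel)"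
      unfolding w_def[abs_def] by measurable
    have wF: "0 \<le> w z" "w z \<le> 1" "1 \<le> F z" "F z \<le> (\<Sum>k\<le>N. c k)" if "W z \<noteq> 0" for z
    proof -
      obtain t x where z: "z = (t, x)" by (cases z)
      have tx: "0 \<le> t" "t \<le> T0" "norm x \<le> (1 + t) powr m / m - \<delta>" using W(3)[of t x] that z by auto
      have "(1 + t) powr (- \<beta>) \<le> (1 + t) powr 0" using tx \<beta> by (intro powr_mono) auto
      then have "w z \<le> 1 * 1"
        unfolding w_def z using tx profile_le_1 profile_nonneg by (intro mult_mono) auto
      then show "w z \<le> 1" by simp
      show "0 \<le> w z" unfolding w_def using profile_nonneg by (intro mult_nonneg_nonneg) auto
      have "c 0 * cone_var m (1 + t) x ^ 0 \<le> F z"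
        unfolding F_def z fst_conv snd_conv using cone[OF tx] cpos by (intro member_le_sum) (auto simp: less_imp_le)
      then show "1 \<le> F z" by (simp add: c_def)
      have "F z \<le> (\<Sum>k\<le>N. c k * 1)"
        unfolding F_def z fst_conv snd_conv using cone[OF tx] cpos
        by (intro sum_mono mult_left_mono power_le_one) (auto simp: less_imp_le)
      then show "F z \<le> (\<Sum>k\<le>N. c k)" by simp
    qed
    have int_Ww: "integrable lborel (\<lambda>z. W z * w z)"
      using w_meas wF by (intro integrable_mult_bounded[OF W(1), of _ 1]) (auto simp: borel_prod)
    have int_WwF: "integrable lborel (\<lambda>z. W z * (w z * F z))"
    proof (rule integrable_mult_bounded[OF W(1)])
      have "(\<lambda>z. w z * F z) \<in> borel_measurable (borel \<Otimes>\<^sub>M borel)" using w_meas Fm by measurable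
      then show "(\<lambda>z. w z * F z) \<in> borel_measurable lborel" by (simp add: borel_prod)
      fix z assume "W z \<noteq> 0"
      note wF[OF this]
      then have "w z * F z \<le> 1 * (\<Sum>k\<le>N. c k)" "0 \<le> w z * F z" by (intro mult_mono mult_nonneg_nonneg; auto)+
      then show "\<bar>w z * F z\<bar> \<le> (\<Sum>k\<le>N. c k)" by simp
    qed
    \<comment> \<open>On the side of the nonlinearity only the constant term of the series is kept:
      the coefficients are positive, so F \<ge> 1.\<close>
    have "(LINT z|lborel. W z * w z) \<le> (LINT z|lborel. W z * (w z * F z))"
    proof (rule integral_mono[OF int_Ww int_WwF])
      fix z
      show "W z * w z \<le> W z * (w z * F z)"
      proof (cases "W z = 0")
        case False
        from mult_left_mono[OF wF(3)[OF False] wF(1)[OF False]]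
        show ?thesis using W(2)[of z] by (intro mult_left_mono) auto
      qed simp
    qed
    also have "\<dots> = (LINT t:time_interval T|lebesgue. LINT x|lebesgue. \<bar>u t x\<bar> powr p * \<psi> (t, x))"
      unfolding time_interval_integral_eq
    proof (rule iterated_lebesgue_integral_eq[OF int_WwF, symmetric])
      show "AE t in lebesgue. AE x in lebesgue.
          indicator (time_interval T) t * (\<bar>u t x\<bar> powr p * \<psi> (t, x)) = W (t, x) * (w (t, x) * F (t, x))"
        using W(4)
      proof (eventually_elim)
        case (elim t)
        then show ?case
        proof eventually_elim
          case (elim x)
          show ?case
          proof (cases "0 \<le> t \<and> t \<le> T0")
            case True
            then have t: "t \<in> time_interval T" using in_time by simp
            show ?thesis
            proof (cases "norm x \<le> (1 + t) powr m / m - \<delta>")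
              case nx: True
              have "\<psi> (t, x) = w (t, x) * F (t, x)"
              proof -
                have "norm x \<le> \<rho>" using cone(5)[of t x] True nx by simp
                then show ?thesis
                  unfolding \<psi>_def w_def F_def c_def fst_conv snd_conv
                  using True \<rho>(1) by (subst cone_test_eq) (simp_all only: mult.commute)
              qed
              moreover have "W (t, x) = \<bar>u t x\<bar> powr p" using elim True by blast
              ultimately show ?thesis using t by simp
            next
              case False
              then have "u t x = 0" using elim True by blast
              moreover have "W (t, x) = 0" using W(3) False by blast
              ultimately show ?thesis by simp
            qed
          next
            \<comment> \<open>Negative times are removed by the indicator; times of existence after
              \<open>T0\<close> satisfy 1 + t \<ge> S, where the cutoff in time is 0.\<close>
            case False
            then have W0: "W (t, x) = 0" using W(3)[of t x] by (cases "W (t, x) = 0") simp_all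
            show ?thesis
            proof (cases "t \<in> time_interval T")
              case True
              have "0 \<le> t" "S \<le> 1 + t" using False time_nonneg[OF True] S by linarith+
              then have "\<psi> (t, x) = 0" unfolding \<psi>_def using S q by (intro cone_test_eq_0) linarith+
              then show ?thesis by (simp only: W0 mult_zero_left mult_zero_right)
            qed (simp add: W0)
          qed
        qed
      qed
    qed
    finally have lower: "(LINT z|lborel. W z * w z)
        \<le> (LINT t:time_interval T|lebesgue. LINT x|lebesgue. \<bar>u t x\<bar> powr p * \<psi> (t, x))" .
    define D where "D = M * K * (1 + 2 * \<beta> + 4 * m)"
    have b0: "0 \<le> b N" using K(1) \<beta> m \<zeta> unfolding b_def
      by (intro mult_nonneg_nonneg add_nonneg_nonneg) auto
    have D0: "0 \<le> D" using M(1) K(1) \<beta> m by (simp add: D_def)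
    have int_B: "integrable lborel (\<lambda>z. D * (V z * G z) + b N * V z)" using V VG by simp
    have "(LINT t:time_interval T|lebesgue. LINT x|lebesgue. u t x * wave_op l \<mu> \<psi> t x)
        \<le> \<bar>LINT t:time_interval T|lebesgue. LINT x|lebesgue. u t x * wave_op l \<mu> \<psi> t x\<bar>" by simp
    also have "\<dots> \<le> (LINT z|lborel. D * (V z * G z) + b N * V z)"
      unfolding time_interval_integral_eq
    proof (rule iterated_lebesgue_integral_le[OF int_B])
      show "AE t in lebesgue. AE x in lebesgue.
          \<bar>indicator (time_interval T) t * (u t x * wave_op l \<mu> \<psi> t x)\<bar>
            \<le> D * (V (t, x) * G (t, x)) + b N * V (t, x)"
        using W(4)
      proof (eventually_elim)
        case (elim t)
        then show ?case
        proof eventually_elim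
          case (elim x)
          have G0: "0 \<le> G (t, x)" by (simp add: G_def)
          have rhs: "0 \<le> D * (V (t, x) * G (t, x)) + b N * V (t, x)"
            using D0 b0 V0 G0 by (intro add_nonneg_nonneg mult_nonneg_nonneg) auto
          show ?case
          proof (cases "0 \<le> t \<and> t \<le> T0 \<and> norm x \<le> (1 + t) powr m / m - \<delta>")
            case True
            then have tx: "0 \<le> t" "t \<le> T0" "norm x \<le> (1 + t) powr m / m - \<delta>" by auto
            have "V (t, x) = \<bar>u t x\<bar>"
              using elim True p by (simp add: V_def powr_powr)
            have "\<bar>wave_op l \<mu> \<psi> t x\<bar> \<le> D * G (t, x)
               + K * ((\<beta> + 2 * m * real N) * (\<beta> + 2 * m * real N + 1) + \<mu>\<^sup>2) * cone_var m (1 + t) x ^ N"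
              using wave_op_cone_test_le[OF tx(1) cone(5)[OF tx] m \<beta> R(2) tx(3) _ q M K, of S N] S
              by (simp add: \<psi>_def D_def G_def)
            also have "\<dots> \<le> D * G (t, x) + b N"
              unfolding b_def using K(1) \<beta> m cone[OF tx]
              by (intro add_left_mono mult_left_mono power_mono mult_nonneg_nonneg add_nonneg_nonneg) auto
            finally have "\<bar>u t x\<bar> * \<bar>wave_op l \<mu> \<psi> t x\<bar> \<le> V (t, x) * (D * G (t, x) + b N)"
              unfolding \<open>V (t, x) = \<bar>u t x\<bar>\<close> by (intro mult_left_mono) auto
            moreover have "t \<in> time_interval T" using in_time tx by simp
            ultimately show ?thesis by (simp add: abs_mult algebra_simps)
          next
            case False
            have "indicator (time_interval T) t * (u t x * wave_op l \<mu> \<psi> t x) = 0"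
            proof (cases "0 \<le> t \<and> t \<le> T0")
              case True
              then show ?thesis using False elim by simp
            next
              case ft: False
              show ?thesis
              proof (cases "t \<in> time_interval T")
                case True
                have "0 \<le> t" "S < 1 + t" using ft time_nonneg[OF True] S by linarith+
                then have "wave_op l \<mu> \<psi> t x = 0"
                  unfolding \<psi>_def using S q by (intro wave_op_cone_test_eq_0) linarith+
                then show ?thesis by (simp only: mult_zero_right)
              qed simp
            qed
            then show ?thesis using rhs by (simp only: abs_zero)
          qed
        qed
      qed
    qed
    also have "\<dots> = D * (LINT z|lborel. V z * G z) + b N * (LINT z|lborel. V z)"
      using V VG by simp
    finally have upper: "(LINT t:time_interval T|lebesgue. LINT x|lebesgue. u t x * wave_op l \<mu> \<psi> t x)
        \<le> D * (LINT z|lborel. V z * G z) + b N * (LINT z|lborel. V z)" .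
    have supp: "ess_supp f \<union> ess_supp g \<subseteq> cball 0 R" using ws by (simp add: weak_solution_def)
    have "(LINT x|lebesgue. g x) + \<beta> * (LINT x|lebesgue. f x)
        \<le> (LINT x|lebesgue. g x * \<psi> (0, x) - f x * time_deriv \<psi> (0, x))"
      unfolding \<psi>_def
      by (rule cone_test_data_ge[OF fg supp]) (use R \<rho> S m \<beta> in auto)
    then have "\<epsilon> * ((LINT x|lebesgue. g x) + \<beta> * (LINT x|lebesgue. f x))
        \<le> \<epsilon> * (LINT x|lebesgue. g x * \<psi> (0, x) - f x * time_deriv \<psi> (0, x))"
      using \<epsilon> by (intro mult_left_mono) auto
    with lower upper weak show ?thesis unfolding w_def D_def by linarith
  qed
  have "(LINT z|lborel. W z * ((1 + fst z) powr (- \<beta>) * profile q ((1 + fst z) / S)))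
      + \<epsilon> * ((LINT x|lebesgue. g x) + \<beta> * (LINT x|lebesgue. f x))
    \<le> M * K * (1 + 2 * \<beta> + 4 * m) * (LINT z|lborel. V z * G z) + 0 * (LINT z|lborel. V z)"
    by (rule LIMSEQ_le_const[OF tendsto_add[OF tendsto_const tendsto_mult_right[OF b]]])
       (use bound in auto)
  then show ?thesis by (simp add: V_def)
qed

subsection \<open>Critical exponents\<close>

text \<open>The second claim is the vanishing of the exponent of S: \<kappa> cancels, and after
  multiplication by 2 p (p - 1) the left side is the polynomial whose root is p. The first claim
  makes the coefficients for \<kappa> = 1 - 1 / p positive.\<close>

lemma critical_exponents:
  fixes l p n :: real
  assumes l: "-1 < l" "l \<le> 0" and n: "(1 + l) * n > 1" "2 \<le> n" and p: "1 < p"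
    and root: "((1 + l) * n - 1) * p\<^sup>2 - ((1 + l) * n + 1 - 2 * l) * p - 2 * (1 + l) = 0"
  defines "m \<equiv> 1 + l" and "\<beta> \<equiv> \<lambda>\<kappa>. (1 + l) * (\<kappa> - 1) + ((1 + l) * n - 1) / 2"
  shows "0 < \<beta> (1 - 1 / p)"
    and "(- \<beta> \<kappa> - 2 + \<beta> (1 - 1 / p) / p) * (p / (p - 1)) + 1 + m * (n - 1 + \<kappa> * (p / (p - 1))) = 0"
proof -
  have m: "0 < m" "m \<le> 1" using l by (auto simp: m_def)
  have root': "(m * n - 1) * p\<^sup>2 = (m * n + 3 - 2 * m) * p + 2 * m"
    using root by (simp add: m_def algebra_simps)
  \<comment> \<open>From n \<ge> 2 and m \<le> 1 follows m n + 3 - 2 m \<ge> 3 > 2 m; inserted into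
    the equation for p, this gives (m n - 1) p > 2 m.\<close>
  have "m * 2 \<le> m * n" using m n by (intro mult_left_mono) auto
  then have "2 * m < m * n + 3 - 2 * m" using m by linarith
  then have "2 * m * p < (m * n + 3 - 2 * m) * p" using p by (intro mult_strict_right_mono) auto
  then have "(2 * m) * p < ((m * n - 1) * p) * p" using m root' by (simp add: power2_eq_square mult.assoc)
  then have big: "2 * m < (m * n - 1) * p" using p by (auto intro: mult_right_less_imp_less)
  have "\<beta> (1 - 1 / p) = ((m * n - 1) * p - 2 * m) / (2 * p)"
    using p by (simp add: \<beta>_def m_def[symmetric] field_simps)
  then show "0 < \<beta> (1 - 1 / p)" using big p by simp
  define b where "b = \<beta> (1 - 1 / p)"
  have b: "2 * p * b = (m * n - 1) * p - 2 * m"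
    using p by (simp add: b_def \<beta>_def m_def[symmetric] field_simps)
  have bk: "\<beta> \<kappa> = m * (\<kappa> - 1) + (m * n - 1) / 2" by (simp add: \<beta>_def m_def)
  have "2 * p * ((p - 1) * ((- \<beta> \<kappa> - 2 + b / p) * (p / (p - 1)) + 1 + m * (n - 1 + \<kappa> * (p / (p - 1)))))
      = 2 * p * ((- \<beta> \<kappa> - 2) * p + b + (p - 1) * (1 + m * (n - 1)) + m * \<kappa> * p)"
  proof -
    define r where "r = p / (p - 1)"
    have r: "(p - 1) * r = p" "b / p * p = b" using p by (simp_all add: r_def)
    have "(p - 1) * ((- \<beta> \<kappa> - 2 + b / p) * r + 1 + m * (n - 1 + \<kappa> * r))
        = (- \<beta> \<kappa> - 2 + b / p) * ((p - 1) * r) + (p - 1) * (1 + m * (n - 1)) + m * \<kappa> * ((p - 1) * r)"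
      by (simp only: ring_distribs mult_ac add_ac)
    then show ?thesis unfolding r r_def[symmetric] by (simp only: distrib_right r)
  qed
  also have "\<dots> = 2 * p * b + 2 * p * ((- \<beta> \<kappa> - 2) * p + (p - 1) * (1 + m * (n - 1)) + m * \<kappa> * p)"
    by (simp add: algebra_simps)
  also have "\<dots> = (m * n - 1) * p\<^sup>2 - ((m * n + 3 - 2 * m) * p + 2 * m)"
    unfolding b bk by (simp add: field_simps power2_eq_square)
  also have "\<dots> = 0" using root' by simp
  finally show "(- \<beta> \<kappa> - 2 + \<beta> (1 - 1 / p) / p) * (p / (p - 1)) + 1 + m * (n - 1 + \<kappa> * (p / (p - 1))) = 0"
    using p by (simp add: b_def)
qed

lemma sum_powr_le_suminf:
  assumes "1 < r"
  shows "(\<Sum>k=1..K. real k powr (- r)) \<le> (\<Sum>k. real k powr (- r))"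
  using assms by (intro sum_le_suminf) (auto simp: summable_real_powr_iff)

lemma harmonic_sum_le:
  assumes "1 \<le> K"
  shows "(\<Sum>k=1..K. real k powr (- 1)) \<le> 1 + ln (real K)"
proof -
  obtain j where j: "K = Suc j" using assms by (cases K) auto
  have "harm (Suc j) - ln (real (Suc j)) \<le> harm (Suc 0) - ln (real (Suc 0))"
    using decseqD[OF decseq_harm_diff_ln, of 0 j] by simp
  then have "harm K \<le> 1 + ln (real K)" by (simp add: j harm_expand)
  moreover have "harm K = (\<Sum>k=1..K. real k powr (- 1))"
    unfolding harm_def by (intro sum.cong) (auto simp: powr_minus)
  ultimately show ?thesis by simp
qed

text \<open>Hoelder's inequality on the shell, followed by the cone integral with exponent \<kappa>
  p'; the power of S equals 1 because p is critical. The constant is quantified before \<epsilon>,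
  the solution and S, as the uniform lifespan estimate requires.\<close>

lemma weak_solution_shell_inequality:
  fixes f g :: "real^'n \<Rightarrow> real" and l \<mu> R p \<kappa> :: real
  assumes l: "-1 < l" "l \<le> 0" "(1 + l) * real CARD('n) > 1"
    and p: "1 < p" "strauss_poly CARD('n) l p = 0"
    and m: "m = 1 + l" and R: "0 < R" "0 < \<delta>" "\<delta> = 1 / m - R"
    and fg: "integrable lebesgue f" "integrable lebesgue g"
    "AE x in lebesgue. 0 \<le> f x" "AE x in lebesgue. 0 \<le> g x"
    and q: "2 * (p / (p - 1)) \<le> real q"
    and \<kappa>: "0 < \<kappa>" "\<kappa> \<le> 1" and \<beta>: "\<beta> = m * (\<kappa> - 1) + (m * real CARD('n) - 1) / 2" "0 < \<beta>"
    and \<beta>': "\<beta>' = - m / p + (m * real CARD('n) - 1) / 2"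
  shows "\<exists>C>0. \<forall>\<epsilon> T (u :: real \<Rightarrow> real^'n \<Rightarrow> real) T0 S W.
      0 < \<epsilon> \<longrightarrow> weak_solution l \<mu> p R \<epsilon> f g T u \<longrightarrow> 0 \<le> T0 \<longrightarrow> ereal T0 < T \<longrightarrow> 2 < S \<longrightarrow> S \<le> 1 + T0 \<longrightarrow>
      integrable lborel W \<longrightarrow> (\<forall>z. 0 \<le> W z) \<longrightarrow>
      (\<forall>t x. W (t, x) \<noteq> 0 \<longrightarrow> 0 \<le> t \<and> t \<le> T0 \<and> norm x \<le> (1 + t) powr m / m - \<delta>) \<longrightarrow>
      (AE t in lebesgue. AE x in lebesgue. 0 \<le> t \<and> t \<le> T0 \<longrightarrow>
         W (t, x) = \<bar>u t x\<bar> powr p \<and> (\<not> norm x \<le> (1 + t) powr m / m - \<delta> \<longrightarrow> u t x = 0)) \<longrightarrow>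
      (LINT z|lborel. W z * ((1 + fst z) powr (- \<beta>) * profile q ((1 + fst z) / S)))
        + \<epsilon> * ((LINT x|lebesgue. g x) + \<beta> * (LINT x|lebesgue. f x))
      \<le> C * (LINT z|lborel. W z * (indicator (cone_shell m \<delta> S) z
              * ((1 + fst z) powr (- \<beta>') * profile q ((1 + fst z) / S)))) powr (1 / p)
          * (\<Sum>k=1..nat \<lceil>S powr m / (m * \<delta>)\<rceil>. real k powr (- (\<kappa> * (p / (p - 1))))) powr (1 - 1 / p)"
proof -
  define p' where "p' = p / (p - 1)"
  define n where "n = real CARD('n)"
  have p': "1 < p'" "1 / p + 1 / p' = 1" "1 / p' = 1 - 1 / p" using p by (auto simp: p'_def field_simps)
  have m0: "0 < m" using l m by simp
  have q0: "0 < q" using q p'(1) by (cases q) (auto simp: p'_def[symmetric])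
  have n2: "2 \<le> n"
  proof -
    have "m * n \<le> 1 * n" using m l by (intro mult_right_mono) (auto simp: n_def)
    moreover have "1 < m * n" using l(3) by (simp add: m n_def)
    ultimately have "1 < n" by linarith
    then have "1 < CARD('n)" by (simp add: n_def)
    then show ?thesis by (simp add: n_def)
  qed
  have root: "((1 + l) * n - 1) * p\<^sup>2 - ((1 + l) * n + 1 - 2 * l) * p - 2 * (1 + l) = 0"
    using p(2) by (simp add: strauss_poly_def n_def)
  have \<beta>'eq: "\<beta>' = (1 + l) * (1 - 1 / p - 1) + ((1 + l) * n - 1) / 2"
    using p(1) by (simp add: \<beta>' m n_def field_simps)
  have \<beta>eq: "\<beta> = (1 + l) * (\<kappa> - 1) + ((1 + l) * n - 1) / 2" by (simp add: \<beta>(1) m n_def)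
  note crit = critical_exponents[OF l(1,2) l(3)[folded n_def] n2 p(1) root]
  have \<beta>'0: "0 < \<beta>'" using crit(1) by (simp add: \<beta>'eq)
  define a where "a = (- \<beta> - 2 + \<beta>' / p) * p'"
  have expo: "a + 1 + m * (n - 1 + \<kappa> * p') = 0"
    using crit(2)[of \<kappa>] by (simp add: a_def \<beta>eq \<beta>'eq p'_def m)
  obtain M where M: "0 < M" "\<And>y. \<bar>partial 1 (profile q) y\<bar> \<le> M * profile q y powr (1 / p)"
    "\<And>y. \<bar>partial 1 (partial 1 (profile q)) y\<bar> \<le> M * profile q y powr (1 / p)"
    using profile_deriv_bounds[OF p(1) q] by blast
  obtain K where K: "0 < K" "\<And>k. hyp_coeff m CARD('n) \<mu> \<beta> k \<le> K"
    "\<And>N z. 0 \<le> z \<Longrightarrow> z < 1 \<Longrightarrow>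
       (\<Sum>k\<le>N. hyp_coeff m CARD('n) \<mu> \<beta> k * z ^ k) \<le> K * (1 - z) powr (- \<kappa>)"
    "\<And>N z. 0 \<le> z \<Longrightarrow> z < 1 \<Longrightarrow>
       (\<Sum>k\<le>N. real k * hyp_coeff m CARD('n) \<mu> \<beta> k * z ^ k) \<le> K * (1 - z) powr (- \<kappa>)"
    using hyp_coeff_bounds[OF m0 \<beta>(2) _ \<kappa> \<beta>(1), of \<mu>] by auto
  have kp: "0 \<le> \<kappa> * p'" using \<kappa> p' by simp
  obtain C0 where C0: "0 < C0"
    "\<And>S. 0 < S \<Longrightarrow> integrable lborel (\<lambda>z::real \<times> (real^'n). indicator (cone_shell m \<delta> S) z
        * ((1 + fst z) powr a * (1 - cone_var m (1 + fst z) (snd z)) powr (- (\<kappa> * p'))))"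
    "\<And>S. 0 < S \<Longrightarrow> (LINT z::real \<times> (real^'n)|lborel. indicator (cone_shell m \<delta> S) z
        * ((1 + fst z) powr a * (1 - cone_var m (1 + fst z) (snd z)) powr (- (\<kappa> * p'))))
       \<le> C0 * S powr (a + 1 + m * (real CARD('n) - 1 + \<kappa> * p'))
          * (\<Sum>k=1..nat \<lceil>S powr m / (m * \<delta>)\<rceil>. real k powr (- (\<kappa> * p')))"
    using cone_shell_integral[where 'n = 'n, OF m0 R(2) kp, of a] by blast
  define A where "A = M * K * (1 + 2 * \<beta> + 4 * m)"
  have "0 < 1 + 2 * \<beta> + 4 * m" using \<beta>(2) m0 by linarith
  then have A: "0 < A" unfolding A_def by (intro mult_pos_pos M(1) K(1))
  have main: "(LINT z|lborel. W z * ((1 + fst z) powr (- \<beta>) * profile q ((1 + fst z) / S)))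
        + \<epsilon> * ((LINT x|lebesgue. g x) + \<beta> * (LINT x|lebesgue. f x))
      \<le> (A * C0 powr (1 - 1 / p)) * (LINT z|lborel. W z * (indicator (cone_shell m \<delta> S) z
              * ((1 + fst z) powr (- \<beta>') * profile q ((1 + fst z) / S)))) powr (1 / p)
          * (\<Sum>k=1..nat \<lceil>S powr m / (m * \<delta>)\<rceil>. real k powr (- (\<kappa> * (p / (p - 1))))) powr (1 - 1 / p)"
    if \<epsilon>: "0 < \<epsilon>" and ws: "weak_solution l \<mu> p R \<epsilon> f g T u" and T0: "0 \<le> T0" "ereal T0 < T"
      and S: "2 < S" "S \<le> 1 + T0"
      and W: "integrable lborel W" "\<And>z. 0 \<le> W z"
      "\<And>t x. W (t, x) \<noteq> 0 \<Longrightarrow> 0 \<le> t \<and> t \<le> T0 \<and> norm x \<le> (1 + t) powr m / m - \<delta>"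
      "AE t in lebesgue. AE x in lebesgue. 0 \<le> t \<and> t \<le> T0 \<longrightarrow>
         W (t, x) = \<bar>u t x\<bar> powr p \<and> (\<not> norm x \<le> (1 + t) powr m / m - \<delta> \<longrightarrow> u t x = 0)"
    for \<epsilon> T T0 S and u :: "real \<Rightarrow> real^'n \<Rightarrow> real" and W :: "real \<times> (real^'n) \<Rightarrow> real"
  proof -
    define sh where "sh z = (indicator (cone_shell m \<delta> S) z :: real)" for z :: "real \<times> (real^'n)"
    define h where "h z = profile q ((1 + fst z) / S)" for z :: "real \<times> (real^'n)"
    define v where "v z = 1 - cone_var m (1 + fst z) (snd z)" for z :: "real \<times> (real^'n)"
    have [measurable]: "profile q \<in> borel_measurable borel"
      by (intro borel_measurable_continuous_onI smooth_continuous smooth_profile)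
    have [measurable]: "cone_shell m \<delta> S \<in> sets (borel \<Otimes>\<^sub>M (borel :: (real^'n) measure))"
      unfolding borel_prod by (rule cone_shell_borel)
    have h: "0 \<le> h z" "h z \<le> 1" for z by (auto simp: h_def profile_nonneg profile_le_1)
    have Ws: "1 \<le> 1 + fst z" if "W z \<noteq> 0" for z
      using W(3)[of "fst z" "snd z"] that by simp
    \<comment> \<open>The weight is split so that s^(-\<beta>') and the cutoff join the mass under
      the power 1 / p; the compensating factor s^(\<beta>' / p) goes into \<open>G\<close>.\<close>
    define W1 where "W1 z = W z * (sh z * ((1 + fst z) powr (- \<beta>') * h z))" for z
    define G where "G z = sh z * ((1 + fst z) powr (- \<beta> - 2 + \<beta>' / p) * v z powr (- \<kappa>))" for z
    have W1: "integrable lborel W1"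
      unfolding W1_def[abs_def]
    proof (rule integrable_mult_bounded[OF W(1)])
      have "(\<lambda>z. sh z * ((1 + fst z) powr (- \<beta>') * h z)) \<in> borel_measurable (borel \<Otimes>\<^sub>M borel)"
        unfolding sh_def h_def by measurable
      then show "(\<lambda>z. sh z * ((1 + fst z) powr (- \<beta>') * h z)) \<in> borel_measurable lborel"
        by (simp add: borel_prod)
      fix z assume "W z \<noteq> 0"
      from Ws[OF this] have "(1 + fst z) powr (- \<beta>') \<le> (1 + fst z) powr 0"
        using \<beta>'0 by (intro powr_mono) auto
      then have "(1 + fst z) powr (- \<beta>') \<le> 1" using Ws[OF \<open>W z \<noteq> 0\<close>] by simp
      then have "sh z * ((1 + fst z) powr (- \<beta>') * h z) \<le> 1 * (1 * 1)"
        using h[of z] by (intro mult_mono) (auto simp: sh_def indicator_def)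
      then show "\<bar>sh z * ((1 + fst z) powr (- \<beta>') * h z)\<bar> \<le> 1"
        using h[of z] by (simp add: sh_def)
    qed
    have W10: "0 \<le> W1 z" for z using W(2) h by (simp add: W1_def sh_def)
    have Gm: "G \<in> borel_measurable lborel"
    proof -
      have "G \<in> borel_measurable (borel \<Otimes>\<^sub>M borel)"
        unfolding G_def[abs_def] sh_def v_def cone_var_def by measurable
      then show ?thesis by (simp add: borel_prod)
    qed
    have Gp: "G z powr p' = sh z * ((1 + fst z) powr a * v z powr (- (\<kappa> * p')))" for z
      using p' by (simp add: G_def sh_def indicator_def powr_mult powr_powr a_def)
    have S0: "0 < S" using S by simp
    have intG: "integrable lborel (\<lambda>z. G z powr p')"
      unfolding Gp sh_def v_def by (rule C0(2)[OF S0])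
    have "S powr (a + 1 + m * (real CARD('n) - 1 + \<kappa> * p')) = 1"
      using expo S0 by (simp add: n_def)
    then have GC: "(LINT z|lborel. G z powr p') \<le> C0 * (\<Sum>k=1..nat \<lceil>S powr m / (m * \<delta>)\<rceil>. real k powr (- (\<kappa> * p')))"
      using C0(3)[OF S0] unfolding Gp sh_def v_def by simp
    have G0: "0 \<le> G z" for z by (simp add: G_def sh_def)
    have eq: "W z powr (1 / p) * (sh z * ((1 + fst z) powr (- \<beta> - 2) * v z powr (- \<kappa>) * h z powr (1 / p)))
        = W1 z powr (1 / p) * G z" for z
    proof (cases "W z = 0 \<or> z \<notin> cone_shell m \<delta> S")
      case True
      then show ?thesis by (auto simp: W1_def sh_def)
    next
      case False
      then have s: "0 < 1 + fst z" "sh z = 1" using Ws[of z] by (auto simp: sh_def)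
      have "(1 + fst z) powr (- \<beta> - 2) = (1 + fst z) powr (- \<beta>' / p) * (1 + fst z) powr (- \<beta> - 2 + \<beta>' / p)"
        using s by (simp add: powr_add[symmetric])
      moreover have "((1 + fst z) powr (- \<beta>')) powr (1 / p) = (1 + fst z) powr (- \<beta>' / p)"
        by (simp add: powr_powr)
      ultimately show ?thesis
        using W(2)[of z] h[of z] s by (simp add: W1_def G_def powr_mult mult_ac)
    qed
    have "(LINT z|lborel. W z * ((1 + fst z) powr (- \<beta>) * profile q ((1 + fst z) / S)))
        + \<epsilon> * ((LINT x|lebesgue. g x) + \<beta> * (LINT x|lebesgue. f x))
      \<le> A * (LINT z|lborel. W z powr (1 / p) * (sh z
          * ((1 + fst z) powr (- \<beta> - 2) * v z powr (- \<kappa>) * h z powr (1 / p))))"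
      unfolding A_def sh_def v_def h_def
      by (rule weak_solution_cone_inequality[OF ws p(1) m m0 R T0 S \<epsilon> fg W \<beta>(2) q0 less_imp_le[OF \<kappa>(1)] M K])
    also have "\<dots> = A * (LINT z|lborel. W1 z powr (1 / p) * G z)" by (simp only: eq)
    also have "\<dots> \<le> A * ((LINT z|lborel. W1 z) powr (1 / p) * (LINT z|lborel. G z powr p') powr (1 / p'))"
      using A by (intro mult_left_mono Hoelder_integral(2)[OF p(1) p'(1,2) W1 W10 Gm intG G0]) auto
    also have "\<dots> \<le> A * ((LINT z|lborel. W1 z) powr (1 / p)
        * (C0 * (\<Sum>k=1..nat \<lceil>S powr m / (m * \<delta>)\<rceil>. real k powr (- (\<kappa> * p')))) powr (1 / p'))"
      using A GC p' p(1) G0 by (intro mult_left_mono powr_mono2) (auto intro!: integral_nonneg)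
    also have "\<dots> = (A * C0 powr (1 - 1 / p)) * (LINT z|lborel. W1 z) powr (1 / p)
        * (\<Sum>k=1..nat \<lceil>S powr m / (m * \<delta>)\<rceil>. real k powr (- (\<kappa> * p'))) powr (1 - 1 / p)"
      using C0(1) by (simp add: p'(3) powr_mult sum_nonneg mult_ac)
    finally show ?thesis unfolding W1_def[abs_def] sh_def h_def p'_def .
  qed
  show ?thesis
  proof (intro exI[of _ "A * C0 powr (1 - 1 / p)"] conjI allI impI)
    show "0 < A * C0 powr (1 - 1 / p)" using A C0(1) by simp
  qed (rule main, assumption+, blast, blast, assumption)
qed

section \<open>Iteration over dyadic shells and the lifespan\<close>

lemma weak_solution_dyadic_bound:
  fixes f g :: "real^'n \<Rightarrow> real" and l \<mu> R p :: real
  assumes l: "-1 < l" "l \<le> 0" "(1 + l) * real CARD('n) > 1"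
    and p: "1 < p" "strauss_poly CARD('n) l p = 0"
    and R: "0 < R" "R < 1 / (1 + l)"
    and fg: "integrable lebesgue f" "integrable lebesgue g"
    "AE x in lebesgue. 0 \<le> f x" "AE x in lebesgue. 0 \<le> g x"
    and nz: "\<not> ((AE x in lebesgue. f x = 0) \<and> (AE x in lebesgue. g x = 0))"
  shows "\<exists>C>0. \<forall>\<epsilon> T (u :: real \<Rightarrow> real^'n \<Rightarrow> real) J. 0 < \<epsilon> \<longrightarrow> weak_solution l \<mu> p R \<epsilon> f g T u
    \<longrightarrow> ereal (2 ^ J - 1) < T \<longrightarrow> real J \<le> C * (1 + \<epsilon> powr (- (p * (p - 1))))"
proof -
  define m where "m = 1 + l"
  define \<delta> where "\<delta> = 1 / m - R"
  define n where "n = real CARD('n)"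
  define p' where "p' = p / (p - 1)"
  have m: "0 < m" "m \<le> 1" "1 < m * n" using l by (auto simp: m_def n_def)
  have \<delta>: "0 < \<delta>" using R by (simp add: \<delta>_def m_def)
  have p': "1 < p'" "1 / p' = 1 - 1 / p" "(1 - 1 / p) * p' = 1"
    using p(1) by (auto simp: p'_def field_simps)
  obtain q :: nat where q: "2 * (p / (p - 1)) \<le> real q" using real_arch_simple by blast
  define \<beta>1 where "\<beta>1 = m * (1 - 1) + (m * n - 1) / 2"
  define \<beta>' where "\<beta>' = - m / p + (m * n - 1) / 2"
  have n2: "2 \<le> n"
  proof -
    have "m * n \<le> 1 * n" using m by (intro mult_right_mono) (auto simp: n_def)
    then have "1 < n" using m by linarith
    then have "1 < CARD('n)" by (simp add: n_def)
    then show ?thesis by (simp add: n_def)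
  qed
  have \<beta>1: "0 < \<beta>1" using m by (simp add: \<beta>1_def)
  have \<beta>'eq: "\<beta>' = m * (1 - 1 / p - 1) + (m * n - 1) / 2"
    using p(1) by (simp add: \<beta>'_def field_simps)
  have \<beta>'0: "0 < \<beta>'"
    using critical_exponents(1)[of l n p] l p n2 by (simp add: \<beta>'eq m_def n_def strauss_poly_def)
  define I where "I \<beta> = (LINT x|lebesgue. g x) + \<beta> * (LINT x|lebesgue. f x)" for \<beta>
  have int0: "0 \<le> (LINT x|lebesgue. g x)" "0 \<le> (LINT x|lebesgue. f x)"
    using fg by (auto intro: integral_nonneg_AE)
  have I1: "0 < I \<beta>1"
  proof (rule ccontr)
    assume "\<not> 0 < I \<beta>1"
    moreover have "0 \<le> \<beta>1 * (LINT x|lebesgue. f x)" using int0 \<beta>1 by simp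
    ultimately have "(LINT x|lebesgue. g x) = 0" "\<beta>1 * (LINT x|lebesgue. f x) = 0"
      using int0 unfolding I_def by linarith+
    then have "(LINT x|lebesgue. g x) = 0" "(LINT x|lebesgue. f x) = 0" using \<beta>1 by auto
    then show False
      using nz integral_nonneg_eq_0_iff_AE[OF fg(1,3)] integral_nonneg_eq_0_iff_AE[OF fg(2,4)] by simp
  qed
  have I': "0 \<le> I \<beta>'" using int0 \<beta>'0 by (simp add: I_def)
  have n_def': "real CARD('n) = n" by (simp add: n_def)
  have k01: "0 < 1 - 1 / p" "1 - 1 / p \<le> 1" using p(1) by auto
  note ineq = weak_solution_shell_inequality[OF l p m_def R(1) \<delta> \<delta>_def fg q, unfolded n_def']
  \<comment> \<open>The choices \<kappa> = 1 and \<kappa> = 1 - 1 / p. In the second one \<beta> and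
    \<beta>' coincide, so the mass on the left carries the same weight as the shell mass on the
    right, and the inequality can be iterated.\<close>
  note ineq1 = ineq[OF zero_less_one order_refl \<beta>1_def \<beta>1 \<beta>'_def, of \<mu>]
    and ineq2 = ineq[OF k01 \<beta>'eq \<beta>'0 \<beta>'_def, of \<mu>]
  obtain C1 where C1: "0 < C1" and test1: "\<And>\<epsilon> T (u :: real \<Rightarrow> real^'n \<Rightarrow> real) T0 S W.
      \<lbrakk>0 < \<epsilon>; weak_solution l \<mu> p R \<epsilon> f g T u; 0 \<le> T0; ereal T0 < T; 2 < S; S \<le> 1 + T0;
      integrable lborel W; \<forall>z. 0 \<le> W z;
      \<forall>t x. W (t, x) \<noteq> 0 \<longrightarrow> 0 \<le> t \<and> t \<le> T0 \<and> norm x \<le> (1 + t) powr m / m - \<delta>;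
      AE t in lebesgue. AE x in lebesgue. 0 \<le> t \<and> t \<le> T0 \<longrightarrow>
         W (t, x) = \<bar>u t x\<bar> powr p \<and> (\<not> norm x \<le> (1 + t) powr m / m - \<delta> \<longrightarrow> u t x = 0)\<rbrakk> \<Longrightarrow>
      (LINT z|lborel. W z * ((1 + fst z) powr (- \<beta>1) * profile q ((1 + fst z) / S))) + \<epsilon> * I \<beta>1
      \<le> C1 * (LINT z|lborel. W z * (indicator (cone_shell m \<delta> S) z
              * ((1 + fst z) powr (- \<beta>') * profile q ((1 + fst z) / S)))) powr (1 / p)
          * (\<Sum>k=1..nat \<lceil>S powr m / (m * \<delta>)\<rceil>. real k powr (- p')) powr (1 - 1 / p)"
    using ineq1 unfolding I_def p'_def mult_1_left by blast
  obtain C2 where C2: "0 < C2" and test2: "\<And>\<epsilon> T (u :: real \<Rightarrow> real^'n \<Rightarrow> real) T0 S W.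
      \<lbrakk>0 < \<epsilon>; weak_solution l \<mu> p R \<epsilon> f g T u; 0 \<le> T0; ereal T0 < T; 2 < S; S \<le> 1 + T0;
      integrable lborel W; \<forall>z. 0 \<le> W z;
      \<forall>t x. W (t, x) \<noteq> 0 \<longrightarrow> 0 \<le> t \<and> t \<le> T0 \<and> norm x \<le> (1 + t) powr m / m - \<delta>;
      AE t in lebesgue. AE x in lebesgue. 0 \<le> t \<and> t \<le> T0 \<longrightarrow>
         W (t, x) = \<bar>u t x\<bar> powr p \<and> (\<not> norm x \<le> (1 + t) powr m / m - \<delta> \<longrightarrow> u t x = 0)\<rbrakk> \<Longrightarrow>
      (LINT z|lborel. W z * ((1 + fst z) powr (- \<beta>') * profile q ((1 + fst z) / S))) + \<epsilon> * I \<beta>'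
      \<le> C2 * (LINT z|lborel. W z * (indicator (cone_shell m \<delta> S) z
              * ((1 + fst z) powr (- \<beta>') * profile q ((1 + fst z) / S)))) powr (1 / p)
          * (\<Sum>k=1..nat \<lceil>S powr m / (m * \<delta>)\<rceil>. real k powr (- 1)) powr (1 - 1 / p)"
    using ineq2 unfolding I_def p'(3)[unfolded p'_def] by blast
  define Z where "Z = (\<Sum>k. real k powr (- p'))"
  have Zle: "(\<Sum>k=1..K. real k powr (- p')) \<le> Z" for K
    unfolding Z_def using sum_powr_le_suminf[OF p'(1)] .
  have Z: "1 \<le> Z" using Zle[of 1] by simp
  define B0 where "B0 = 1 + ln 2 + ln (1 / (m * \<delta>) + 1)"
  have md: "0 < 1 / (m * \<delta>)" using m \<delta> by simp
  have B0: "0 < B0" using md by (simp add: B0_def add_pos_nonneg)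
  \<comment> \<open>About 2^(j m) layers lie below the cone, so the harmonic sum is of order j; as m
    \<le> 1, the bound 2^j for the power suffices.\<close>
  have log_sum: "(\<Sum>k=1..nat \<lceil>(2 ^ j) powr m / (m * \<delta>)\<rceil>. real k powr (- 1)) \<le> B0 * real j"
    if "1 \<le> j" for j
  proof -
    define K where "K = nat \<lceil>(2 ^ j) powr m / (m * \<delta>)\<rceil>"
    have pos: "0 < (2 ^ j) powr m / (m * \<delta>)" using m \<delta> by simp
    then have K1: "1 \<le> K" by (simp add: K_def Suc_le_eq)
    have "(2 ^ j) powr m \<le> (2 ^ j) powr (1::real)" using m by (intro powr_mono) auto
    then have le: "(2 ^ j) powr m \<le> (2::real) ^ j" by simp
    have "real K \<le> (2 ^ j) powr m / (m * \<delta>) + 1"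
      unfolding K_def using pos by linarith
    also have "\<dots> \<le> 2 ^ j * (1 / (m * \<delta>)) + 2 ^ j"
      using mult_right_mono[OF le, of "1 / (m * \<delta>)"] md by (intro add_mono) auto
    also have "\<dots> = 2 ^ j * (1 / (m * \<delta>) + 1)" by (simp only: distrib_left mult_1_right)
    finally have "ln (real K) \<le> ln (2 ^ j * (1 / (m * \<delta>) + 1))" using K1 by simp
    also have "\<dots> = ln (2 ^ j) + ln (1 / (m * \<delta>) + 1)"
      using md by (intro ln_mult_pos add_pos_pos) auto
    also have "\<dots> = real j * ln 2 + ln (1 / (m * \<delta>) + 1)"
      by (simp add: ln_realpow)
    finally have "1 + ln (real K) \<le> 1 + real j * ln 2 + ln (1 / (m * \<delta>) + 1)" by simp
    also have "\<dots> \<le> 1 * real j + real j * ln 2 + ln (1 / (m * \<delta>) + 1) * real j"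
    proof -
      have "ln (1 / (m * \<delta>) + 1) * 1 \<le> ln (1 / (m * \<delta>) + 1) * real j"
        using md that by (intro mult_left_mono) auto
      then show ?thesis using that by simp
    qed
    also have "\<dots> = B0 * real j" by (simp add: B0_def algebra_simps)
    finally show ?thesis using harmonic_sum_le[OF K1] unfolding K_def[symmetric] by linarith
  qed
  \<comment> \<open>Obtained by solving \<epsilon> I \<le> C1 Z^(1 - 1/p) D_j^(1/p) for D_j; the
    power p turns \<epsilon> into \<epsilon>^p.\<close>
  define a where "a = (I \<beta>1 / (C1 * Z powr (1 - 1 / p))) powr p"
  define X where "X = I \<beta>1 / (C1 * Z powr (1 - 1 / p))"
  have X: "0 < X" "a = X powr p" using I1 C1 Z by (simp_all add: a_def X_def)
  then have a: "0 < a" by simp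
  \<comment> \<open>One summand for each of the two upper bounds required by the discrete
    blow-up.\<close>
  define B where "B = C2 powr p' * B0 + C2 * B0 powr (1 - 1 / p)"
  have B: "0 < B" "C2 powr p' * B0 \<le> B" "C2 * B0 powr (1 - 1 / p) \<le> B"
    using C2 B0 by (auto simp: B_def add_pos_pos)
  obtain C where C: "0 < C" and blowup: "\<And>D J e. \<lbrakk>0 < e; \<forall>i\<in>{2..J}. a * e \<le> D i;
      \<forall>j\<in>{2..J}. (\<Sum>i=2..<j. D i) \<le> B * real j;
      \<forall>j\<in>{2..J}. (\<Sum>i=2..<j. D i) \<le> B * D j powr (1 / p) * real j powr (1 - 1 / p)\<rbrakk>
     \<Longrightarrow> real J \<le> C * (1 + e powr (1 - p))"
    using discrete_blowup_bound[OF p(1) a B(1)] by blast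
  have "real J \<le> C * (1 + \<epsilon> powr (- (p * (p - 1))))"
    if \<epsilon>: "0 < \<epsilon>" and ws: "weak_solution l \<mu> p R \<epsilon> f g T u" and JT: "ereal (2 ^ J - 1) < T"
    for \<epsilon> T J and u :: "real \<Rightarrow> real^'n \<Rightarrow> real"
  proof -
    define T0 where "T0 = (2::real) ^ J - 1"
    have T0: "0 \<le> T0" "ereal T0 < T" using JT by (auto simp: T0_def)
    obtain W where W: "integrable lborel W" "\<And>z. 0 \<le> W z"
      "\<And>t x. W (t, x) \<noteq> 0 \<Longrightarrow> 0 \<le> t \<and> t \<le> T0 \<and> norm x \<le> (1 + t) powr m / m - \<delta>"
      "AE t in lebesgue. AE x in lebesgue. 0 \<le> t \<and> t \<le> T0 \<longrightarrow>
         W (t, x) = \<bar>u t x\<bar> powr p \<and> (\<not> norm x \<le> (1 + t) powr m / m - \<delta> \<longrightarrow> u t x = 0)"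
      using weak_solution_density[OF ws l(1) m_def \<delta> \<delta>_def T0] by blast
    have W3: "\<forall>t x. W (t, x) \<noteq> 0 \<longrightarrow> 0 \<le> t \<and> t \<le> T0 \<and> norm x \<le> (1 + t) powr m / m - \<delta>"
      and W2: "\<forall>z. 0 \<le> W z" using W by blast+
    have [measurable]: "profile q \<in> borel_measurable borel"
      by (intro borel_measurable_continuous_onI smooth_continuous smooth_profile)
    have [measurable]: "cone_shell m \<delta> S \<in> sets (borel \<Otimes>\<^sub>M (borel :: (real^'n) measure))" for S
      unfolding borel_prod by (rule cone_shell_borel)
    define w where "w z = (1 + fst z) powr (- \<beta>')" for z :: "real \<times> (real^'n)"
    have w: "0 \<le> w z" for z by (simp add: w_def)
    have w1: "w z \<le> 1" if "W z \<noteq> 0" for z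
    proof -
      have "0 \<le> fst z" using W3 that by (metis prod.collapse)
      then have "w z \<le> (1 + fst z) powr 0" unfolding w_def using \<beta>'0 by (intro powr_mono) auto
      then show ?thesis using \<open>0 \<le> fst z\<close> by simp
    qed
    have int: "integrable lborel (\<lambda>z. W z * (k z * w z))"
      if "k \<in> borel_measurable (borel \<Otimes>\<^sub>M borel)" "\<And>z. 0 \<le> k z" "\<And>z. k z \<le> 1" for k
    proof (rule integrable_mult_bounded[OF W(1)])
      have "(\<lambda>z. k z * w z) \<in> borel_measurable (borel \<Otimes>\<^sub>M borel)"
        unfolding w_def using that(1) by measurable
      then show "(\<lambda>z. k z * w z) \<in> borel_measurable lborel" by (simp add: borel_prod)
      fix z assume "W z \<noteq> 0"
      then have "k z * w z \<le> 1 * 1" using w1 w that by (intro mult_mono) auto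
      then show "\<bar>k z * w z\<bar> \<le> 1" using w[of z] that(2)[of z] by simp
    qed
    define h where "h j z = profile q ((1 + fst z) / 2 ^ j)" for j and z :: "real \<times> (real^'n)"
    have h: "0 \<le> h j z" "h j z \<le> 1" for j z by (auto simp: h_def profile_nonneg profile_le_1)
    have hm: "h j \<in> borel_measurable (borel \<Otimes>\<^sub>M borel)" for j
      unfolding h_def[abs_def] by measurable
    define sh where "sh j z = indicator (cone_shell m \<delta> (2 ^ j)) z * h j z" for j and z :: "real \<times> (real^'n)"
    have sh: "0 \<le> sh j z" "sh j z \<le> 1" for j z using h[of j z] by (auto simp: sh_def indicator_def)
    have shm: "sh j \<in> borel_measurable (borel \<Otimes>\<^sub>M borel)" for j
      unfolding sh_def[abs_def] using hm by measurable
    define k where "k j z = (if 1 + fst z < 2 ^ (j - 1) then 1 else 0 :: real)" for j and z :: "real \<times> (real^'n)"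
    have k: "0 \<le> k j z" "k j z \<le> 1" for j z by (auto simp: k_def)
    have km: "k j \<in> borel_measurable (borel \<Otimes>\<^sub>M borel)" for j
      unfolding k_def[abs_def] by measurable
    \<comment> \<open>E_j is the mass of s < 2^(j-1), where the cutoff of shell j is 1, hence E_j
      \<le> Y_j. D_j is the mass of 2^(j-1) \<le> s < 2^j, outside of which the integrand of P_j
      vanishes, hence P_j \<le> D_j. The half-open ranges are disjoint, so the sums of D_j
      telescope.\<close>
    define Y where "Y j = (LINT z|lborel. W z * (h j z * w z))" for j
    define P where "P j = (LINT z|lborel. W z * (sh j z * w z))" for j
    define E where "E j = (LINT z|lborel. W z * (k j z * w z))" for j
    define D where "D j = E (Suc j) - E j" for j
    have E0: "0 \<le> E j" and P0: "0 \<le> P j" and Y0: "0 \<le> Y j" for j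
      unfolding E_def P_def Y_def using W(2) w k sh h
      by (auto intro!: integral_nonneg mult_nonneg_nonneg)
    have PY: "P j \<le> Y j" for j
      unfolding P_def Y_def
    proof (intro integral_mono int hm shm h sh)
      fix z show "W z * (sh j z * w z) \<le> W z * (h j z * w z)"
        using W(2) w h by (intro mult_left_mono mult_right_mono) (auto simp: sh_def indicator_def)
    qed
    have EY: "E j \<le> Y j" if "1 \<le> j" for j
      unfolding E_def Y_def
    proof (intro integral_mono int hm km h k)
      fix z
      have "k j z \<le> h j z"
      proof (cases "1 + fst z < 2 ^ (j - 1)")
        case True
        have "(2::real) ^ j = 2 * 2 ^ (j - 1)" using that by (cases j) auto
        then have "(1 + fst z) / 2 ^ j \<le> 1 / 2" using True by (simp add: divide_le_eq)
        then show ?thesis using True by (simp add: k_def h_def profile_eq_1)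
      qed (use h in \<open>simp add: k_def\<close>)
      then show "W z * (k j z * w z) \<le> W z * (h j z * w z)"
        using W(2) w by (intro mult_left_mono mult_right_mono)
    qed
    have PD: "P j \<le> D j" if "1 \<le> j" for j
    proof -
      have "D j = (LINT z|lborel. W z * (k (Suc j) z * w z) - W z * (k j z * w z))"
        unfolding D_def E_def by (intro Bochner_Integration.integral_diff[symmetric] int km k)
      moreover have "P j \<le> (LINT z|lborel. W z * (k (Suc j) z * w z) - W z * (k j z * w z))"
        unfolding P_def
      proof (intro integral_mono int shm sh Bochner_Integration.integrable_diff km k)
        fix z
        have pw: "(2::real) ^ j = 2 * 2 ^ (j - 1)" using that by (cases j) auto
        have "0 < q" using q p'(1) by (cases q) (auto simp: p'_def[symmetric])
        have le: "sh j z \<le> k (Suc j) z - k j z"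
        proof (cases "2 ^ (j - 1) \<le> 1 + fst z \<and> 1 + fst z < 2 ^ j")
          case True
          then show ?thesis using sh(2)[of j z] by (simp add: k_def)
        next
          case False
          have "sh j z = 0"
          proof (cases "1 + fst z < 2 ^ (j - 1)")
            case True
            then have "z \<notin> cone_shell m \<delta> (2 ^ j)" by (auto simp: cone_shell_def pw)
            then show ?thesis by (simp add: sh_def)
          next
            case F: False
            then have "1 \<le> (1 + fst z) / 2 ^ j" using False by simp
            then show ?thesis using \<open>0 < q\<close> by (simp add: sh_def h_def profile_eq_0)
          qed
          moreover have "k j z \<le> k (Suc j) z"
            using pw by (auto simp: k_def intro: less_le_trans)
          ultimately show ?thesis by simp
        qed
        have "W z * (sh j z * w z) \<le> W z * ((k (Suc j) z - k j z) * w z)"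
          using W(2) w le by (intro mult_left_mono mult_right_mono) auto
        then show "W z * (sh j z * w z) \<le> W z * (k (Suc j) z * w z) - W z * (k j z * w z)"
          by (simp add: algebra_simps)
      qed
      ultimately show ?thesis by simp
    qed
    \<comment> \<open>Shells start at j = 2, because S > 2 is needed for the cutoff to be 1 near
      time 0.\<close>
    have S: "2 < (2::real) ^ j" "(2::real) ^ j \<le> 1 + T0" if "j \<in> {2..J}" for j
    proof -
      have "(2::real) ^ 1 < 2 ^ j" using that by (intro power_strict_increasing) auto
      then show "2 < (2::real) ^ j" by simp
      show "(2::real) ^ j \<le> 1 + T0" using that by (auto simp: T0_def intro: power_increasing)
    qed
    have Peq: "(LINT z|lborel. W z * (indicator (cone_shell m \<delta> (2 ^ j)) z
              * ((1 + fst z) powr (- \<beta>') * profile q ((1 + fst z) / 2 ^ j)))) = P j" for j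
      unfolding P_def sh_def w_def h_def by (simp only: mult_ac)
    have Yeq: "(LINT z|lborel. W z * ((1 + fst z) powr (- \<beta>') * profile q ((1 + fst z) / 2 ^ j))) = Y j" for j
      unfolding Y_def w_def h_def by (simp only: mult_ac)
    \<comment> \<open>From \<kappa> = 1: the integral on the left is dropped and only the data are
      kept, while the sum over the layers is at most the convergent series \<open>Z\<close>.\<close>
    have low: "a * \<epsilon> powr p \<le> D j" if j: "j \<in> {2..J}" for j
    proof -
      have "0 \<le> (LINT z|lborel. W z * ((1 + fst z) powr (- \<beta>1) * profile q ((1 + fst z) / 2 ^ j)))"
        using W(2) profile_nonneg by (auto intro!: integral_nonneg mult_nonneg_nonneg)
      then have "\<epsilon> * I \<beta>1 \<le> C1 * P j powr (1 / p)
          * (\<Sum>k=1..nat \<lceil>(2 ^ j) powr m / (m * \<delta>)\<rceil>. real k powr (- p')) powr (1 - 1 / p)"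
        using test1[OF \<epsilon> ws T0 S[OF j] W(1) W2 W3 W(4)] unfolding Peq by linarith
      also have "\<dots> \<le> C1 * D j powr (1 / p) * Z powr (1 - 1 / p)"
        using C1 P0[of j] PD[of j] j Zle k01 p(1)
        by (intro mult_mono mult_left_mono powr_mono2 sum_nonneg mult_nonneg_nonneg) auto
      finally have "\<epsilon> * I \<beta>1 \<le> C1 * Z powr (1 - 1 / p) * D j powr (1 / p)" by (simp add: mult_ac)
      then have "\<epsilon> * X \<le> D j powr (1 / p)"
        using C1 Z by (simp add: X_def field_simps)
      then have "(\<epsilon> * X) powr p \<le> (D j powr (1 / p)) powr p"
        using \<epsilon> X(1) p(1) by (intro powr_mono2) auto
      moreover have "0 \<le> D j" using P0[of j] PD[of j] j by simp
      ultimately show ?thesis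
        using p(1) unfolding powr_mult X(2) by (simp add: powr_powr mult.commute)
    qed
    have up: "Y j \<le> C2 * P j powr (1 / p) * (B0 * real j) powr (1 - 1 / p)" if j: "j \<in> {2..J}" for j
    proof -
      have "Y j \<le> C2 * P j powr (1 / p)
          * (\<Sum>k=1..nat \<lceil>(2 ^ j) powr m / (m * \<delta>)\<rceil>. real k powr (- 1)) powr (1 - 1 / p)"
        using test2[OF \<epsilon> ws T0 S[OF j] W(1) W2 W3 W(4)] mult_nonneg_nonneg[OF less_imp_le[OF \<epsilon>] I']
        unfolding Peq Yeq by linarith
      also have "\<dots> \<le> C2 * P j powr (1 / p) * (B0 * real j) powr (1 - 1 / p)"
        using C2 k01 log_sum[of j] j
        by (intro mult_left_mono powr_mono2 sum_nonneg mult_nonneg_nonneg) auto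
      finally show ?thesis .
    qed
    have sumD: "(\<Sum>i=2..<j. D i) \<le> E j" if "j \<in> {2..J}" for j
    proof -
      have "(\<Sum>i=2..<j. D i) = E j - E 2"
        unfolding D_def using that by (intro sum_Suc_diff') auto
      then show ?thesis using E0[of 2] by simp
    qed
    \<comment> \<open>The blow-up bound is used with e = \<epsilon>^p, which yields the exponent -p
      (p - 1).\<close>
    have "real J \<le> C * (1 + (\<epsilon> powr p) powr (1 - p))"
    proof (rule blowup[of _ J D], goal_cases)
      case 1 show ?case using \<epsilon> by simp
    next
      case 2 show ?case using low by blast
    next
      case 3
      show ?case
      proof
        fix j assume j: "j \<in> {2..J}"
        \<comment> \<open>With P_j \<le> Y_j the second inequality contains Y_j on both sides;
          dividing by Y_j^(1/p) leaves Y_j^(1 - 1/p), and (1 - 1/p) p' = 1 makes the result linear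
          in j.\<close>
        have "Y j \<le> C2 powr p' * B0 * real j"
        proof (cases "Y j = 0")
          case True
          then show ?thesis using B0 by simp
        next
          case False
          then have Yp: "0 < Y j" using Y0[of j] by simp
          have "Y j \<le> C2 * P j powr (1 / p) * (B0 * real j) powr (1 - 1 / p)" by (rule up[OF j])
          also have "\<dots> \<le> C2 * Y j powr (1 / p) * (B0 * real j) powr (1 - 1 / p)"
            using C2 P0 PY p(1) by (intro mult_right_mono mult_left_mono powr_mono2) auto
          finally have "Y j powr (1 - 1 / p) \<le> C2 * (B0 * real j) powr (1 - 1 / p)"
            using Yp by (simp add: powr_diff field_simps)
          then have "(Y j powr (1 - 1 / p)) powr p' \<le> (C2 * (B0 * real j) powr (1 - 1 / p)) powr p'"
            using p' by (intro powr_mono2) auto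
          then show ?thesis
            using Yp C2 B0 p'(3) by (simp add: powr_powr powr_mult mult.assoc)
        qed
        also have "\<dots> \<le> B * real j" using B by (intro mult_right_mono) auto
        finally show "(\<Sum>i=2..<j. D i) \<le> B * real j" using sumD[OF j] EY[of j] j by simp
      qed
    next
      case 4
      show ?case
      proof
        fix j assume j: "j \<in> {2..J}"
        have "(\<Sum>i=2..<j. D i) \<le> Y j" using sumD[OF j] EY[of j] j by simp
        also have "\<dots> \<le> C2 * P j powr (1 / p) * (B0 * real j) powr (1 - 1 / p)" by (rule up[OF j])
        also have "\<dots> \<le> C2 * D j powr (1 / p) * (B0 * real j) powr (1 - 1 / p)"
          using C2 P0 PD[of j] j p(1) by (intro mult_right_mono mult_left_mono powr_mono2) auto
        also have "\<dots> = (C2 * B0 powr (1 - 1 / p)) * (D j powr (1 / p) * real j powr (1 - 1 / p))"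
          using B0 by (simp add: powr_mult)
        also have "\<dots> \<le> B * (D j powr (1 / p) * real j powr (1 - 1 / p))"
          using B by (intro mult_right_mono) auto
        finally show "(\<Sum>i=2..<j. D i) \<le> B * D j powr (1 / p) * real j powr (1 - 1 / p)"
          by (simp add: mult.assoc)
      qed
    qed
    moreover have "(\<epsilon> powr p) powr (1 - p) = \<epsilon> powr (- (p * (p - 1)))"
      by (simp add: powr_powr algebra_simps)
    ultimately show ?thesis by simp
  qed
  then show ?thesis using C by blast
qed

lemma weak_solution_lifespan_bound:
  fixes f g :: "real^'n \<Rightarrow> real" and l \<mu> R p :: real
  assumes l: "-1 < l" "l \<le> 0" "(1 + l) * real CARD('n) > 1"
    and p: "1 < p" "strauss_poly CARD('n) l p = 0"
    and R: "0 < R" "R < 1 / (1 + l)"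
    and fg: "integrable lebesgue f" "integrable lebesgue g"
    "AE x in lebesgue. 0 \<le> f x" "AE x in lebesgue. 0 \<le> g x"
    and nz: "\<not> ((AE x in lebesgue. f x = 0) \<and> (AE x in lebesgue. g x = 0))"
  shows "\<exists>C>0. \<forall>\<epsilon> T (u :: real \<Rightarrow> real^'n \<Rightarrow> real). 0 < \<epsilon> \<longrightarrow> weak_solution l \<mu> p R \<epsilon> f g T u
    \<longrightarrow> T \<le> ereal (2 powr (C * (1 + \<epsilon> powr (- (p * (p - 1)))) + 1))"
proof -
  obtain C where C: "0 < C" and J: "\<And>\<epsilon> T (u :: real \<Rightarrow> real^'n \<Rightarrow> real) J.
      \<lbrakk>0 < \<epsilon>; weak_solution l \<mu> p R \<epsilon> f g T u; ereal (2 ^ J - 1) < T\<rbrakk>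
      \<Longrightarrow> real J \<le> C * (1 + \<epsilon> powr (- (p * (p - 1))))"
    using weak_solution_dyadic_bound[OF assms, of \<mu>] by blast
  have "T \<le> ereal (2 powr (C * (1 + \<epsilon> powr (- (p * (p - 1)))) + 1))"
    if \<epsilon>: "0 < \<epsilon>" and ws: "weak_solution l \<mu> p R \<epsilon> f g T u"
    for \<epsilon> T and u :: "real \<Rightarrow> real^'n \<Rightarrow> real"
  proof (rule ccontr)
    define X where "X = C * (1 + \<epsilon> powr (- (p * (p - 1))))"
    assume "\<not> T \<le> ereal (2 powr (C * (1 + \<epsilon> powr (- (p * (p - 1)))) + 1))"
    then have T: "ereal (2 powr (X + 1)) < T" by (simp add: X_def not_le)
    have X0: "0 \<le> X" using C by (simp add: X_def add_nonneg_nonneg)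
    \<comment> \<open>The first integer above \<open>X\<close>, one too many for the dyadic bound;
      it is at most X + 1, the exponent in the assumed lower bound for \<open>T\<close>.\<close>
    define j where "j = nat \<lfloor>X\<rfloor> + 1"
    have j: "X < real j" "real j \<le> X + 1" using X0 unfolding j_def by linarith+
    have "(2::real) ^ j = 2 powr real j" by (simp add: powr_realpow)
    also have "\<dots> \<le> 2 powr (X + 1)" using j by (intro powr_mono) auto
    finally have "ereal (2 ^ j - 1) \<le> ereal (2 powr (X + 1))" by simp
    then have "ereal (2 ^ j - 1) < T" using T by (rule le_less_trans)
    from J[OF \<epsilon> ws this] j show False by (simp add: X_def)
  qed
  then show ?thesis using C by blast
qed

theorem theorem4:
  fixes f g :: "real^'n \<Rightarrow> real" and l \<mu> R p :: real
  assumes "-1 < l" and "l \<le> 0" and "(1 + l) * real CARD('n) > 1"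
    and "\<mu>\<^sup>2 > 1 / 4"
    and "p = p_star CARD('n) l"
    and "H1 f" and "L2 g"
    and "AE x in lebesgue. 0 \<le> f x" and "AE x in lebesgue. 0 \<le> g x"
    and "\<not> ((AE x in lebesgue. f x = 0) \<and> (AE x in lebesgue. g x = 0))"
    and "0 < R" and "R < 1 / (1 + l)"
    and "ess_supp f \<union> ess_supp g \<subseteq> cball 0 R"
  shows "(\<forall>\<epsilon>>0. \<forall>T u. weak_solution l \<mu> p R \<epsilon> f g T u \<longrightarrow>
            lifespan l \<mu> p R \<epsilon> f g T u < \<infinity>) \<and>
         (\<exists>\<epsilon>0>0. \<exists>C>0. \<forall>\<epsilon>. 0 < \<epsilon> \<and> \<epsilon> \<le> \<epsilon>0 \<longrightarrow>
            (\<forall>T u. weak_solution l \<mu> p R \<epsilon> f g T u \<longrightarrow>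
               lifespan l \<mu> p R \<epsilon> f g T u \<le> ereal (exp (C * \<epsilon> powr (- (p * (p - 1)))))))"
proof -
  have p: "1 < p" "strauss_poly CARD('n) l p = 0"
    using p_star[OF assms(1-3)] assms(5) by simp_all
  have "L2 f" using assms(6) by (simp add: H1_def)
  then have fg: "integrable lebesgue f" "integrable lebesgue g"
    using assms(7,13) by (auto intro: L2_integrable)
  obtain C where C: "0 < C" and T: "\<And>\<epsilon> T (u :: real \<Rightarrow> real^'n \<Rightarrow> real).
      \<lbrakk>0 < \<epsilon>; weak_solution l \<mu> p R \<epsilon> f g T u\<rbrakk>
      \<Longrightarrow> T \<le> ereal (2 powr (C * (1 + \<epsilon> powr (- (p * (p - 1)))) + 1))"
    using weak_solution_lifespan_bound[OF assms(1-3) p assms(11,12) fg assms(8-10), of \<mu>] by blast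
  \<comment> \<open>Each time in the supremum is itself an existence time of some weak solution with
    the same data, and the bound applies to every such solution.\<close>
  have life: "lifespan l \<mu> p R \<epsilon> f g T u \<le> ereal (2 powr (C * (1 + \<epsilon> powr (- (p * (p - 1)))) + 1))"
    if "0 < \<epsilon>" for \<epsilon> T and u :: "real \<Rightarrow> real^'n \<Rightarrow> real"
    unfolding lifespan_def using T[OF that] by (intro Sup_least) blast
  show ?thesis
  proof (intro conjI allI impI)
    fix \<epsilon> :: real and T and u :: "real \<Rightarrow> real^'n \<Rightarrow> real"
    assume "0 < \<epsilon>"
    from life[OF this, of T u] show "lifespan l \<mu> p R \<epsilon> f g T u < \<infinity>"
      by (rule le_less_trans) simp
  next
    \<comment> \<open>For \<epsilon> \<le> 1 the negative power of \<epsilon> is at least 1 and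
      absorbs the additive constants, whence \<epsilon>0 = 1.\<close>
    have "lifespan l \<mu> p R \<epsilon> f g T u \<le> ereal (exp ((2 * C + 1) * ln 2 * \<epsilon> powr (- (p * (p - 1)))))"
      if \<epsilon>: "0 < \<epsilon>" "\<epsilon> \<le> 1" for \<epsilon> T and u :: "real \<Rightarrow> real^'n \<Rightarrow> real"
    proof -
      define y where "y = \<epsilon> powr (- (p * (p - 1)))"
      have "1 powr (- (p * (p - 1))) \<le> y"
        unfolding y_def using \<epsilon> p(1) by (intro powr_mono2') auto
      then have y: "1 \<le> y" by simp
      have "C * (1 + y) + 1 \<le> C * (y + y) + y"
        using y C by (intro add_mono mult_left_mono) auto
      then have "C * (1 + y) + 1 \<le> (2 * C + 1) * y" by (simp add: algebra_simps)
      then have "2 powr (C * (1 + y) + 1) \<le> 2 powr ((2 * C + 1) * y)" by (intro powr_mono) auto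
      also have "\<dots> = exp ((2 * C + 1) * ln 2 * y)" by (simp add: powr_def mult_ac)
      finally show ?thesis
        using life[OF \<epsilon>(1), of T u] by (auto simp: y_def intro: order_trans)
    qed
    moreover have "0 < (2 * C + 1) * ln 2" using C by simp
    ultimately show "\<exists>\<epsilon>0>0. \<exists>C>0. \<forall>\<epsilon>. 0 < \<epsilon> \<and> \<epsilon> \<le> \<epsilon>0 \<longrightarrow>
            (\<forall>T (u :: real \<Rightarrow> real^'n \<Rightarrow> real). weak_solution l \<mu> p R \<epsilon> f g T u \<longrightarrow>
               lifespan l \<mu> p R \<epsilon> f g T u \<le> ereal (exp (C * \<epsilon> powr (- (p * (p - 1))))))"
      by (intro exI[of _ 1] exI[of _ "(2 * C + 1) * ln 2"]) auto
  qed
qed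

end
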